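(* Let $\mathbb{K}$ be a field and let $p,q,\lambda,\mu\in\mathbb{K}^{\ast}$. Assume that neither $p$ nor $q$ is a root of unity. Then the center of $\mathcal{A}_p(\lambda,\mu,\mathbb{K}_q[s,t])$ is $\mathbb{K}$. Furthermore, $\mathcal{A}_p(\lambda,\mu,\mathbb{K}_q[s,t])$ is universally cancellative; and thus it is strongly cancellative and cancellative.
   Context: For a field $\mathbb{K}$ and $p,q,\lambda,\mu\in\mathbb{K}^{\ast}$, $\mathcal{A}_p(\lambda,\mu,\mathbb{K}_q[s,t])$ denotes the associative unital $\mathbb{K}$-algebra generated by $x,y,s,t$ subject to the relations $$xy-pyx=1,\quad st=qts,\quad sx=\lambda xs,\quad sy=\lambda^{-1}ys,\quad tx=\mu xt,\quad ty=\mu^{-1}yt.$$ The number $1$ counts as a root of unity. Let $A$ be a $\mathbb{K}$-algebra. (1) $A$ is cancellative if $A[w]\cong B[w]$ for some $\mathbb{K}$-algebra $B$ implies $A\cong B$ as $\mathbb{K}$-algebras. (2) $A$ is strongly cancellative if, for any $d\ge 1$, $A[w_1,\dots,w_d]\cong B[w_1,\dots,w_d]$ for some $\mathbb{K}$-algebra $B$ implies $A\cong B$ as $\mathbb{K}$-algebras. (3) $A$ is universally cancellative if, for any finitely generated commutative $\mathbb{K}$-algebra $R$ that is a domain and satisfies $R/I=\mathbb{K}$ for some ideal $I\subset R$, and for any $\mathbb{K}$-algebra $B$, $A\otimes_{\mathbb{K}} R\cong B\otimes_{\mathbb{K}} R$ implies $A\cong B$ as $\mathbb{K}$-algebras. Here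 the variables $w,w_i$ are central polynomial variables and all isomorphisms are $\mathbb{K}$-algebra isomorphisms. *)

theory Defs
  imports "HOL-Algebra.UnivPoly" "HOL-Algebra.QuotRing" "HOL-Algebra.Generated_Rings" "HOL-Library.Multiset"
begin

(* HOL-Algebra's locale "algebra" demands a commutative algebra, so associative unital
   algebras need their own locale. *)
locale assoc_algebra = module K A + A: ring A for K (structure) and A (structure) +
  assumes smult_mult_left:
      "\<lbrakk>c \<in> carrier K; a \<in> carrier A; b \<in> carrier A\<rbrakk>
        \<Longrightarrow> (c \<odot>\<^bsub>A\<^esub> a) \<otimes>\<^bsub>A\<^esub> b = c \<odot>\<^bsub>A\<^esub> (a \<otimes>\<^bsub>A\<^esub> b)"
    and smult_mult_right:
      "\<lbrakk>c \<in> carrier K; a \<in> carrier A; b \<in> carrier A\<rbrakk>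
        \<Longrightarrow> a \<otimes>\<^bsub>A\<^esub> (c \<odot>\<^bsub>A\<^esub> b) = c \<odot>\<^bsub>A\<^esub> (a \<otimes>\<^bsub>A\<^esub> b)"

definition alg_iso ::
  "('k, 'z) ring_scheme \<Rightarrow> ('k, 'a, 'd) module_scheme \<Rightarrow> ('k, 'b, 'e) module_scheme \<Rightarrow> ('a \<Rightarrow> 'b) set"
  where "alg_iso K A B =
    {h \<in> ring_iso A B. \<forall>c \<in> carrier K. \<forall>a \<in> carrier A. h (c \<odot>\<^bsub>A\<^esub> a) = c \<odot>\<^bsub>B\<^esub> h a}"

definition alg_isomorphic ::
  "('k, 'z) ring_scheme \<Rightarrow> ('k, 'a, 'd) module_scheme \<Rightarrow> ('k, 'b, 'e) module_scheme \<Rightarrow> bool"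
  where "alg_isomorphic K A B \<longleftrightarrow> alg_iso K A B \<noteq> {}"

definition ring_center :: "('a, 'm) ring_scheme \<Rightarrow> 'a set"
  where "ring_center A = {z \<in> carrier A. \<forall>a \<in> carrier A. z \<otimes>\<^bsub>A\<^esub> a = a \<otimes>\<^bsub>A\<^esub> z}"

definition root_of_unity :: "('k, 'z) ring_scheme \<Rightarrow> 'k \<Rightarrow> bool"
  where "root_of_unity K c \<longleftrightarrow> (\<exists>n::nat. n \<ge> 1 \<and> c [^]\<^bsub>K\<^esub> n = \<one>\<^bsub>K\<^esub>)"

(* The ring R (other record fields dropped) with the given action of scalars. *)
definition with_scalars :: "('a, 'm) ring_scheme \<Rightarrow> ('k \<Rightarrow> 'a \<Rightarrow> 'a) \<Rightarrow> ('k, 'a) module"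
  where "with_scalars R act = ring.extend (ring.truncate R) (module.fields act)"

definition ground_alg :: "('k, 'z) ring_scheme \<Rightarrow> ('k, 'k) module"
  where "ground_alg K = with_scalars K (\<lambda>c x. c \<otimes>\<^bsub>K\<^esub> x)"

(* On cosets, c . (I + x) = I + c x, written in the style of rcoset_mult. *)
definition quot_alg :: "('k, 'a, 'd) module_scheme \<Rightarrow> 'a set \<Rightarrow> ('k, 'a set) module"
  where "quot_alg A I = with_scalars (A Quot I) (\<lambda>c C. \<Union>x\<in>C. I +>\<^bsub>A\<^esub> (c \<odot>\<^bsub>A\<^esub> x))"

(* The monoid ring A[M]: finitely supported functions from M to A with convolution as product.
   Elements of A commute with elements of M. *)
definition monoid_alg ::
  "('k, 'a, 'd) module_scheme \<Rightarrow> ('m, 'n) monoid_scheme \<Rightarrow> ('k, 'm \<Rightarrow> 'a) module"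
  where "monoid_alg A M =
    \<lparr>carrier = {f. (\<forall>m. f m \<in> carrier A) \<and> (\<forall>m. m \<notin> carrier M \<longrightarrow> f m = \<zero>\<^bsub>A\<^esub>)
                  \<and> finite {m. f m \<noteq> \<zero>\<^bsub>A\<^esub>}},
     monoid.mult = (\<lambda>f g m. \<Oplus>\<^bsub>A\<^esub>z \<in> {(u, v). u \<in> carrier M \<and> v \<in> carrier M \<and> f u \<noteq> \<zero>\<^bsub>A\<^esub>
                  \<and> g v \<noteq> \<zero>\<^bsub>A\<^esub> \<and> u \<otimes>\<^bsub>M\<^esub> v = m}. f (fst z) \<otimes>\<^bsub>A\<^esub> g (snd z)),
     one = (\<lambda>m. if m = \<one>\<^bsub>M\<^esub> then \<one>\<^bsub>A\<^esub> else \<zero>\<^bsub>A\<^esub>),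
     zero = (\<lambda>m. \<zero>\<^bsub>A\<^esub>),
     add = (\<lambda>f g m. f m \<oplus>\<^bsub>A\<^esub> g m),
     smult = (\<lambda>c f m. c \<odot>\<^bsub>A\<^esub> f m)\<rparr>"

definition basis_elt :: "('a, 'm) ring_scheme \<Rightarrow> 'w \<Rightarrow> 'w \<Rightarrow> 'a"
  where "basis_elt A u = (\<lambda>m. if m = u then \<one>\<^bsub>A\<^esub> else \<zero>\<^bsub>A\<^esub>)"

definition word_monoid :: "'g list monoid"
  where "word_monoid = \<lparr>carrier = UNIV, monoid.mult = (@), one = []\<rparr>"

definition free_alg :: "('k, 'z) ring_scheme \<Rightarrow> ('k, 'g list \<Rightarrow> 'k) module"
  where "free_alg K = monoid_alg (ground_alg K) word_monoid"

datatype gen = GX | GY | GS | GT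

definition quantum_rels ::
  "('k, 'z) ring_scheme \<Rightarrow> 'k \<Rightarrow> 'k \<Rightarrow> 'k \<Rightarrow> 'k \<Rightarrow> (gen list \<Rightarrow> 'k) set"
  where "quantum_rels K p q l m =
    (let F = (free_alg K :: ('k, gen list \<Rightarrow> 'k) module);
         x = basis_elt K [GX]; y = basis_elt K [GY]; s = basis_elt K [GS]; t = basis_elt K [GT]
     in {(x \<otimes>\<^bsub>F\<^esub> y \<ominus>\<^bsub>F\<^esub> p \<odot>\<^bsub>F\<^esub> (y \<otimes>\<^bsub>F\<^esub> x)) \<ominus>\<^bsub>F\<^esub> \<one>\<^bsub>F\<^esub>,
         s \<otimes>\<^bsub>F\<^esub> t \<ominus>\<^bsub>F\<^esub> q \<odot>\<^bsub>F\<^esub> (t \<otimes>\<^bsub>F\<^esub> s),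
         s \<otimes>\<^bsub>F\<^esub> x \<ominus>\<^bsub>F\<^esub> l \<odot>\<^bsub>F\<^esub> (x \<otimes>\<^bsub>F\<^esub> s),
         s \<otimes>\<^bsub>F\<^esub> y \<ominus>\<^bsub>F\<^esub> (inv\<^bsub>K\<^esub> l) \<odot>\<^bsub>F\<^esub> (y \<otimes>\<^bsub>F\<^esub> s),
         t \<otimes>\<^bsub>F\<^esub> x \<ominus>\<^bsub>F\<^esub> m \<odot>\<^bsub>F\<^esub> (x \<otimes>\<^bsub>F\<^esub> t),
         t \<otimes>\<^bsub>F\<^esub> y \<ominus>\<^bsub>F\<^esub> (inv\<^bsub>K\<^esub> m) \<odot>\<^bsub>F\<^esub> (y \<otimes>\<^bsub>F\<^esub> t)})"

(* A_p(lambda, mu, K_q[s,t]), with l = lambda and m = mu *)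
definition quantum_alg ::
  "('k, 'z) ring_scheme \<Rightarrow> 'k \<Rightarrow> 'k \<Rightarrow> 'k \<Rightarrow> 'k \<Rightarrow> ('k, (gen list \<Rightarrow> 'k) set) module"
  where "quantum_alg K p q l m =
    quot_alg (free_alg K) (Idl\<^bsub>free_alg K\<^esub> (quantum_rels K p q l m))"

(* UP A carries the action of A on itself; here the scalars are those of K. *)
definition poly_alg :: "('k, 'a, 'd) module_scheme \<Rightarrow> ('k, nat \<Rightarrow> 'a) module"
  where "poly_alg A = with_scalars (UP A) (\<lambda>c f i. c \<odot>\<^bsub>A\<^esub> f i)"

(* A[w_0, ..., w_(d-1)], with multisets of indices as monomials. *)
definition monomials :: "nat \<Rightarrow> nat multiset monoid"
  where "monomials d = \<lparr>carrier = {u. set_mset u \<subseteq> {..<d}}, monoid.mult = (+), one = {#}\<rparr>"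

definition mpoly_alg :: "nat \<Rightarrow> ('k, 'a, 'd) module_scheme \<Rightarrow> ('k, nat multiset \<Rightarrow> 'a) module"
  where "mpoly_alg d A = monoid_alg A (monomials d)"

(* The tensor product of A and B over K: the free K-module on the pairs (a, b), with product
   (a, b) (a', b') = (a a', b b'), modulo the bilinearity relations. Multiplying a bilinearity
   relation by a pair gives another such relation, so the two-sided ideal generated by the
   relations is just their K-span. *)
definition tensor_free ::
  "('k, 'z) ring_scheme \<Rightarrow> ('k, 'a, 'd) module_scheme \<Rightarrow> ('k, 'b, 'e) module_scheme
    \<Rightarrow> ('k, 'a \<times> 'b \<Rightarrow> 'k) module"
  where "tensor_free K A B = monoid_alg (ground_alg K) (A \<times>\<times> B)"

definition tensor_rels ::
  "('k, 'z) ring_scheme \<Rightarrow> ('k, 'a, 'd) module_scheme \<Rightarrow> ('k, 'b, 'e) module_scheme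
    \<Rightarrow> ('a \<times> 'b \<Rightarrow> 'k) set"
  where "tensor_rels K A B =
    (let F = tensor_free K A B; e = basis_elt K
     in {(e (a \<oplus>\<^bsub>A\<^esub> a', b) \<ominus>\<^bsub>F\<^esub> e (a, b)) \<ominus>\<^bsub>F\<^esub> e (a', b)
          | a a' b. a \<in> carrier A \<and> a' \<in> carrier A \<and> b \<in> carrier B}
      \<union> {(e (a, b \<oplus>\<^bsub>B\<^esub> b') \<ominus>\<^bsub>F\<^esub> e (a, b)) \<ominus>\<^bsub>F\<^esub> e (a, b')
          | a b b'. a \<in> carrier A \<and> b \<in> carrier B \<and> b' \<in> carrier B}
      \<union> {e (c \<odot>\<^bsub>A\<^esub> a, b) \<ominus>\<^bsub>F\<^esub> c \<odot>\<^bsub>F\<^esub> e (a, b)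
          | c a b. c \<in> carrier K \<and> a \<in> carrier A \<and> b \<in> carrier B}
      \<union> {e (a, c \<odot>\<^bsub>B\<^esub> b) \<ominus>\<^bsub>F\<^esub> c \<odot>\<^bsub>F\<^esub> e (a, b)
          | c a b. c \<in> carrier K \<and> a \<in> carrier A \<and> b \<in> carrier B})"

definition tensor_alg ::
  "('k, 'z) ring_scheme \<Rightarrow> ('k, 'a, 'd) module_scheme \<Rightarrow> ('k, 'b, 'e) module_scheme
    \<Rightarrow> ('k, ('a \<times> 'b \<Rightarrow> 'k) set) module"
  where "tensor_alg K A B = quot_alg (tensor_free K A B) (Idl\<^bsub>tensor_free K A B\<^esub> (tensor_rels K A B))"

definition fin_gen_alg :: "('k, 'z) ring_scheme \<Rightarrow> ('k, 'a, 'd) module_scheme \<Rightarrow> bool"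
  where "fin_gen_alg K A \<longleftrightarrow>
    (\<exists>S. finite S \<and> S \<subseteq> carrier A \<and>
      generate_ring A ((\<lambda>c. c \<odot>\<^bsub>A\<^esub> \<one>\<^bsub>A\<^esub>) ` carrier K \<union> S) = carrier A)"

(* A definition cannot quantify over types, so the types carrying the test algebras B (and R)
   are arguments; "for all algebras" is the statement with these as free type variables. *)
definition cancellative ::
  "('k, 'z) ring_scheme \<Rightarrow> ('k, 'a, 'd) module_scheme \<Rightarrow> 'b itself \<Rightarrow> bool"
  where "cancellative K A (B_type :: 'b itself) \<longleftrightarrow>
    (\<forall>B :: ('k, 'b) module. assoc_algebra K B \<longrightarrow>
      alg_isomorphic K (poly_alg A) (poly_alg B) \<longrightarrow> alg_isomorphic K A B)"

definition strongly_cancellative ::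
  "('k, 'z) ring_scheme \<Rightarrow> ('k, 'a, 'd) module_scheme \<Rightarrow> 'b itself \<Rightarrow> bool"
  where "strongly_cancellative K A (B_type :: 'b itself) \<longleftrightarrow>
    (\<forall>d \<ge> 1. \<forall>B :: ('k, 'b) module. assoc_algebra K B \<longrightarrow>
      alg_isomorphic K (mpoly_alg d A) (mpoly_alg d B) \<longrightarrow> alg_isomorphic K A B)"

definition universally_cancellative ::
  "('k, 'z) ring_scheme \<Rightarrow> ('k, 'a, 'd) module_scheme \<Rightarrow> 'r itself \<Rightarrow> 'b itself \<Rightarrow> bool"
  where "universally_cancellative K A (R_type :: 'r itself) (B_type :: 'b itself) \<longleftrightarrow>
    (\<forall>R :: ('k, 'r) module. assoc_algebra K R \<longrightarrow> domain R \<longrightarrow> fin_gen_alg K R \<longrightarrow>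
      (\<exists>I. ideal I R \<and> alg_isomorphic K (quot_alg R I) (ground_alg K)) \<longrightarrow>
      (\<forall>B :: ('k, 'b) module. assoc_algebra K B \<longrightarrow>
        alg_isomorphic K (tensor_alg K A R) (tensor_alg K B R) \<longrightarrow> alg_isomorphic K A B))"

end

theory Submission
  imports Defs "HOL-Library.Multiset_Order"
begin

text \<open>
  The center decides cancellation.  Suppose that \<open>A\<close> has center \<open>K\<close> and that one algebra \<open>T\<close> is
  both \<open>A \<otimes> R\<close> and \<open>B \<otimes> R\<close>, where \<open>R\<close> is a finitely generated commutative domain with a character
  \<open>e : R \<rightarrow> K\<close>.  The center of \<open>A \<otimes> R\<close> is \<open>R\<close>.  The second decomposition puts the center \<open>Z\<close> of \<open>B\<close>
  and another copy of \<open>R\<close> into the center of \<open>T\<close>, so \<open>Z \<otimes> R\<close> sits inside \<open>R\<close>, and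
  the second copy of \<open>R\<close> is the image of an endomorphism \<open>\<theta>\<close> of \<open>R\<close>.

  If some \<open>z\<close> in \<open>Z\<close> were transcendental over \<open>K\<close>, then \<open>z\<close>, \<open>\<theta> z\<close>, \<open>\<theta> (\<theta> z)\<close>, ... would be
  algebraically independent in \<open>R\<close>, because the powers of \<open>z\<close> are independent over \<open>\<theta> R\<close>
  (\<open>monomials_independent\<close>).  An algebra with \<open>k\<close> commuting generators has no \<open>k + 1\<close> such
  elements: its monomials of bounded degree are too few (\<open>fin_gen_dependent_monomials\<close>).  Hence
  every \<open>z\<close> in \<open>Z\<close> is algebraic; after subtraction of its value under \<open>e\<close> it lies in the kernel
  of a character of a domain and is algebraic, so it vanishes.  Therefore \<open>Z = K\<close>, the two copies
  of \<open>R\<close> coincide, and \<open>A\<close> and \<open>B\<close> are both the quotient of \<open>T\<close> by the ideal that the kernel of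
  \<open>e\<close> generates (\<open>factors_isomorphic\<close>).

  The argument uses of \<open>T = A \<otimes> R\<close> only the maps \<open>id \<otimes> \<phi> : T \<rightarrow> A\<close> for linear functionals \<open>\<phi>\<close>
  on \<open>R\<close>, which is what \<open>tensor_decomposition\<close> records.  They exist on the tensor product defined
  by generators and relations (\<open>tensor_alg_decomposition\<close>) and, with \<open>R = K[M]\<close>, on the monoid
  algebra \<open>A[M]\<close> (\<open>monoid_alg_decomposition\<close>).  Polynomial extensions in one or several variables
  are thus covered by the same theorem.

  It remains to see that the quantum algebra has center \<open>K\<close>.  The monomials \<open>y\<^sup>a x\<^sup>b s\<^sup>c t\<^sup>d\<close> span it.
  They are independent because the algebra acts on the free module on these monomials by the
  formulas for left multiplication, and a monomial sends the basis vector of \<open>1\<close> to its own basis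
  vector (\<open>coords_expand\<close>, \<open>expand_surj\<close>).  For the coefficients \<open>f a b c d\<close> of a central element, commuting
  with \<open>x\<close> links \<open>f a b c d\<close> to \<open>f (a + 1) (b + 1) c d\<close> with the factor \<open>1 + p + ... + p\<^sup>a\<close>, which is
  not zero as \<open>p\<close> is not a root of unity.  Together with \<open>y\<close> this leaves only \<open>a = b\<close>; then
  commuting with \<open>s\<close> and \<open>t\<close> gives \<open>q\<^sup>d = 1\<close> and \<open>q\<^sup>c = 1\<close>, hence \<open>c = d = 0\<close>; and on the remaining diagonal
  \<open>x\<close> propagates zero from \<open>a = 1\<close> onwards (\<open>central_coords_supported_at_origin\<close>).
\<close>

section \<open>Additive maps and algebra homomorphisms\<close>

definition additive_map ::
  "('a, 'm) ring_scheme \<Rightarrow> ('b, 'n) ring_scheme \<Rightarrow> ('a \<Rightarrow> 'b) \<Rightarrow> bool"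
  where "additive_map V W f \<longleftrightarrow> f \<in> carrier V \<rightarrow> carrier W \<and>
    (\<forall>x \<in> carrier V. \<forall>y \<in> carrier V. f (x \<oplus>\<^bsub>V\<^esub> y) = f x \<oplus>\<^bsub>W\<^esub> f y)"

lemma additive_mapI:
  assumes "\<And>x. x \<in> carrier V \<Longrightarrow> f x \<in> carrier W"
    and "\<And>x y. x \<in> carrier V \<Longrightarrow> y \<in> carrier V \<Longrightarrow> f (x \<oplus>\<^bsub>V\<^esub> y) = f x \<oplus>\<^bsub>W\<^esub> f y"
  shows "additive_map V W f"
  using assms by (auto simp: additive_map_def)

lemma additive_map_closed: "additive_map V W f \<Longrightarrow> x \<in> carrier V \<Longrightarrow> f x \<in> carrier W"
  by (auto simp: additive_map_def)

lemma additive_map_add: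
  "additive_map V W f \<Longrightarrow> x \<in> carrier V \<Longrightarrow> y \<in> carrier V \<Longrightarrow> f (x \<oplus>\<^bsub>V\<^esub> y) = f x \<oplus>\<^bsub>W\<^esub> f y"
  by (auto simp: additive_map_def)

lemma additive_map_hom:
  assumes "abelian_group V" "abelian_group W" "additive_map V W f"
  shows "abelian_group_hom V W f"
proof -
  interpret V: abelian_group V by fact
  interpret W: abelian_group W by fact
  show ?thesis
    by (rule abelian_group_homI)
      (use assms in \<open>auto simp: group_hom_def group_hom_axioms_def hom_def additive_map_def
        intro: V.a_group W.a_group\<close>)
qed

lemma additive_map_zero:
  assumes "abelian_group V" "abelian_group W" "additive_map V W f"
  shows "f \<zero>\<^bsub>V\<^esub> = \<zero>\<^bsub>W\<^esub>"
  using abelian_group_hom.hom_zero[OF additive_map_hom[OF assms]] .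

lemma additive_map_a_inv:
  assumes "abelian_group V" "abelian_group W" "additive_map V W f" "x \<in> carrier V"
  shows "f (\<ominus>\<^bsub>V\<^esub> x) = \<ominus>\<^bsub>W\<^esub> f x"
  using abelian_group_hom.hom_a_inv[OF additive_map_hom[OF assms(1-3)]] assms(4) by simp

lemma additive_map_minus:
  assumes "abelian_group V" "abelian_group W" "additive_map V W f" "x \<in> carrier V" "y \<in> carrier V"
  shows "f (x \<ominus>\<^bsub>V\<^esub> y) = f x \<ominus>\<^bsub>W\<^esub> f y"
  using assms
  by (simp add: a_minus_def additive_map_add additive_map_a_inv abelian_group.a_inv_closed)

lemma additive_map_finsum:
  assumes "abelian_group V" "abelian_group W" "additive_map V W f" "g \<in> S \<rightarrow> carrier V"
  shows "f (\<Oplus>\<^bsub>V\<^esub>i\<in>S. g i) = (\<Oplus>\<^bsub>W\<^esub>i\<in>S. f (g i))"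
proof -
  interpret V: abelian_group V by fact
  interpret W: abelian_group W by fact
  show ?thesis
  proof (cases "finite S")
    case True
    then show ?thesis using assms(4)
    proof (induction S rule: finite_induct)
      case empty
      then show ?case using additive_map_zero[OF assms(1-3)] by simp
    next
      case (insert x F)
      have "(\<lambda>i. f (g i)) \<in> F \<rightarrow> carrier W" "f (g x) \<in> carrier W"
        using insert.prems additive_map_closed[OF assms(3)] by auto
      then show ?case using insert
        by (simp add: additive_map_add[OF assms(3)])
    qed
  next
    case False
    then show ?thesis
      using additive_map_zero[OF assms(1-3)] by simp
  qed
qed

definition alg_hom ::
  "('k, 'z) ring_scheme \<Rightarrow> ('k, 'a, 'd) module_scheme \<Rightarrow> ('k, 'b, 'e) module_scheme \<Rightarrow> ('a \<Rightarrow> 'b) set"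
  where "alg_hom K A B =
    {h \<in> ring_hom A B. \<forall>c \<in> carrier K. \<forall>a \<in> carrier A. h (c \<odot>\<^bsub>A\<^esub> a) = c \<odot>\<^bsub>B\<^esub> h a}"

lemma alg_homI:
  assumes "additive_map A B h"
    and "\<And>x y. x \<in> carrier A \<Longrightarrow> y \<in> carrier A \<Longrightarrow> h (x \<otimes>\<^bsub>A\<^esub> y) = h x \<otimes>\<^bsub>B\<^esub> h y"
    and "h \<one>\<^bsub>A\<^esub> = \<one>\<^bsub>B\<^esub>"
    and "\<And>c a. c \<in> carrier K \<Longrightarrow> a \<in> carrier A \<Longrightarrow> h (c \<odot>\<^bsub>A\<^esub> a) = c \<odot>\<^bsub>B\<^esub> h a"
  shows "h \<in> alg_hom K A B"
  using assms unfolding alg_hom_def additive_map_def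
  by (auto intro!: ring_hom_memI)

lemma alg_homD:
  assumes "h \<in> alg_hom K A B"
  shows "additive_map A B h"
    and "x \<in> carrier A \<Longrightarrow> h x \<in> carrier B"
    and "x \<in> carrier A \<Longrightarrow> y \<in> carrier A \<Longrightarrow> h (x \<oplus>\<^bsub>A\<^esub> y) = h x \<oplus>\<^bsub>B\<^esub> h y"
    and "x \<in> carrier A \<Longrightarrow> y \<in> carrier A \<Longrightarrow> h (x \<otimes>\<^bsub>A\<^esub> y) = h x \<otimes>\<^bsub>B\<^esub> h y"
    and "h \<one>\<^bsub>A\<^esub> = \<one>\<^bsub>B\<^esub>"
    and "c \<in> carrier K \<Longrightarrow> a \<in> carrier A \<Longrightarrow> h (c \<odot>\<^bsub>A\<^esub> a) = c \<odot>\<^bsub>B\<^esub> h a"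
  using assms unfolding alg_hom_def additive_map_def ring_hom_def by auto

lemma alg_hom_comp:
  assumes "h \<in> alg_hom K A B" "g \<in> alg_hom K B C"
  shows "g \<circ> h \<in> alg_hom K A C"
  by (rule alg_homI)
    (auto intro!: additive_mapI simp: alg_homD[OF assms(1)] alg_homD[OF assms(2)])

lemma alg_iso_altdef: "alg_iso K A B = {h \<in> alg_hom K A B. bij_betw h (carrier A) (carrier B)}"
  by (auto simp: alg_iso_def alg_hom_def ring_iso_def)

lemma alg_iso_inverse:
  assumes A: "assoc_algebra K A" and h: "h \<in> alg_iso K A B"
  shows "inv_into (carrier A) h \<in> alg_iso K B A"
proof -
  interpret assoc_algebra K A by fact
  have hom: "h \<in> alg_hom K A B" and bij: "bij_betw h (carrier A) (carrier B)"
    using h by (auto simp: alg_iso_altdef)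
  let ?g = "inv_into (carrier A) h"
  have cl: "?g x \<in> carrier A" if "x \<in> carrier B" for x
    using bij that by (metis bij_betw_def inv_into_into)
  have hg: "h (?g x) = x" if "x \<in> carrier B" for x
    using bij that by (metis bij_betw_inv_into_right)
  have eq: "?g y = x" if "x \<in> carrier A" "h x = y" for x y
    using bij that by (metis bij_betw_inv_into_left)
  have "?g \<in> alg_hom K B A"
    by (intro alg_homI additive_mapI eq) (auto simp: cl hg alg_homD[OF hom])
  then show ?thesis using bij_betw_inv_into[OF bij] by (simp add: alg_iso_altdef)
qed

lemma alg_iso_comp:
  assumes "h \<in> alg_iso K A B" "g \<in> alg_iso K B C"
  shows "g \<circ> h \<in> alg_iso K A C"
  using assms alg_hom_comp[of h K A B g C] bij_betw_trans
  unfolding alg_iso_altdef by blast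

lemma assoc_algebraI:
  assumes "cring K" "ring A"
    and "\<And>a x. a \<in> carrier K \<Longrightarrow> x \<in> carrier A \<Longrightarrow> a \<odot>\<^bsub>A\<^esub> x \<in> carrier A"
    and "\<And>a b x. a \<in> carrier K \<Longrightarrow> b \<in> carrier K \<Longrightarrow> x \<in> carrier A \<Longrightarrow>
      (a \<oplus>\<^bsub>K\<^esub> b) \<odot>\<^bsub>A\<^esub> x = a \<odot>\<^bsub>A\<^esub> x \<oplus>\<^bsub>A\<^esub> b \<odot>\<^bsub>A\<^esub> x"
    and "\<And>a x y. a \<in> carrier K \<Longrightarrow> x \<in> carrier A \<Longrightarrow> y \<in> carrier A \<Longrightarrow>
      a \<odot>\<^bsub>A\<^esub> (x \<oplus>\<^bsub>A\<^esub> y) = a \<odot>\<^bsub>A\<^esub> x \<oplus>\<^bsub>A\<^esub> a \<odot>\<^bsub>A\<^esub> y"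
    and "\<And>a b x. a \<in> carrier K \<Longrightarrow> b \<in> carrier K \<Longrightarrow> x \<in> carrier A \<Longrightarrow>
      (a \<otimes>\<^bsub>K\<^esub> b) \<odot>\<^bsub>A\<^esub> x = a \<odot>\<^bsub>A\<^esub> (b \<odot>\<^bsub>A\<^esub> x)"
    and "\<And>x. x \<in> carrier A \<Longrightarrow> \<one>\<^bsub>K\<^esub> \<odot>\<^bsub>A\<^esub> x = x"
    and "\<And>a x y. a \<in> carrier K \<Longrightarrow> x \<in> carrier A \<Longrightarrow> y \<in> carrier A \<Longrightarrow>
      (a \<odot>\<^bsub>A\<^esub> x) \<otimes>\<^bsub>A\<^esub> y = a \<odot>\<^bsub>A\<^esub> (x \<otimes>\<^bsub>A\<^esub> y)"
    and "\<And>a x y. a \<in> carrier K \<Longrightarrow> x \<in> carrier A \<Longrightarrow> y \<in> carrier A \<Longrightarrow>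
      x \<otimes>\<^bsub>A\<^esub> (a \<odot>\<^bsub>A\<^esub> y) = a \<odot>\<^bsub>A\<^esub> (x \<otimes>\<^bsub>A\<^esub> y)"
  shows "assoc_algebra K A"
  by (intro assoc_algebra.intro moduleI assoc_algebra_axioms.intro)
    (use assms in \<open>simp_all add: ring.is_abelian_group\<close>)

lemma with_scalars_simps [simp]:
  "carrier (with_scalars R act) = carrier R"
  "monoid.mult (with_scalars R act) = monoid.mult R"
  "one (with_scalars R act) = one R"
  "zero (with_scalars R act) = zero R"
  "add (with_scalars R act) = add R"
  "smult (with_scalars R act) = act"
  by (simp_all add: with_scalars_def ring.defs module.defs)

lemma with_scalars_ring:
  assumes "ring R"
  shows "ring (with_scalars R act)"
proof -
  interpret ring R by fact
  show ?thesis
    by (intro ringI abelian_groupI monoidI)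
      (auto simp: a_ac m_assoc l_distr r_distr intro: l_neg a_inv_closed)
qed

lemma ground_alg_simps [simp]:
  "carrier (ground_alg K) = carrier K"
  "monoid.mult (ground_alg K) = monoid.mult K"
  "one (ground_alg K) = one K"
  "zero (ground_alg K) = zero K"
  "add (ground_alg K) = add K"
  "c \<odot>\<^bsub>ground_alg K\<^esub> x = c \<otimes>\<^bsub>K\<^esub> x"
  by (simp_all add: ground_alg_def)

lemma ground_alg_assoc_algebra:
  assumes "cring K"
  shows "assoc_algebra K (ground_alg K)"
proof -
  interpret cring K by fact
  have "ring (ground_alg K)" unfolding ground_alg_def by (rule with_scalars_ring) (rule ring_axioms)
  then show ?thesis
    by (intro assoc_algebraI) (auto simp: l_distr r_distr m_assoc m_lcomm intro: assms)
qed

section \<open>Subspaces, linear functionals and linear dependence\<close>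

definition subspace ::
  "('k, 'z) ring_scheme \<Rightarrow> ('k, 'v, 'd) module_scheme \<Rightarrow> 'v set \<Rightarrow> bool"
  where "subspace K V W \<longleftrightarrow> W \<subseteq> carrier V \<and> \<zero>\<^bsub>V\<^esub> \<in> W \<and> (\<forall>x \<in> W. \<forall>y \<in> W. x \<oplus>\<^bsub>V\<^esub> y \<in> W) \<and>
    (\<forall>c \<in> carrier K. \<forall>x \<in> W. c \<odot>\<^bsub>V\<^esub> x \<in> W)"

lemma subspaceD:
  assumes "subspace K V W"
  shows "x \<in> W \<Longrightarrow> x \<in> carrier V" and "\<zero>\<^bsub>V\<^esub> \<in> W" and "x \<in> W \<Longrightarrow> y \<in> W \<Longrightarrow> x \<oplus>\<^bsub>V\<^esub> y \<in> W"
    and "c \<in> carrier K \<Longrightarrow> x \<in> W \<Longrightarrow> c \<odot>\<^bsub>V\<^esub> x \<in> W"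
  using assms by (auto simp: subspace_def)

lemma (in module) subspace_a_inv:
  assumes "subspace R M W" "x \<in> W"
  shows "\<ominus>\<^bsub>M\<^esub> x \<in> W"
proof -
  have "(\<ominus> \<one>) \<odot>\<^bsub>M\<^esub> x \<in> W" using assms by (simp add: subspaceD)
  then show ?thesis using assms smult_l_minus[of \<one> x] by (simp add: subspaceD)
qed

definition linear_functional ::
  "('k, 'z) ring_scheme \<Rightarrow> ('k, 'v, 'd) module_scheme \<Rightarrow> ('v \<Rightarrow> 'k) \<Rightarrow> bool"
  where "linear_functional K V \<phi> \<longleftrightarrow> additive_map V K \<phi> \<and>
    (\<forall>c \<in> carrier K. \<forall>v \<in> carrier V. \<phi> (c \<odot>\<^bsub>V\<^esub> v) = c \<otimes>\<^bsub>K\<^esub> \<phi> v)"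

lemma linear_functionalD:
  assumes "linear_functional K V \<phi>"
  shows "additive_map V K \<phi>"
    and "v \<in> carrier V \<Longrightarrow> \<phi> v \<in> carrier K"
    and "v \<in> carrier V \<Longrightarrow> w \<in> carrier V \<Longrightarrow> \<phi> (v \<oplus>\<^bsub>V\<^esub> w) = \<phi> v \<oplus>\<^bsub>K\<^esub> \<phi> w"
    and "c \<in> carrier K \<Longrightarrow> v \<in> carrier V \<Longrightarrow> \<phi> (c \<odot>\<^bsub>V\<^esub> v) = c \<otimes>\<^bsub>K\<^esub> \<phi> v"
  using assms by (auto simp: linear_functional_def additive_map_def)

lemma alg_hom_linear_functional:
  "h \<in> alg_hom K A (ground_alg K) \<Longrightarrow> linear_functional K A h"
  by (auto simp: linear_functional_def additive_map_def alg_hom_def ring_hom_def)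

text \<open>Zorn: the union of a chain of subspaces that avoid \<open>x\<close> is again one.\<close>

lemma (in module) maximal_subspace_avoiding:
  assumes W: "subspace R M W" and x: "x \<notin> W"
  obtains H where "subspace R M H" "W \<subseteq> H" "x \<notin> H"
    "\<And>H'. subspace R M H' \<Longrightarrow> H \<subseteq> H' \<Longrightarrow> x \<notin> H' \<Longrightarrow> H' = H"
proof -
  let ?P = "{H. subspace R M H \<and> W \<subseteq> H \<and> x \<notin> H}"
  have "\<exists>H \<in> ?P. \<forall>X \<in> ?P. H \<subseteq> X \<longrightarrow> X = H"
  proof (rule subset_Zorn_nonempty)
    show "?P \<noteq> {}" using W x by auto
  next
    fix C assume ne: "C \<noteq> {}" and ch: "subset.chain ?P C"
    have sub: "subspace R M H" if "H \<in> C" for H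
      using ch that by (auto simp: subset_chain_def)
    have "subspace R M (\<Union>C)"
      unfolding subspace_def
    proof (intro conjI ballI)
      fix a b assume "a \<in> \<Union>C" "b \<in> \<Union>C"
      then obtain A B where AB: "a \<in> A" "A \<in> C" "b \<in> B" "B \<in> C" by auto
      then have "A \<subseteq> B \<or> B \<subseteq> A" using ch by (auto simp: subset_chain_def)
      then show "a \<oplus>\<^bsub>M\<^esub> b \<in> \<Union>C" using AB sub by (metis Union_iff subsetD subspaceD(3))
    qed (use ne sub in \<open>auto dest: subspaceD\<close>)
    then show "\<Union>C \<in> ?P" using ne ch by (auto simp: subset_chain_def)
  qed
  then obtain H where "subspace R M H" "W \<subseteq> H" "x \<notin> H" and
    max: "\<And>X. subspace R M X \<Longrightarrow> W \<subseteq> X \<Longrightarrow> x \<notin> X \<Longrightarrow> H \<subseteq> X \<Longrightarrow> X = H" by auto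
  then show thesis by (intro that[of H]) auto
qed

lemma (in module) subspace_sum_line:
  assumes H: "subspace R M H" and v: "v \<in> carrier M"
  shows "subspace R M {h \<oplus>\<^bsub>M\<^esub> c \<odot>\<^bsub>M\<^esub> v | h c. h \<in> H \<and> c \<in> carrier R}" (is "subspace R M ?S")
proof -
  have [simp]: "h \<in> carrier M" if "h \<in> H" for h using H that by (rule subspaceD)
  show ?thesis unfolding subspace_def
  proof (intro conjI ballI)
    show "\<zero>\<^bsub>M\<^esub> \<in> ?S"
      using subspaceD(2)[OF H] v by (auto intro!: exI[of _ "\<zero>\<^bsub>M\<^esub>"] exI[of _ "\<zero>"])
  next
    fix x y assume "x \<in> ?S" "y \<in> ?S"
    then obtain h c h' c' where *: "x = h \<oplus>\<^bsub>M\<^esub> c \<odot>\<^bsub>M\<^esub> v" "y = h' \<oplus>\<^bsub>M\<^esub> c' \<odot>\<^bsub>M\<^esub> v"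
      "h \<in> H" "h' \<in> H" "c \<in> carrier R" "c' \<in> carrier R" by blast
    have "x \<oplus>\<^bsub>M\<^esub> y = (h \<oplus>\<^bsub>M\<^esub> h') \<oplus>\<^bsub>M\<^esub> (c \<oplus> c') \<odot>\<^bsub>M\<^esub> v"
      using * v by (simp add: smult_l_distr M.a_ac)
    then show "x \<oplus>\<^bsub>M\<^esub> y \<in> ?S" using * subspaceD(3)[OF H] by blast
  next
    fix a x assume "a \<in> carrier R" "x \<in> ?S"
    then obtain h c where *: "x = h \<oplus>\<^bsub>M\<^esub> c \<odot>\<^bsub>M\<^esub> v" "h \<in> H" "c \<in> carrier R" by blast
    have "a \<odot>\<^bsub>M\<^esub> x = (a \<odot>\<^bsub>M\<^esub> h) \<oplus>\<^bsub>M\<^esub> (a \<otimes> c) \<odot>\<^bsub>M\<^esub> v"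
      using * v \<open>a \<in> _\<close> by (simp add: smult_r_distr smult_assoc1)
    then show "a \<odot>\<^bsub>M\<^esub> x \<in> ?S" using * \<open>a \<in> _\<close> subspaceD(4)[OF H] by blast
  qed (use v in auto)
qed

text \<open>A maximal subspace \<open>H\<close> that contains \<open>W\<close> but not \<open>x\<close> is a complement of the line through
  \<open>x\<close>, since enlarging \<open>H\<close> by any further vector captures \<open>x\<close>. The functional is the coordinate
  along \<open>x\<close>.\<close>

lemma functional_separating:
  assumes "field K" "module K V" and W: "subspace K V W"
    and x: "x \<in> carrier V" "x \<notin> W"
  obtains \<phi> where "linear_functional K V \<phi>" "\<And>w. w \<in> W \<Longrightarrow> \<phi> w = \<zero>\<^bsub>K\<^esub>" "\<phi> x = \<one>\<^bsub>K\<^esub>"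
proof -
  interpret K: field K by fact
  interpret V: module K V by fact
  obtain H where H: "subspace K V H" "W \<subseteq> H" "x \<notin> H" and
    max: "\<And>H'. subspace K V H' \<Longrightarrow> H \<subseteq> H' \<Longrightarrow> x \<notin> H' \<Longrightarrow> H' = H"
    using V.maximal_subspace_avoiding[OF W x(2)] by blast
  have [simp]: "h \<in> carrier V" if "h \<in> H" for h using H(1) that by (rule subspaceD)
  have ex: "\<exists>c \<in> carrier K. \<exists>h \<in> H. v = h \<oplus>\<^bsub>V\<^esub> c \<odot>\<^bsub>V\<^esub> x" if v: "v \<in> carrier V" for v
  proof (cases "v \<in> H")
    case True
    then show ?thesis using x by (intro bexI[of _ "\<zero>\<^bsub>K\<^esub>"] bexI[of _ v]) auto
  next
    case False
    let ?S = "{h \<oplus>\<^bsub>V\<^esub> c \<odot>\<^bsub>V\<^esub> v | h c. h \<in> H \<and> c \<in> carrier K}"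
    have "H \<subseteq> ?S"
    proof
      fix h assume "h \<in> H"
      then have "h = h \<oplus>\<^bsub>V\<^esub> \<zero>\<^bsub>K\<^esub> \<odot>\<^bsub>V\<^esub> v" using v by simp
      with \<open>h \<in> H\<close> show "h \<in> ?S" by blast
    qed
    moreover have "v \<in> ?S"
      using v subspaceD(2)[OF H(1)] by (auto intro!: exI[of _ "\<zero>\<^bsub>V\<^esub>"] exI[of _ "\<one>\<^bsub>K\<^esub>"])
    ultimately have "x \<in> ?S" using max[OF V.subspace_sum_line[OF H(1) v]] False by blast
    then obtain h c where hc: "x = h \<oplus>\<^bsub>V\<^esub> c \<odot>\<^bsub>V\<^esub> v" "h \<in> H" "c \<in> carrier K" by blast
    have "c \<noteq> \<zero>\<^bsub>K\<^esub>" using hc H(3) v by auto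
    then have c: "c \<in> Units K" using hc K.field_Units by auto
    let ?d = "inv\<^bsub>K\<^esub> c"
    have d: "?d \<in> carrier K" using c by simp
    have "?d \<odot>\<^bsub>V\<^esub> x = ?d \<odot>\<^bsub>V\<^esub> h \<oplus>\<^bsub>V\<^esub> v"
      using hc d v c by (simp add: V.smult_r_distr V.smult_assoc1[symmetric])
    then have "v = (\<ominus>\<^bsub>V\<^esub> (?d \<odot>\<^bsub>V\<^esub> h)) \<oplus>\<^bsub>V\<^esub> ?d \<odot>\<^bsub>V\<^esub> x"
      using d hc(2) v x by (simp add: V.r_neg1)
    then show ?thesis using d V.subspace_a_inv[OF H(1)] subspaceD(4)[OF H(1) d hc(2)] by blast
  qed
  have uniq: "c = d" if cd: "c \<in> carrier K" "d \<in> carrier K" "h \<in> H" "k \<in> H"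
    "h \<oplus>\<^bsub>V\<^esub> c \<odot>\<^bsub>V\<^esub> x = k \<oplus>\<^bsub>V\<^esub> d \<odot>\<^bsub>V\<^esub> x" for c d h k
  proof (rule ccontr)
    assume "c \<noteq> d"
    let ?e = "c \<ominus>\<^bsub>K\<^esub> d"
    have e: "?e \<in> carrier K" using cd by simp
    have e0: "?e \<noteq> \<zero>\<^bsub>K\<^esub>" using cd \<open>c \<noteq> d\<close> by simp
    then have eU: "?e \<in> Units K" using e K.field_Units by auto
    have "?e \<odot>\<^bsub>V\<^esub> x = c \<odot>\<^bsub>V\<^esub> x \<oplus>\<^bsub>V\<^esub> \<ominus>\<^bsub>V\<^esub> (d \<odot>\<^bsub>V\<^esub> x)"
      using cd x by (simp add: a_minus_def V.smult_l_distr V.smult_l_minus)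
    also have "c \<odot>\<^bsub>V\<^esub> x = \<ominus>\<^bsub>V\<^esub> h \<oplus>\<^bsub>V\<^esub> (k \<oplus>\<^bsub>V\<^esub> d \<odot>\<^bsub>V\<^esub> x)"
      using cd x V.r_neg1[of h "c \<odot>\<^bsub>V\<^esub> x"] by (simp add: cd(5)[symmetric])
    also have "\<dots> \<oplus>\<^bsub>V\<^esub> \<ominus>\<^bsub>V\<^esub> (d \<odot>\<^bsub>V\<^esub> x) = \<ominus>\<^bsub>V\<^esub> h \<oplus>\<^bsub>V\<^esub> k"
      using cd x by (simp add: V.a_assoc V.r_neg)
    finally have "?e \<odot>\<^bsub>V\<^esub> x \<in> H"
      using cd V.subspace_a_inv[OF H(1)] subspaceD(3)[OF H(1)] by simp
    then have "inv\<^bsub>K\<^esub> ?e \<odot>\<^bsub>V\<^esub> (?e \<odot>\<^bsub>V\<^esub> x) \<in> H" using eU subspaceD(4)[OF H(1)] by simp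
    then have "x \<in> H" using eU x e by (simp add: V.smult_assoc1[symmetric])
    with H(3) show False ..
  qed
  define \<phi> where "\<phi> v = (SOME c. c \<in> carrier K \<and> (\<exists>h \<in> H. v = h \<oplus>\<^bsub>V\<^esub> c \<odot>\<^bsub>V\<^esub> x))" for v
  have \<phi>: "\<phi> v \<in> carrier K \<and> (\<exists>h \<in> H. v = h \<oplus>\<^bsub>V\<^esub> \<phi> v \<odot>\<^bsub>V\<^esub> x)" if "v \<in> carrier V" for v
    unfolding \<phi>_def by (rule someI_ex) (use ex[OF that] in blast)
  have eq: "\<phi> (h \<oplus>\<^bsub>V\<^esub> c \<odot>\<^bsub>V\<^esub> x) = c" if "h \<in> H" "c \<in> carrier K" for h c
    using \<phi>[of "h \<oplus>\<^bsub>V\<^esub> c \<odot>\<^bsub>V\<^esub> x"] that x uniq by (metis V.M.a_closed V.smult_closed subspaceD(1) H(1))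
  have lin: "linear_functional K V \<phi>"
    unfolding linear_functional_def
  proof (intro conjI additive_mapI ballI)
    fix v w assume vw: "v \<in> carrier V" "w \<in> carrier V"
    obtain h k where hk: "h \<in> H" "k \<in> H" "v = h \<oplus>\<^bsub>V\<^esub> \<phi> v \<odot>\<^bsub>V\<^esub> x" "w = k \<oplus>\<^bsub>V\<^esub> \<phi> w \<odot>\<^bsub>V\<^esub> x"
      using \<phi> vw by metis
    have cl: "\<phi> v \<in> carrier K" "\<phi> w \<in> carrier K" using \<phi> vw by auto
    have "v \<oplus>\<^bsub>V\<^esub> w = (h \<oplus>\<^bsub>V\<^esub> \<phi> v \<odot>\<^bsub>V\<^esub> x) \<oplus>\<^bsub>V\<^esub> (k \<oplus>\<^bsub>V\<^esub> \<phi> w \<odot>\<^bsub>V\<^esub> x)"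
      using hk by simp
    also have "\<dots> = (h \<oplus>\<^bsub>V\<^esub> k) \<oplus>\<^bsub>V\<^esub> (\<phi> v \<oplus>\<^bsub>K\<^esub> \<phi> w) \<odot>\<^bsub>V\<^esub> x"
      using hk(1,2) cl x by (simp add: V.smult_l_distr V.M.a_ac)
    finally show "\<phi> (v \<oplus>\<^bsub>V\<^esub> w) = \<phi> v \<oplus>\<^bsub>K\<^esub> \<phi> w"
      using eq subspaceD(3)[OF H(1) hk(1,2)] cl by simp
  next
    fix a v assume av: "a \<in> carrier K" "v \<in> carrier V"
    obtain h where h: "h \<in> H" "v = h \<oplus>\<^bsub>V\<^esub> \<phi> v \<odot>\<^bsub>V\<^esub> x" using \<phi> av by metis
    have cl: "\<phi> v \<in> carrier K" using \<phi> av by auto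
    have "a \<odot>\<^bsub>V\<^esub> v = a \<odot>\<^bsub>V\<^esub> (h \<oplus>\<^bsub>V\<^esub> \<phi> v \<odot>\<^bsub>V\<^esub> x)" using h by simp
    also have "\<dots> = a \<odot>\<^bsub>V\<^esub> h \<oplus>\<^bsub>V\<^esub> (a \<otimes>\<^bsub>K\<^esub> \<phi> v) \<odot>\<^bsub>V\<^esub> x"
      using av h(1) cl x by (simp add: V.smult_r_distr V.smult_assoc1)
    finally show "\<phi> (a \<odot>\<^bsub>V\<^esub> v) = a \<otimes>\<^bsub>K\<^esub> \<phi> v"
      using eq subspaceD(4)[OF H(1) av(1) h(1)] cl av by simp
  qed (use \<phi> in blast)
  have "\<phi> w = \<zero>\<^bsub>K\<^esub>" if "w \<in> W" for w
    using eq[of w "\<zero>\<^bsub>K\<^esub>"] that H(2) x by auto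
  moreover have "\<phi> x = \<one>\<^bsub>K\<^esub>"
    using eq[of "\<zero>\<^bsub>V\<^esub>" "\<one>\<^bsub>K\<^esub>"] subspaceD(2)[OF H(1)] x by auto
  ultimately show thesis using that lin by blast
qed

inductive_set lin_span ::
  "('k, 'z) ring_scheme \<Rightarrow> ('k, 'v, 'd) module_scheme \<Rightarrow> 'v set \<Rightarrow> 'v set"
  for K and V and S where
    zero: "\<zero>\<^bsub>V\<^esub> \<in> lin_span K V S"
  | step: "c \<in> carrier K \<Longrightarrow> s \<in> S \<Longrightarrow> v \<in> lin_span K V S \<Longrightarrow> c \<odot>\<^bsub>V\<^esub> s \<oplus>\<^bsub>V\<^esub> v \<in> lin_span K V S"

lemma lin_span_minimal:
  assumes "subspace K V W" "S \<subseteq> W" shows "lin_span K V S \<subseteq> W"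
proof
  fix v assume "v \<in> lin_span K V S"
  then show "v \<in> W"
    by induction (use assms in \<open>auto dest: subspaceD intro!: subspaceD(3,4)\<close>)
qed

lemma lin_span_mono: "S \<subseteq> S' \<Longrightarrow> lin_span K V S \<subseteq> lin_span K V S'"
proof
  fix v assume "S \<subseteq> S'" "v \<in> lin_span K V S"
  from this(2,1) show "v \<in> lin_span K V S'"
    by induction (auto intro: lin_span.intros)
qed

context module
begin

lemma carrier_subspace: "subspace R M (carrier M)"
  by (auto simp: subspace_def)

lemma lin_span_closed: "S \<subseteq> carrier M \<Longrightarrow> lin_span R M S \<subseteq> carrier M"
  by (rule lin_span_minimal[OF carrier_subspace])

lemma lin_span_base: "S \<subseteq> carrier M \<Longrightarrow> s \<in> S \<Longrightarrow> s \<in> lin_span R M S"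
  using lin_span.step[OF R.one_closed _ lin_span.zero, of s S M] by (auto simp: subset_iff)

lemma subspace_lin_span:
  assumes S: "S \<subseteq> carrier M" shows "subspace R M (lin_span R M S)"
proof -
  have cl: "v \<in> carrier M" if "v \<in> lin_span R M S" for v using lin_span_closed[OF S] that by auto
  show ?thesis unfolding subspace_def
  proof (intro conjI ballI lin_span_closed[OF S] lin_span.zero)
    fix x y assume "x \<in> lin_span R M S" and y: "y \<in> lin_span R M S"
    then show "x \<oplus>\<^bsub>M\<^esub> y \<in> lin_span R M S"
    proof induction
      case (step c s v)
      then have "(c \<odot>\<^bsub>M\<^esub> s \<oplus>\<^bsub>M\<^esub> v) \<oplus>\<^bsub>M\<^esub> y = c \<odot>\<^bsub>M\<^esub> s \<oplus>\<^bsub>M\<^esub> (v \<oplus>\<^bsub>M\<^esub> y)"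
        using S cl y by (intro M.a_assoc) auto
      with step show ?case by (auto intro: lin_span.step)
    qed (use y cl in auto)
  next
    fix a x assume a: "a \<in> carrier R" and "x \<in> lin_span R M S"
    from this(2) show "a \<odot>\<^bsub>M\<^esub> x \<in> lin_span R M S"
    proof induction
      case zero
      then show ?case using a by (simp add: lin_span.zero)
    next
      case (step c s v)
      then have "a \<odot>\<^bsub>M\<^esub> (c \<odot>\<^bsub>M\<^esub> s \<oplus>\<^bsub>M\<^esub> v) = (a \<otimes> c) \<odot>\<^bsub>M\<^esub> s \<oplus>\<^bsub>M\<^esub> a \<odot>\<^bsub>M\<^esub> v"
        using S cl a by (simp add: smult_r_distr smult_assoc1 subset_iff)
      with step a show ?case by (auto intro: lin_span.step)
    qed
  qed
qed

lemma lin_span_finite_sum: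
  assumes S: "finite S" "S \<subseteq> carrier M" and v: "v \<in> lin_span R M S"
  shows "\<exists>c \<in> S \<rightarrow> carrier R. v = (\<Oplus>\<^bsub>M\<^esub>s\<in>S. c s \<odot>\<^bsub>M\<^esub> s)"
  using v
proof induction
  case zero
  have "(\<Oplus>\<^bsub>M\<^esub>s\<in>S. \<zero> \<odot>\<^bsub>M\<^esub> s) = \<zero>\<^bsub>M\<^esub>" using S by (intro M.add.finprod_one_eqI) auto
  then show ?case by (intro bexI[of _ "\<lambda>_. \<zero>"]) auto
next
  case (step a t v)
  then obtain c where c: "c \<in> S \<rightarrow> carrier R" "v = (\<Oplus>\<^bsub>M\<^esub>s\<in>S. c s \<odot>\<^bsub>M\<^esub> s)" by blast
  have t: "t \<in> carrier M" using step S by auto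
  let ?d = "\<lambda>s. (if s = t then a else \<zero>)"
  have cS: "(\<lambda>s. c s \<odot>\<^bsub>M\<^esub> s) \<in> S \<rightarrow> carrier M" using c S by auto
  have dS: "(\<lambda>s. ?d s \<odot>\<^bsub>M\<^esub> s) \<in> S \<rightarrow> carrier M" using step S by auto
  have "a \<odot>\<^bsub>M\<^esub> t = (\<Oplus>\<^bsub>M\<^esub>s\<in>S. if t = s then a \<odot>\<^bsub>M\<^esub> s else \<zero>\<^bsub>M\<^esub>)"
    using step S t by (subst M.add.finprod_singleton) auto
  also have "\<dots> = (\<Oplus>\<^bsub>M\<^esub>s\<in>S. ?d s \<odot>\<^bsub>M\<^esub> s)"
    using dS S by (intro M.add.finprod_cong') auto
  finally have "a \<odot>\<^bsub>M\<^esub> t \<oplus>\<^bsub>M\<^esub> v = (\<Oplus>\<^bsub>M\<^esub>s\<in>S. ?d s \<odot>\<^bsub>M\<^esub> s \<oplus>\<^bsub>M\<^esub> c s \<odot>\<^bsub>M\<^esub> s)"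
    using c(2) M.finsum_addf[OF dS cS] by simp
  also have "\<dots> = (\<Oplus>\<^bsub>M\<^esub>s\<in>S. (?d s \<oplus> c s) \<odot>\<^bsub>M\<^esub> s)"
    using S c step by (intro M.add.finprod_cong') (auto simp: smult_l_distr Pi_iff subset_iff)
  finally show ?case using c step by (intro bexI[of _ "\<lambda>s. ?d s \<oplus> c s"]) auto
qed

end

lemma (in abelian_monoid) finsum_swap:
  assumes "finite I" "finite J" "\<And>i j. i \<in> I \<Longrightarrow> j \<in> J \<Longrightarrow> f i j \<in> carrier G"
  shows "(\<Oplus>i\<in>I. \<Oplus>j\<in>J. f i j) = (\<Oplus>j\<in>J. \<Oplus>i\<in>I. f i j)"
  using assms(1,3)
proof (induction I rule: finite_induct)
  case empty
  then show ?case by simp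
next
  case (insert x F)
  have "(\<Oplus>i\<in>insert x F. \<Oplus>j\<in>J. f i j) = (\<Oplus>j\<in>J. f x j) \<oplus> (\<Oplus>j\<in>J. \<Oplus>i\<in>F. f i j)"
    using insert by (simp add: Pi_iff)
  also have "\<dots> = (\<Oplus>j\<in>J. f x j \<oplus> (\<Oplus>i\<in>F. f i j))"
    using insert by (intro finsum_addf[symmetric]) auto
  also have "\<dots> = (\<Oplus>j\<in>J. \<Oplus>i\<in>insert x F. f i j)"
    using insert by (intro add.finprod_cong') (auto simp: Pi_iff)
  finally show ?case .
qed

text \<open>Gaussian elimination: an equation with a nonzero coefficient expresses one unknown by the
  others, which leaves one equation and one unknown fewer.\<close>

lemma (in field) homogeneous_system_nontrivial:
  assumes "finite I" "finite J" "card I < card J"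
    and "\<And>i j. i \<in> I \<Longrightarrow> j \<in> J \<Longrightarrow> m i j \<in> carrier R"
  shows "\<exists>c \<in> J \<rightarrow> carrier R. (\<exists>j \<in> J. c j \<noteq> \<zero>) \<and> (\<forall>i \<in> I. (\<Oplus>j\<in>J. c j \<otimes> m i j) = \<zero>)"
  using assms
proof (induction I arbitrary: J m rule: finite_induct)
  case empty
  then show ?case by (intro bexI[of _ "\<lambda>_. \<one>"]) (auto simp: card_gt_0_iff)
next
  case (insert k I J m)
  show ?case
  proof (cases "\<forall>j \<in> J. m k j = \<zero>")
    case True
    obtain c where c: "c \<in> J \<rightarrow> carrier R" "\<exists>j \<in> J. c j \<noteq> \<zero>" "\<forall>i \<in> I. (\<Oplus>j\<in>J. c j \<otimes> m i j) = \<zero>"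
      using insert.IH[of J m] insert.prems insert.hyps by auto
    have "(\<Oplus>j\<in>J. c j \<otimes> m k j) = \<zero>"
      using True c(1) by (intro add.finprod_one_eqI) (auto simp: Pi_iff)
    with c show ?thesis by auto
  next
    case False
    then obtain l where l: "l \<in> J" "m k l \<noteq> \<zero>" by auto
    \<comment> \<open>The unknown \<open>c l\<close> is eliminated by means of the equation \<open>k\<close>.\<close>
    let ?J = "J - {l}"
    have mc: "m i j \<in> carrier R" if "i \<in> insert k I" "j \<in> J" for i j using insert.prems that by auto
    have U: "m k l \<in> Units R" using l mc field_Units by auto
    define r where "r j = m k j \<otimes> inv (m k l)" for j
    have r: "r j \<in> carrier R" if "j \<in> J" for j using that mc U by (simp add: r_def)
    have rk: "r j \<otimes> m k l = m k j" if "j \<in> J" for j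
      using that mc U l by (simp add: r_def m_assoc)
    define m' where "m' i j = m i j \<ominus> r j \<otimes> m i l" for i j
    have m'c: "m' i j \<in> carrier R" if "i \<in> insert k I" "j \<in> J" for i j
      using that mc r l by (simp add: m'_def)
    have "card I < card ?J" using insert.prems insert.hyps l by simp
    then obtain c where c: "c \<in> ?J \<rightarrow> carrier R" "\<exists>j \<in> ?J. c j \<noteq> \<zero>"
      "\<forall>i \<in> I. (\<Oplus>j\<in>?J. c j \<otimes> m' i j) = \<zero>"
      using insert.IH[of ?J m'] insert.prems m'c by auto
    have m'0: "m' k j = \<zero>" if "j \<in> J" for j using that rk mc l by (simp add: m'_def)
    have c': "\<forall>i \<in> insert k I. (\<Oplus>j\<in>?J. c j \<otimes> m' i j) = \<zero>"
      using c m'0 by (auto intro!: add.finprod_one_eqI simp: Pi_iff)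
    define e where "e = (\<Oplus>j\<in>?J. c j \<otimes> r j)"
    have cr: "(\<lambda>j. c j \<otimes> r j) \<in> ?J \<rightarrow> carrier R" using c(1) r by auto
    have e: "e \<in> carrier R" unfolding e_def using cr by (rule finsum_closed)
    define d where "d j = (if j = l then \<ominus> e else c j)" for j
    have sum: "(\<Oplus>j\<in>J. d j \<otimes> m i j) = \<zero>" if i: "i \<in> insert k I" for i
    proof -
      have cm: "(\<lambda>j. c j \<otimes> m' i j) \<in> ?J \<rightarrow> carrier R" using c(1) m'c i by auto
      have crm: "(\<lambda>j. c j \<otimes> r j \<otimes> m i l) \<in> ?J \<rightarrow> carrier R"
        using c(1) r mc[OF i] l by (intro Pi_I m_closed) auto
      have split: "c j \<otimes> m i j = c j \<otimes> m' i j \<oplus> c j \<otimes> r j \<otimes> m i l" if "j \<in> ?J" for j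
      proof -
        have "m i j = m' i j \<oplus> r j \<otimes> m i l"
          using that mc[OF i] r l unfolding m'_def a_minus_def
          by (simp add: a_assoc l_neg)
        then have "c j \<otimes> m i j = c j \<otimes> (m' i j \<oplus> r j \<otimes> m i l)" by simp
        then show ?thesis using that c(1) mc[OF i] m'c[OF i] r l
          by (simp add: r_distr m_assoc Pi_iff)
      qed
      have "(\<Oplus>j\<in>?J. d j \<otimes> m i j) = (\<Oplus>j\<in>?J. c j \<otimes> m' i j \<oplus> c j \<otimes> r j \<otimes> m i l)"
        using cm crm by (intro finsum_cong') (auto simp: d_def split Pi_iff)
      also have "\<dots> = (\<Oplus>j\<in>?J. c j \<otimes> m' i j) \<oplus> (\<Oplus>j\<in>?J. c j \<otimes> r j \<otimes> m i l)"
        using cm crm by (rule finsum_addf)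
      also have "(\<Oplus>j\<in>?J. c j \<otimes> m' i j) = \<zero>" using c' i by blast
      also have "(\<Oplus>j\<in>?J. c j \<otimes> r j \<otimes> m i l) = e \<otimes> m i l"
        using mc[OF i] l cr insert.prems unfolding e_def by (intro finsum_ldistr[symmetric]) auto
      also have "\<zero> \<oplus> e \<otimes> m i l = e \<otimes> m i l" using e mc[OF i] l by simp
      finally have "(\<Oplus>j\<in>?J. d j \<otimes> m i j) = e \<otimes> m i l" .
      moreover have "(\<Oplus>j\<in>J. d j \<otimes> m i j) = d l \<otimes> m i l \<oplus> (\<Oplus>j\<in>?J. d j \<otimes> m i j)"
      proof -
        have "J = insert l ?J" using l by auto
        moreover have "(\<Oplus>j\<in>insert l ?J. d j \<otimes> m i j) = d l \<otimes> m i l \<oplus> (\<Oplus>j\<in>?J. d j \<otimes> m i j)"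
          using insert.prems c(1) mc[OF i] e l by (intro finsum_insert) (auto simp: d_def Pi_iff)
        ultimately show ?thesis by simp
      qed
      ultimately show ?thesis using e mc[OF i] l by (simp add: d_def l_minus l_neg)
    qed
    moreover have "d \<in> J \<rightarrow> carrier R" using c(1) e by (auto simp: d_def)
    moreover have "\<exists>j \<in> J. d j \<noteq> \<zero>" using c(2) by (auto simp: d_def)
    ultimately show ?thesis by blast
  qed
qed

text \<open>In terms of the coordinates of the \<open>v j\<close> with respect to \<open>S\<close>, a linear relation is a
  solution of a homogeneous system with more unknowns than equations.\<close>

lemma dependent_if_card_less:
  assumes "field K" "module K V" and S: "finite S" "S \<subseteq> carrier V"
    and J: "finite J" "card S < card J" and v: "\<And>j. j \<in> J \<Longrightarrow> v j \<in> lin_span K V S"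
  shows "\<exists>c \<in> J \<rightarrow> carrier K. (\<exists>j \<in> J. c j \<noteq> \<zero>\<^bsub>K\<^esub>) \<and> (\<Oplus>\<^bsub>V\<^esub>j\<in>J. c j \<odot>\<^bsub>V\<^esub> v j) = \<zero>\<^bsub>V\<^esub>"
proof -
  interpret K: field K by fact
  interpret V: module K V by fact
  have "\<forall>j \<in> J. \<exists>d. d \<in> S \<rightarrow> carrier K \<and> v j = (\<Oplus>\<^bsub>V\<^esub>s\<in>S. d s \<odot>\<^bsub>V\<^esub> s)"
    using V.lin_span_finite_sum[OF S] v by blast
  then obtain d where d: "\<And>j. j \<in> J \<Longrightarrow> d j \<in> S \<rightarrow> carrier K"
    "\<And>j. j \<in> J \<Longrightarrow> v j = (\<Oplus>\<^bsub>V\<^esub>s\<in>S. d j s \<odot>\<^bsub>V\<^esub> s)" by metis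
  obtain c where c: "c \<in> J \<rightarrow> carrier K" "\<exists>j \<in> J. c j \<noteq> \<zero>\<^bsub>K\<^esub>"
    "\<forall>s \<in> S. (\<Oplus>\<^bsub>K\<^esub>j\<in>J. c j \<otimes>\<^bsub>K\<^esub> d j s) = \<zero>\<^bsub>K\<^esub>"
    using K.homogeneous_system_nontrivial[OF S(1) J, of "\<lambda>s j. d j s"] d(1) by blast
  have cl: "c j \<in> carrier K" "s \<in> carrier V" "d j s \<in> carrier K" if "j \<in> J" "s \<in> S" for j s
    using that c(1) S d(1) by (auto simp: Pi_iff)
  have "(\<Oplus>\<^bsub>V\<^esub>j\<in>J. c j \<odot>\<^bsub>V\<^esub> v j) = (\<Oplus>\<^bsub>V\<^esub>j\<in>J. \<Oplus>\<^bsub>V\<^esub>s\<in>S. (c j \<otimes>\<^bsub>K\<^esub> d j s) \<odot>\<^bsub>V\<^esub> s)"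
  proof (rule V.M.finsum_cong'; (intro Pi_I V.M.finsum_closed)?)
    fix j assume j: "j \<in> J"
    have cj: "c j \<in> carrier K" using j c(1) by auto
    have "c j \<odot>\<^bsub>V\<^esub> v j = (\<Oplus>\<^bsub>V\<^esub>s\<in>S. c j \<odot>\<^bsub>V\<^esub> (d j s \<odot>\<^bsub>V\<^esub> s))"
      unfolding d(2)[OF j]
      by (rule additive_map_finsum[of V V])
        (use j cj cl V.abelian_group_axioms in \<open>auto intro!: additive_mapI V.smult_r_distr\<close>)
    then show "c j \<odot>\<^bsub>V\<^esub> v j = (\<Oplus>\<^bsub>V\<^esub>s\<in>S. (c j \<otimes>\<^bsub>K\<^esub> d j s) \<odot>\<^bsub>V\<^esub> s)"
      using j cj cl by (subst V.M.finsum_cong') (auto simp: V.smult_assoc1)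
  qed (use cl in auto)
  also have "\<dots> = (\<Oplus>\<^bsub>V\<^esub>s\<in>S. \<Oplus>\<^bsub>V\<^esub>j\<in>J. (c j \<otimes>\<^bsub>K\<^esub> d j s) \<odot>\<^bsub>V\<^esub> s)"
    using S J cl by (intro V.M.finsum_swap) auto
  also have "\<dots> = \<zero>\<^bsub>V\<^esub>"
  proof (rule V.M.add.finprod_one_eqI)
    fix s assume s: "s \<in> S"
    have "(\<Oplus>\<^bsub>V\<^esub>j\<in>J. (c j \<otimes>\<^bsub>K\<^esub> d j s) \<odot>\<^bsub>V\<^esub> s) = (\<Oplus>\<^bsub>K\<^esub>j\<in>J. c j \<otimes>\<^bsub>K\<^esub> d j s) \<odot>\<^bsub>V\<^esub> s"
      using s cl J S by (intro additive_map_finsum[of K V, symmetric])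
        (auto intro!: additive_mapI V.smult_l_distr K.abelian_group_axioms V.abelian_group_axioms)
    also have "\<dots> = \<zero>\<^bsub>V\<^esub>" using c(3) s S by (simp add: subset_iff)
    finally show "(\<Oplus>\<^bsub>V\<^esub>j\<in>J. (c j \<otimes>\<^bsub>K\<^esub> d j s) \<odot>\<^bsub>V\<^esub> s) = \<zero>\<^bsub>V\<^esub>" .
  qed
  finally show ?thesis using c by blast
qed

section \<open>Monoid algebras\<close>

definition single :: "('a, 'm) ring_scheme \<Rightarrow> 'a \<Rightarrow> 'w \<Rightarrow> 'w \<Rightarrow> 'a"
  where "single A a u = (\<lambda>m. if m = u then a else \<zero>\<^bsub>A\<^esub>)"

definition supp :: "('a, 'm) ring_scheme \<Rightarrow> ('w \<Rightarrow> 'a) \<Rightarrow> 'w set"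
  where "supp A f = {u. f u \<noteq> \<zero>\<^bsub>A\<^esub>}"

locale monoid_algebra = A: assoc_algebra K A + M: monoid M
  for K :: "('k, 'z) ring_scheme" and A :: "('k, 'a, 'd) module_scheme"
    and M :: "('m, 'n) monoid_scheme"
begin

abbreviation F where "F \<equiv> monoid_alg A M"

lemma carrier_iff:
  "f \<in> carrier F \<longleftrightarrow> (\<forall>m. f m \<in> carrier A) \<and> supp A f \<subseteq> carrier M \<and> finite (supp A f)"
  by (auto simp: monoid_alg_def supp_def)

lemma carrierD:
  assumes "f \<in> carrier F"
  shows "f m \<in> carrier A" "supp A f \<subseteq> carrier M" "finite (supp A f)"
  using assms by (auto simp: carrier_iff)

lemma F_simps:
  "\<zero>\<^bsub>F\<^esub> = (\<lambda>m. \<zero>\<^bsub>A\<^esub>)" "f \<oplus>\<^bsub>F\<^esub> g = (\<lambda>m. f m \<oplus>\<^bsub>A\<^esub> g m)" "c \<odot>\<^bsub>F\<^esub> f = (\<lambda>m. c \<odot>\<^bsub>A\<^esub> f m)"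
  "\<one>\<^bsub>F\<^esub> = single A \<one>\<^bsub>A\<^esub> \<one>\<^bsub>M\<^esub>"
  by (simp_all add: monoid_alg_def single_def)

text \<open>The index set in the definition of the product depends on both supports. Boxes that contain
  the supports can be chosen in common for several products, which is how distributivity is
  proved.\<close>

lemma mult_box:
  assumes f: "f \<in> carrier F" and g: "g \<in> carrier F"
    and U: "finite U" "supp A f \<subseteq> U" "U \<subseteq> carrier M"
    and V: "finite V" "supp A g \<subseteq> V" "V \<subseteq> carrier M"
  shows "(f \<otimes>\<^bsub>F\<^esub> g) m = (\<Oplus>\<^bsub>A\<^esub>z\<in>{z \<in> U \<times> V. fst z \<otimes>\<^bsub>M\<^esub> snd z = m}. f (fst z) \<otimes>\<^bsub>A\<^esub> g (snd z))"
proof -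
  have "(f \<otimes>\<^bsub>F\<^esub> g) m = (\<Oplus>\<^bsub>A\<^esub>z \<in> {(u, v). u \<in> carrier M \<and> v \<in> carrier M \<and> f u \<noteq> \<zero>\<^bsub>A\<^esub>
      \<and> g v \<noteq> \<zero>\<^bsub>A\<^esub> \<and> u \<otimes>\<^bsub>M\<^esub> v = m}. f (fst z) \<otimes>\<^bsub>A\<^esub> g (snd z))"
    by (simp add: monoid_alg_def)
  also have "\<dots> = (\<Oplus>\<^bsub>A\<^esub>z\<in>{z \<in> U \<times> V. fst z \<otimes>\<^bsub>M\<^esub> snd z = m}. f (fst z) \<otimes>\<^bsub>A\<^esub> g (snd z))"
  proof (rule A.M.add.finprod_mono_neutral_cong_left)
    show "finite {z \<in> U \<times> V. fst z \<otimes>\<^bsub>M\<^esub> snd z = m}" using U V by simp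
    show "{(u, v). u \<in> carrier M \<and> v \<in> carrier M \<and> f u \<noteq> \<zero>\<^bsub>A\<^esub> \<and> g v \<noteq> \<zero>\<^bsub>A\<^esub> \<and> u \<otimes>\<^bsub>M\<^esub> v = m}
        \<subseteq> {z \<in> U \<times> V. fst z \<otimes>\<^bsub>M\<^esub> snd z = m}"
      using U V by (auto simp: supp_def)
    show "f (fst z) \<otimes>\<^bsub>A\<^esub> g (snd z) = \<zero>\<^bsub>A\<^esub>"
      if "z \<in> {z \<in> U \<times> V. fst z \<otimes>\<^bsub>M\<^esub> snd z = m} - {(u, v). u \<in> carrier M \<and> v \<in> carrier M \<and> f u \<noteq> \<zero>\<^bsub>A\<^esub>
        \<and> g v \<noteq> \<zero>\<^bsub>A\<^esub> \<and> u \<otimes>\<^bsub>M\<^esub> v = m}" for z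
      using that U V carrierD(1)[OF f] carrierD(1)[OF g] by (cases z) auto
  qed (use carrierD(1)[OF f] carrierD(1)[OF g] in auto)
  finally show ?thesis .
qed

lemma mult_closed:
  assumes f: "f \<in> carrier F" and g: "g \<in> carrier F"
  shows "f \<otimes>\<^bsub>F\<^esub> g \<in> carrier F"
proof -
  note fc = carrierD[OF f] and gc = carrierD[OF g]
  let ?S = "(\<lambda>z. fst z \<otimes>\<^bsub>M\<^esub> snd z) ` (supp A f \<times> supp A g)"
  have S: "finite ?S" "?S \<subseteq> carrier M" using fc gc by (auto simp: subset_iff)
  have eq: "(f \<otimes>\<^bsub>F\<^esub> g) m = (\<Oplus>\<^bsub>A\<^esub>z\<in>{z \<in> supp A f \<times> supp A g. fst z \<otimes>\<^bsub>M\<^esub> snd z = m}. f (fst z) \<otimes>\<^bsub>A\<^esub> g (snd z))" for m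
    using mult_box[OF f g fc(3) subset_refl fc(2) gc(3) subset_refl gc(2)] .
  have "(f \<otimes>\<^bsub>F\<^esub> g) m \<in> carrier A" for m
    unfolding eq by (rule A.M.finsum_closed) (use fc gc in auto)
  moreover have "(f \<otimes>\<^bsub>F\<^esub> g) m = \<zero>\<^bsub>A\<^esub>" if "m \<notin> ?S" for m
  proof -
    have "{z \<in> supp A f \<times> supp A g. fst z \<otimes>\<^bsub>M\<^esub> snd z = m} = {}"
      using that unfolding image_iff by blast
    then show ?thesis by (simp only: eq A.M.finsum_empty)
  qed
  then have sub: "supp A (f \<otimes>\<^bsub>F\<^esub> g) \<subseteq> ?S" by (simp add: supp_def[of A "f \<otimes>\<^bsub>F\<^esub> g"] subset_iff) metis
  moreover have "finite (supp A (f \<otimes>\<^bsub>F\<^esub> g))" using sub S(1) by (rule finite_subset)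
  ultimately show ?thesis using S(2) unfolding carrier_iff by (meson subset_trans)
qed

lemma single_closed: "a \<in> carrier A \<Longrightarrow> u \<in> carrier M \<Longrightarrow> single A a u \<in> carrier F"
  by (auto simp: carrier_iff supp_def single_def)

lemma add_closed: "f \<in> carrier F \<Longrightarrow> g \<in> carrier F \<Longrightarrow> f \<oplus>\<^bsub>F\<^esub> g \<in> carrier F"
proof -
  assume f: "f \<in> carrier F" and g: "g \<in> carrier F"
  have "supp A (f \<oplus>\<^bsub>F\<^esub> g) \<subseteq> supp A f \<union> supp A g"
    by (auto simp: supp_def F_simps)
  then show ?thesis using carrierD[OF f] carrierD[OF g]
    by (auto simp: carrier_iff F_simps intro: finite_subset)
qed

lemma abelian_group_F: "abelian_group F"
proof (rule abelian_groupI)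
  fix f assume f: "f \<in> carrier F"
  have "(\<lambda>m. \<ominus>\<^bsub>A\<^esub> f m) \<in> carrier F"
  proof -
    have "supp A (\<lambda>m. \<ominus>\<^bsub>A\<^esub> f m) \<subseteq> supp A f" by (auto simp: supp_def)
    then show ?thesis using carrierD[OF f] by (auto simp: carrier_iff intro: finite_subset)
  qed
  then show "\<exists>y \<in> carrier F. y \<oplus>\<^bsub>F\<^esub> f = \<zero>\<^bsub>F\<^esub>"
    using carrierD(1)[OF f] by (intro bexI[of _ "\<lambda>m. \<ominus>\<^bsub>A\<^esub> f m"]) (auto simp: F_simps A.M.l_neg)
  show "\<zero>\<^bsub>F\<^esub> \<oplus>\<^bsub>F\<^esub> f = f" using carrierD(1)[OF f] by (auto simp: F_simps)
next
  show "\<zero>\<^bsub>F\<^esub> \<in> carrier F" by (simp add: carrier_iff F_simps supp_def)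
next
  fix f g h assume "f \<in> carrier F" "g \<in> carrier F" "h \<in> carrier F"
  then show "f \<oplus>\<^bsub>F\<^esub> g \<oplus>\<^bsub>F\<^esub> h = f \<oplus>\<^bsub>F\<^esub> (g \<oplus>\<^bsub>F\<^esub> h)"
    by (auto simp: F_simps A.M.a_assoc carrierD(1))
next
  fix f g assume "f \<in> carrier F" "g \<in> carrier F"
  then show "f \<oplus>\<^bsub>F\<^esub> g = g \<oplus>\<^bsub>F\<^esub> f"
    by (auto simp: F_simps A.M.a_comm carrierD(1))
qed (rule add_closed)

sublocale F: abelian_group F by (rule abelian_group_F)

lemma mult_additive_left:
  assumes f: "f \<in> carrier F" and f': "f' \<in> carrier F" and g: "g \<in> carrier F"
  shows "(f \<oplus>\<^bsub>F\<^esub> f') \<otimes>\<^bsub>F\<^esub> g = f \<otimes>\<^bsub>F\<^esub> g \<oplus>\<^bsub>F\<^esub> f' \<otimes>\<^bsub>F\<^esub> g"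
proof
  fix m
  note cs = carrierD[OF f] carrierD[OF f'] carrierD[OF g]
  let ?U = "supp A f \<union> supp A f'" and ?V = "supp A g"
  let ?Z = "{z \<in> ?U \<times> ?V. fst z \<otimes>\<^bsub>M\<^esub> snd z = m}"
  have U: "finite ?U" "?U \<subseteq> carrier M" using cs by auto
  have V: "finite ?V" "?V \<subseteq> carrier M" using cs by auto
  have s: "supp A (f \<oplus>\<^bsub>F\<^esub> f') \<subseteq> ?U" by (auto simp: supp_def F_simps)
  have "((f \<oplus>\<^bsub>F\<^esub> f') \<otimes>\<^bsub>F\<^esub> g) m = (\<Oplus>\<^bsub>A\<^esub>z\<in>?Z. (f \<oplus>\<^bsub>F\<^esub> f') (fst z) \<otimes>\<^bsub>A\<^esub> g (snd z))"
    using U V s by (intro mult_box f f' g add_closed) auto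
  also have "\<dots> = (\<Oplus>\<^bsub>A\<^esub>z\<in>?Z. f (fst z) \<otimes>\<^bsub>A\<^esub> g (snd z) \<oplus>\<^bsub>A\<^esub> f' (fst z) \<otimes>\<^bsub>A\<^esub> g (snd z))"
    using cs by (intro A.M.finsum_cong') (auto simp: F_simps A.A.l_distr)
  also have "\<dots> = (\<Oplus>\<^bsub>A\<^esub>z\<in>?Z. f (fst z) \<otimes>\<^bsub>A\<^esub> g (snd z)) \<oplus>\<^bsub>A\<^esub> (\<Oplus>\<^bsub>A\<^esub>z\<in>?Z. f' (fst z) \<otimes>\<^bsub>A\<^esub> g (snd z))"
    using cs by (intro A.M.finsum_addf) auto
  also have "(\<Oplus>\<^bsub>A\<^esub>z\<in>?Z. f (fst z) \<otimes>\<^bsub>A\<^esub> g (snd z)) = (f \<otimes>\<^bsub>F\<^esub> g) m"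
    using U V by (intro mult_box[symmetric] f g) auto
  also have "(\<Oplus>\<^bsub>A\<^esub>z\<in>?Z. f' (fst z) \<otimes>\<^bsub>A\<^esub> g (snd z)) = (f' \<otimes>\<^bsub>F\<^esub> g) m"
    using U V by (intro mult_box[symmetric] f' g) auto
  finally show "((f \<oplus>\<^bsub>F\<^esub> f') \<otimes>\<^bsub>F\<^esub> g) m = (f \<otimes>\<^bsub>F\<^esub> g \<oplus>\<^bsub>F\<^esub> f' \<otimes>\<^bsub>F\<^esub> g) m" by (simp add: F_simps)
qed

lemma mult_additive_right:
  assumes f: "f \<in> carrier F" and g: "g \<in> carrier F" and g': "g' \<in> carrier F"
  shows "f \<otimes>\<^bsub>F\<^esub> (g \<oplus>\<^bsub>F\<^esub> g') = f \<otimes>\<^bsub>F\<^esub> g \<oplus>\<^bsub>F\<^esub> f \<otimes>\<^bsub>F\<^esub> g'"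
proof
  fix m
  note cs = carrierD[OF f] carrierD[OF g] carrierD[OF g']
  let ?U = "supp A f" and ?V = "supp A g \<union> supp A g'"
  let ?Z = "{z \<in> ?U \<times> ?V. fst z \<otimes>\<^bsub>M\<^esub> snd z = m}"
  have U: "finite ?U" "?U \<subseteq> carrier M" using cs by auto
  have V: "finite ?V" "?V \<subseteq> carrier M" using cs by auto
  have s: "supp A (g \<oplus>\<^bsub>F\<^esub> g') \<subseteq> ?V" by (auto simp: supp_def F_simps)
  have "(f \<otimes>\<^bsub>F\<^esub> (g \<oplus>\<^bsub>F\<^esub> g')) m = (\<Oplus>\<^bsub>A\<^esub>z\<in>?Z. f (fst z) \<otimes>\<^bsub>A\<^esub> (g \<oplus>\<^bsub>F\<^esub> g') (snd z))"
    using U V s by (intro mult_box f g' g add_closed) auto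
  also have "\<dots> = (\<Oplus>\<^bsub>A\<^esub>z\<in>?Z. f (fst z) \<otimes>\<^bsub>A\<^esub> g (snd z) \<oplus>\<^bsub>A\<^esub> f (fst z) \<otimes>\<^bsub>A\<^esub> g' (snd z))"
    using cs by (intro A.M.finsum_cong') (auto simp: F_simps A.A.r_distr)
  also have "\<dots> = (\<Oplus>\<^bsub>A\<^esub>z\<in>?Z. f (fst z) \<otimes>\<^bsub>A\<^esub> g (snd z)) \<oplus>\<^bsub>A\<^esub> (\<Oplus>\<^bsub>A\<^esub>z\<in>?Z. f (fst z) \<otimes>\<^bsub>A\<^esub> g' (snd z))"
    using cs by (intro A.M.finsum_addf) auto
  also have "(\<Oplus>\<^bsub>A\<^esub>z\<in>?Z. f (fst z) \<otimes>\<^bsub>A\<^esub> g (snd z)) = (f \<otimes>\<^bsub>F\<^esub> g) m"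
    using U V by (intro mult_box[symmetric] f g) auto
  also have "(\<Oplus>\<^bsub>A\<^esub>z\<in>?Z. f (fst z) \<otimes>\<^bsub>A\<^esub> g' (snd z)) = (f \<otimes>\<^bsub>F\<^esub> g') m"
    using U V by (intro mult_box[symmetric] f g') auto
  finally show "(f \<otimes>\<^bsub>F\<^esub> (g \<oplus>\<^bsub>F\<^esub> g')) m = (f \<otimes>\<^bsub>F\<^esub> g \<oplus>\<^bsub>F\<^esub> f \<otimes>\<^bsub>F\<^esub> g') m" by (simp add: F_simps)
qed

lemma mult_single:
  assumes "a \<in> carrier A" "b \<in> carrier A" "u \<in> carrier M" "v \<in> carrier M"
  shows "single A a u \<otimes>\<^bsub>F\<^esub> single A b v = single A (a \<otimes>\<^bsub>A\<^esub> b) (u \<otimes>\<^bsub>M\<^esub> v)"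
proof
  fix m
  have "(single A a u \<otimes>\<^bsub>F\<^esub> single A b v) m =
      (\<Oplus>\<^bsub>A\<^esub>z\<in>{z \<in> {u} \<times> {v}. fst z \<otimes>\<^bsub>M\<^esub> snd z = m}. single A a u (fst z) \<otimes>\<^bsub>A\<^esub> single A b v (snd z))"
    using assms by (intro mult_box single_closed) (auto simp: supp_def single_def split: if_splits)
  also have "{z \<in> {u} \<times> {v}. fst z \<otimes>\<^bsub>M\<^esub> snd z = m} = (if m = u \<otimes>\<^bsub>M\<^esub> v then {(u, v)} else {})" by auto
  finally show "(single A a u \<otimes>\<^bsub>F\<^esub> single A b v) m = single A (a \<otimes>\<^bsub>A\<^esub> b) (u \<otimes>\<^bsub>M\<^esub> v) m"
    using assms by (simp add: single_def)
qed

text \<open>Every element is a finite sum of single terms, so identities that are additive in each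
  argument need to be checked on single terms only.\<close>

lemma F_induct [consumes 1, case_names zero add]:
  assumes "f \<in> carrier F" and zero: "P \<zero>\<^bsub>F\<^esub>"
    and add: "\<And>a u g. a \<in> carrier A \<Longrightarrow> u \<in> carrier M \<Longrightarrow> g \<in> carrier F \<Longrightarrow> P g \<Longrightarrow> P (single A a u \<oplus>\<^bsub>F\<^esub> g)"
  shows "P f"
  using assms(1)
proof (induction "card (supp A f)" arbitrary: f rule: less_induct)
  case (less f)
  show ?case
  proof (cases "supp A f = {}")
    case True
    then have "f = \<zero>\<^bsub>F\<^esub>" by (auto simp: supp_def F_simps)
    then show ?thesis using zero by simp
  next
    case False
    then obtain u where u: "u \<in> supp A f" by auto
    note fc = carrierD[OF less.prems]
    let ?g = "f(u := \<zero>\<^bsub>A\<^esub>)"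
    have sg: "supp A ?g = supp A f - {u}" by (auto simp: supp_def)
    have g: "?g \<in> carrier F" using fc sg by (auto simp: carrier_iff simp del: fun_upd_apply) auto
    have "card (supp A ?g) < card (supp A f)"
      unfolding sg using u fc by (intro card_Diff1_less) auto
    then have "P ?g" using less.hyps g by blast
    moreover have "f = single A (f u) u \<oplus>\<^bsub>F\<^esub> ?g"
      using fc by (auto simp: F_simps single_def)
    ultimately show ?thesis using add[of "f u" u ?g] fc u g by auto
  qed
qed

lemma zero_mult: "g \<in> carrier F \<Longrightarrow> \<zero>\<^bsub>F\<^esub> \<otimes>\<^bsub>F\<^esub> g = \<zero>\<^bsub>F\<^esub>"
  by (simp add: monoid_alg_def)

lemma mult_zero: "g \<in> carrier F \<Longrightarrow> g \<otimes>\<^bsub>F\<^esub> \<zero>\<^bsub>F\<^esub> = \<zero>\<^bsub>F\<^esub>"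
  by (simp add: monoid_alg_def)

lemma mult_assoc:
  assumes "f \<in> carrier F" "g \<in> carrier F" "h \<in> carrier F"
  shows "f \<otimes>\<^bsub>F\<^esub> g \<otimes>\<^bsub>F\<^esub> h = f \<otimes>\<^bsub>F\<^esub> (g \<otimes>\<^bsub>F\<^esub> h)"
proof -
  note cl = mult_closed single_closed F.a_closed F.zero_closed
  have 1: "single A a u \<otimes>\<^bsub>F\<^esub> single A b v \<otimes>\<^bsub>F\<^esub> h = single A a u \<otimes>\<^bsub>F\<^esub> (single A b v \<otimes>\<^bsub>F\<^esub> h)"
    if "h \<in> carrier F" "a \<in> carrier A" "u \<in> carrier M" "b \<in> carrier A" "v \<in> carrier M" for a u b v h
    using that
    by (induction rule: F_induct)
      (simp_all add: cl mult_zero mult_additive_right mult_single A.A.m_assoc M.m_assoc)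
  have 2: "single A a u \<otimes>\<^bsub>F\<^esub> g \<otimes>\<^bsub>F\<^esub> h = single A a u \<otimes>\<^bsub>F\<^esub> (g \<otimes>\<^bsub>F\<^esub> h)"
    if "g \<in> carrier F" "h \<in> carrier F" "a \<in> carrier A" "u \<in> carrier M" for a u g h
    using that
    by (induction rule: F_induct)
      (simp_all add: cl 1 mult_zero zero_mult mult_additive_right mult_additive_left)
  show ?thesis using assms
    by (induction rule: F_induct) (simp_all add: cl 2 zero_mult mult_additive_left)
qed

lemma one_mult:
  assumes "f \<in> carrier F" shows "\<one>\<^bsub>F\<^esub> \<otimes>\<^bsub>F\<^esub> f = f"
  using assms
  by (induction rule: F_induct)
    (simp_all add: mult_zero mult_additive_right mult_single single_closed F_simps(4))

lemma mult_one:
  assumes "f \<in> carrier F" shows "f \<otimes>\<^bsub>F\<^esub> \<one>\<^bsub>F\<^esub> = f"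
  using assms
  by (induction rule: F_induct)
    (simp_all add: zero_mult mult_additive_left mult_single single_closed F_simps(4))

lemma ring_F: "ring F"
  by (intro ringI abelian_group_F monoidI)
    (auto simp: mult_closed mult_assoc one_mult mult_one mult_additive_left mult_additive_right
      single_closed F_simps(4)[symmetric] intro: single_closed[of "\<one>\<^bsub>A\<^esub>" "\<one>\<^bsub>M\<^esub>", folded F_simps(4)])

lemma smult_F_closed:
  assumes "c \<in> carrier K" "f \<in> carrier F" shows "c \<odot>\<^bsub>F\<^esub> f \<in> carrier F"
proof -
  have "supp A (c \<odot>\<^bsub>F\<^esub> f) \<subseteq> supp A f"
    using assms by (auto simp: supp_def F_simps)
  then show ?thesis using assms carrierD[OF assms(2)]
    by (auto simp: carrier_iff F_simps intro: finite_subset)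
qed

lemma smult_single:
  assumes "c \<in> carrier K" shows "c \<odot>\<^bsub>F\<^esub> single A a u = single A (c \<odot>\<^bsub>A\<^esub> a) u"
  using assms by (auto simp: F_simps single_def)

lemma smult_F_add:
  assumes "c \<in> carrier K" "f \<in> carrier F" "g \<in> carrier F"
  shows "c \<odot>\<^bsub>F\<^esub> (f \<oplus>\<^bsub>F\<^esub> g) = c \<odot>\<^bsub>F\<^esub> f \<oplus>\<^bsub>F\<^esub> c \<odot>\<^bsub>F\<^esub> g"
  using assms by (auto simp: F_simps A.smult_r_distr carrierD(1))

lemma smult_F_zero: "c \<in> carrier K \<Longrightarrow> c \<odot>\<^bsub>F\<^esub> \<zero>\<^bsub>F\<^esub> = \<zero>\<^bsub>F\<^esub>"
  by (auto simp: F_simps)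

lemma smult_F_mult_left:
  assumes "c \<in> carrier K" "f \<in> carrier F" "g \<in> carrier F"
  shows "(c \<odot>\<^bsub>F\<^esub> f) \<otimes>\<^bsub>F\<^esub> g = c \<odot>\<^bsub>F\<^esub> (f \<otimes>\<^bsub>F\<^esub> g)"
proof -
  note cl = mult_closed single_closed F.a_closed F.zero_closed smult_F_closed
  have 1: "(c \<odot>\<^bsub>F\<^esub> single A a u) \<otimes>\<^bsub>F\<^esub> g = c \<odot>\<^bsub>F\<^esub> (single A a u \<otimes>\<^bsub>F\<^esub> g)"
    if "g \<in> carrier F" "a \<in> carrier A" "u \<in> carrier M" for g a u
    using that assms(1)
    by (induction rule: F_induct)
      (simp_all add: cl mult_zero smult_F_zero mult_additive_right mult_single smult_single smult_F_add A.smult_mult_left)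
  show ?thesis using assms(2,1,3)
    by (induction rule: F_induct) (simp_all add: cl 1 zero_mult smult_F_zero smult_F_add mult_additive_left)
qed

lemma smult_F_mult_right:
  assumes "c \<in> carrier K" "f \<in> carrier F" "g \<in> carrier F"
  shows "f \<otimes>\<^bsub>F\<^esub> (c \<odot>\<^bsub>F\<^esub> g) = c \<odot>\<^bsub>F\<^esub> (f \<otimes>\<^bsub>F\<^esub> g)"
proof -
  note cl = mult_closed single_closed F.a_closed F.zero_closed smult_F_closed
  have 1: "single A a u \<otimes>\<^bsub>F\<^esub> (c \<odot>\<^bsub>F\<^esub> g) = c \<odot>\<^bsub>F\<^esub> (single A a u \<otimes>\<^bsub>F\<^esub> g)"
    if "g \<in> carrier F" "a \<in> carrier A" "u \<in> carrier M" for g a u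
    using that assms(1)
    by (induction rule: F_induct)
      (simp_all add: cl mult_zero smult_F_zero mult_additive_right mult_single smult_single smult_F_add A.smult_mult_right)
  show ?thesis using assms(2,1,3)
    by (induction rule: F_induct) (simp_all add: cl 1 zero_mult smult_F_zero smult_F_add mult_additive_left)
qed

lemma assoc_algebra_F: "assoc_algebra K F"
  by (intro assoc_algebraI ring_F A.R.cring_axioms)
    (auto simp: smult_F_closed smult_F_add smult_F_mult_left smult_F_mult_right,
     auto simp: F_simps A.smult_l_distr A.smult_assoc1 carrierD(1))

lemma single_linear:
  assumes "u \<in> carrier M"
  shows "additive_map A F (\<lambda>a. single A a u)"
  using assms by (intro additive_mapI single_closed) (auto simp: F_simps single_def)

text \<open>The additive map out of \<open>A[M]\<close> that is \<open>G u\<close> on the coefficient at \<open>u\<close>.\<close>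

definition term_sum :: "('b, 'e) ring_scheme \<Rightarrow> ('m \<Rightarrow> 'a \<Rightarrow> 'b) \<Rightarrow> ('m \<Rightarrow> 'a) \<Rightarrow> 'b"
  where "term_sum V G f = (\<Oplus>\<^bsub>V\<^esub>u\<in>supp A f. G u (f u))"

lemma term_sum_box:
  assumes V: "abelian_group V" and G: "\<And>u. u \<in> carrier M \<Longrightarrow> additive_map A V (G u)"
    and f: "f \<in> carrier F" and S: "finite S" "supp A f \<subseteq> S" "S \<subseteq> carrier M"
  shows "term_sum V G f = (\<Oplus>\<^bsub>V\<^esub>u\<in>S. G u (f u))"
proof -
  interpret V: abelian_group V by fact
  show ?thesis unfolding term_sum_def
  proof (rule V.add.finprod_mono_neutral_cong_left)
    fix u assume u: "u \<in> S - supp A f"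
    then show "G u (f u) = \<zero>\<^bsub>V\<^esub>"
      using additive_map_zero[OF A.M.abelian_group_axioms V G[of u]] S by (auto simp: supp_def)
  qed (use S carrierD[OF f] additive_map_closed[OF G] in auto)
qed

lemma term_sum_additive:
  assumes V: "abelian_group V" and G: "\<And>u. u \<in> carrier M \<Longrightarrow> additive_map A V (G u)"
  shows "additive_map F V (term_sum V G)"
proof (rule additive_mapI)
  interpret V: abelian_group V by fact
  fix f assume f: "f \<in> carrier F"
  note fc = carrierD[OF f]
  show "term_sum V G f \<in> carrier V"
    unfolding term_sum_def by (rule V.finsum_closed) (use fc additive_map_closed[OF G] in auto)
  fix g assume g: "g \<in> carrier F"
  note gc = carrierD[OF g]
  let ?S = "supp A f \<union> supp A g"
  have S: "finite ?S" "?S \<subseteq> carrier M" using fc gc by (auto simp: subset_iff)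
  have GS: "G u (h u) \<in> carrier V" if "u \<in> ?S" "h \<in> carrier F" for u h
    using that additive_map_closed[OF G[of u]] carrierD(1) S by auto
  have "term_sum V G (f \<oplus>\<^bsub>F\<^esub> g) = (\<Oplus>\<^bsub>V\<^esub>u\<in>?S. G u ((f \<oplus>\<^bsub>F\<^esub> g) u))"
    using S by (intro term_sum_box V G add_closed f g) (auto simp: supp_def F_simps)
  also have "\<dots> = (\<Oplus>\<^bsub>V\<^esub>u\<in>?S. G u (f u) \<oplus>\<^bsub>V\<^esub> G u (g u))"
    using S GS f g fc gc
    by (intro V.finsum_cong') (auto simp: F_simps intro!: additive_map_add[OF G])
  also have "\<dots> = (\<Oplus>\<^bsub>V\<^esub>u\<in>?S. G u (f u)) \<oplus>\<^bsub>V\<^esub> (\<Oplus>\<^bsub>V\<^esub>u\<in>?S. G u (g u))"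
    using GS f g by (intro V.finsum_addf) auto
  also have "(\<Oplus>\<^bsub>V\<^esub>u\<in>?S. G u (f u)) = term_sum V G f"
    using S by (intro term_sum_box[symmetric] V G f) auto
  also have "(\<Oplus>\<^bsub>V\<^esub>u\<in>?S. G u (g u)) = term_sum V G g"
    using S by (intro term_sum_box[symmetric] V G g) auto
  finally show "term_sum V G (f \<oplus>\<^bsub>F\<^esub> g) = term_sum V G f \<oplus>\<^bsub>V\<^esub> term_sum V G g" .
qed

lemma term_sum_single:
  assumes V: "abelian_group V" and G: "\<And>u. u \<in> carrier M \<Longrightarrow> additive_map A V (G u)"
    and au: "a \<in> carrier A" "u \<in> carrier M"
  shows "term_sum V G (single A a u) = G u a"
proof -
  interpret V: abelian_group V by fact
  have "term_sum V G (single A a u) = (\<Oplus>\<^bsub>V\<^esub>w\<in>{u}. G w (single A a u w))"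
    using au by (intro term_sum_box V G single_closed) (auto simp: supp_def single_def)
  also have "\<dots> = G u a" using additive_map_closed[OF G] au by (simp add: single_def)
  finally show ?thesis .
qed

lemma additive_map_cong_on_singles:
  assumes V: "abelian_group V" and h: "additive_map F V h" "additive_map F V h'"
    and eq: "\<And>a u. a \<in> carrier A \<Longrightarrow> u \<in> carrier M \<Longrightarrow> h (single A a u) = h' (single A a u)"
    and f: "f \<in> carrier F"
  shows "h f = h' f"
  using f
  by (induction rule: F_induct)
    (simp_all add: additive_map_zero[OF abelian_group_F V] additive_map_add[OF h(1)]
      additive_map_add[OF h(2)] h eq single_closed)

lemma mult_hom_if_on_singles:
  assumes S: "ring S" and h: "additive_map F S h"
    and eq: "\<And>a u b v. a \<in> carrier A \<Longrightarrow> u \<in> carrier M \<Longrightarrow> b \<in> carrier A \<Longrightarrow> v \<in> carrier M \<Longrightarrow>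
      h (single A (a \<otimes>\<^bsub>A\<^esub> b) (u \<otimes>\<^bsub>M\<^esub> v)) = h (single A a u) \<otimes>\<^bsub>S\<^esub> h (single A b v)"
    and f: "f \<in> carrier F" and g: "g \<in> carrier F"
  shows "h (f \<otimes>\<^bsub>F\<^esub> g) = h f \<otimes>\<^bsub>S\<^esub> h g"
proof -
  interpret S: ring S by fact
  note [simp] = additive_map_closed[OF h] mult_closed single_closed additive_map_add[OF h]
    additive_map_zero[OF abelian_group_F S.abelian_group_axioms h] zero_mult mult_zero
  have 1: "h (single A a u \<otimes>\<^bsub>F\<^esub> g) = h (single A a u) \<otimes>\<^bsub>S\<^esub> h g"
    if "g \<in> carrier F" "a \<in> carrier A" "u \<in> carrier M" for g a u
    using that
    by (induction rule: F_induct) (simp_all add: mult_additive_right mult_single S.r_distr eq)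
  show ?thesis using f g
    by (induction rule: F_induct) (simp_all add: mult_additive_left S.l_distr 1)
qed

end

section \<open>Growth of finitely generated commutative algebras\<close>

lemma span_mult_closed:
  assumes "assoc_algebra K R" and SS: "S \<subseteq> carrier R" "S' \<subseteq> carrier R" "P \<subseteq> carrier R"
    and mult: "\<And>x y. x \<in> S \<Longrightarrow> y \<in> S' \<Longrightarrow> x \<otimes>\<^bsub>R\<^esub> y \<in> P"
    and x: "x \<in> lin_span K R S" and y: "y \<in> lin_span K R S'"
  shows "x \<otimes>\<^bsub>R\<^esub> y \<in> lin_span K R P"
proof -
  interpret R: assoc_algebra K R by fact
  have cl: "v \<in> carrier R" if "v \<in> lin_span K R Q" "Q \<subseteq> carrier R" for v Q
    using R.lin_span_closed that by auto
  note sub = R.subspace_lin_span[OF SS(3)]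
  have 1: "s \<otimes>\<^bsub>R\<^esub> y \<in> lin_span K R P" if s: "s \<in> S" and "y \<in> lin_span K R S'" for s y
    using that(2)
  proof induction
    case zero
    then show ?case using s SS by (simp add: lin_span.zero subset_iff)
  next
    case (step c t v)
    have "s \<otimes>\<^bsub>R\<^esub> (c \<odot>\<^bsub>R\<^esub> t \<oplus>\<^bsub>R\<^esub> v) = c \<odot>\<^bsub>R\<^esub> (s \<otimes>\<^bsub>R\<^esub> t) \<oplus>\<^bsub>R\<^esub> s \<otimes>\<^bsub>R\<^esub> v"
      using step s SS cl[of v S'] by (simp add: R.A.r_distr R.smult_mult_right subset_iff)
    then show ?case using step mult s by (auto intro: lin_span.step)
  qed
  show ?thesis using x
  proof induction
    case zero
    then show ?case using y SS cl by (simp add: lin_span.zero)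
  next
    case (step c t v)
    have "(c \<odot>\<^bsub>R\<^esub> t \<oplus>\<^bsub>R\<^esub> v) \<otimes>\<^bsub>R\<^esub> y = c \<odot>\<^bsub>R\<^esub> (t \<otimes>\<^bsub>R\<^esub> y) \<oplus>\<^bsub>R\<^esub> v \<otimes>\<^bsub>R\<^esub> y"
      using step y SS cl[of v S] cl[of y S'] by (simp add: R.A.l_distr R.smult_mult_left subset_iff)
    then show ?case using step 1 y subspaceD(3,4)[OF sub] by simp
  qed
qed

text \<open>\<open>V d\<close> consists of the monomials in the \<open>k\<close> generators with all exponents at most \<open>d\<close>. That
  there are at most polynomially many of them, with \<open>k\<close> as the degree, is all that the growth
  argument needs from finite generation.\<close>

lemma fin_gen_filtration:
  assumes "field K" "assoc_algebra K R" "cring R" "fin_gen_alg K R"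
  obtains V k where "\<And>d. finite (V d)" "\<And>d. V d \<subseteq> carrier R" "\<And>d. card (V d) \<le> (d + 1) ^ k"
    "\<And>d e. d \<le> e \<Longrightarrow> V d \<subseteq> V e" "\<one>\<^bsub>R\<^esub> \<in> V 0"
    "\<And>d e x y. x \<in> lin_span K R (V d) \<Longrightarrow> y \<in> lin_span K R (V e) \<Longrightarrow> x \<otimes>\<^bsub>R\<^esub> y \<in> lin_span K R (V (d + e))"
    "\<And>r. r \<in> carrier R \<Longrightarrow> \<exists>d. r \<in> lin_span K R (V d)"
proof -
  interpret K: field K by fact
  interpret R: assoc_algebra K R by fact
  interpret C: cring R by fact
  obtain S where S: "finite S" "S \<subseteq> carrier R"
    and gen: "generate_ring R ((\<lambda>c. c \<odot>\<^bsub>R\<^esub> \<one>\<^bsub>R\<^esub>) ` carrier K \<union> S) = carrier R"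
    using assms(4) by (auto simp: fin_gen_alg_def)
  define mono where "mono b = (\<Otimes>\<^bsub>R\<^esub>s\<in>S. s [^]\<^bsub>R\<^esub> (b s :: nat))" for b
  define V where "V d = mono ` (S \<rightarrow>\<^sub>E {..d::nat})" for d
  have mono_closed: "mono b \<in> carrier R" for b
    unfolding mono_def using S by (intro C.finprod_closed) auto
  have mono_cong: "mono b = mono b'" if "\<And>s. s \<in> S \<Longrightarrow> b s = b' s" for b b'
    unfolding mono_def using S that by (intro C.finprod_cong') auto
  have mono_mult: "mono b \<otimes>\<^bsub>R\<^esub> mono b' = mono (\<lambda>s. b s + b' s)" for b b'
  proof -
    have "mono (\<lambda>s. b s + b' s) = (\<Otimes>\<^bsub>R\<^esub>s\<in>S. s [^]\<^bsub>R\<^esub> b s \<otimes>\<^bsub>R\<^esub> s [^]\<^bsub>R\<^esub> b' s)"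
      unfolding mono_def using S by (intro C.finprod_cong') (auto simp: R.A.nat_pow_mult)
    also have "\<dots> = mono b \<otimes>\<^bsub>R\<^esub> mono b'"
      unfolding mono_def using S by (intro C.finprod_multf) auto
    finally show ?thesis by simp
  qed
  have inV: "mono b \<in> V d" if "\<And>s. s \<in> S \<Longrightarrow> b s \<le> d" for b d
  proof -
    have "mono b = mono (restrict b S)" by (rule mono_cong) simp
    moreover have "restrict b S \<in> S \<rightarrow>\<^sub>E {..d}" using that by auto
    ultimately show ?thesis by (simp add: V_def)
  qed
  have Vcl: "V d \<subseteq> carrier R" for d using mono_closed by (auto simp: V_def)
  have Vfin: "finite (V d)" for d unfolding V_def using S by (intro finite_imageI finite_PiE) auto
  have Vcard: "card (V d) \<le> (d + 1) ^ card S" for d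
  proof -
    have "card (V d) \<le> card (S \<rightarrow>\<^sub>E {..d})"
      unfolding V_def using S by (intro card_image_le finite_PiE) auto
    then show ?thesis using S by (simp add: card_PiE)
  qed
  have Vmono: "V d \<subseteq> V e" if "d \<le> e" for d e
    unfolding V_def using that by (intro image_mono PiE_mono) auto
  have mono0: "mono (\<lambda>_. 0) = \<one>\<^bsub>R\<^esub>"
    unfolding mono_def by (intro C.finprod_one_eqI) auto
  have V0: "\<one>\<^bsub>R\<^esub> \<in> V 0" using inV[of "\<lambda>_. 0" 0] mono0 by simp
  have VV: "x \<otimes>\<^bsub>R\<^esub> y \<in> V (d + e)" if xy: "x \<in> V d" "y \<in> V e" for x y d e
  proof -
    obtain b b' where "b \<in> S \<rightarrow>\<^sub>E {..d}" "b' \<in> S \<rightarrow>\<^sub>E {..e}" "x = mono b" "y = mono b'"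
      using xy unfolding V_def by blast
    then show ?thesis unfolding \<open>x = _\<close> \<open>y = _\<close> mono_mult
      by (intro inV add_mono) (auto simp: PiE_iff)
  qed
  have mult: "x \<otimes>\<^bsub>R\<^esub> y \<in> lin_span K R (V (d + e))"
    if "x \<in> lin_span K R (V d)" "y \<in> lin_span K R (V e)" for d e x y
    by (rule span_mult_closed[OF assms(2) Vcl Vcl Vcl VV that])
  note sub = R.subspace_lin_span[OF Vcl]
  have incr: "x \<in> lin_span K R (V e)" if "x \<in> lin_span K R (V d)" "d \<le> e" for x d e
    using lin_span_mono[OF Vmono[OF that(2)]] that(1) by auto
  have all: "\<exists>d. r \<in> lin_span K R (V d)" if "r \<in> carrier R" for r
    using that unfolding gen[symmetric]
  proof (induction rule: generate_ring.induct)
    case one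
    then show ?case using R.lin_span_base[OF Vcl V0] by blast
  next
    case (incl h)
    then show ?case
    proof
      assume "h \<in> (\<lambda>c. c \<odot>\<^bsub>R\<^esub> \<one>\<^bsub>R\<^esub>) ` carrier K"
      then show ?thesis using R.lin_span_base[OF Vcl V0] subspaceD(4)[OF sub] by blast
    next
      assume h: "h \<in> S"
      have "mono (\<lambda>s. if s = h then 1 else 0) = (\<Otimes>\<^bsub>R\<^esub>s\<in>S. if h = s then s else \<one>\<^bsub>R\<^esub>)"
        unfolding mono_def using S by (intro C.finprod_cong') (auto simp: subset_iff)
      also have "\<dots> = h" using h S by (intro C.finprod_singleton) auto
      finally have "h \<in> V 1" using inV[of "\<lambda>s. if s = h then 1 else 0" 1] by simp
      then show ?thesis using R.lin_span_base[OF Vcl] by blast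
    qed
  next
    case (a_inv h)
    then show ?case using R.subspace_a_inv[OF sub] by blast
  next
    case (eng_add h1 h2)
    then obtain d e where "h1 \<in> lin_span K R (V d)" "h2 \<in> lin_span K R (V e)" by blast
    then have "h1 \<in> lin_span K R (V (max d e))" "h2 \<in> lin_span K R (V (max d e))"
      using incr by auto
    then show ?case using subspaceD(3)[OF sub] by blast
  next
    case (eng_mult h1 h2)
    then show ?case using mult by blast
  qed
  show thesis using that[OF Vfin Vcl Vcard Vmono V0 mult all] .
qed

text \<open>The recursion shifts the sequence instead of advancing an index, because the endomorphism of
  \<open>R\<close> in the main argument acts on an orbit as this shift.\<close>

fun seq_monomial :: "('a, 'm) ring_scheme \<Rightarrow> (nat \<Rightarrow> 'a) \<Rightarrow> nat list \<Rightarrow> 'a" where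
  "seq_monomial R x [] = \<one>\<^bsub>R\<^esub>"
| "seq_monomial R x (e # es) = (x 0 [^]\<^bsub>R\<^esub> e) \<otimes>\<^bsub>R\<^esub> seq_monomial R (\<lambda>k. x (Suc k)) es"

definition exponents :: "nat \<Rightarrow> nat \<Rightarrow> nat list set"
  where "exponents N n = {es. set es \<subseteq> {..<N} \<and> length es = n}"

lemma finite_exponents: "finite (exponents N n)"
  unfolding exponents_def by (rule finite_lists_length_eq) simp

lemma card_exponents: "card (exponents N n) = N ^ n"
  unfolding exponents_def by (subst card_lists_length_eq) simp_all

text \<open>Growth: monomials in \<open>k + 1\<close> elements with exponents below \<open>N\<close> number \<open>N ^ (k + 1)\<close>, while
  they all lie in a space spanned by a constant times \<open>N ^ k\<close> vectors.\<close>

lemma fin_gen_dependent_monomials: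
  assumes "field K" "assoc_algebra K R" "cring R" "fin_gen_alg K R"
    and x: "\<And>k. x k \<in> carrier R"
  shows "\<exists>N n. \<exists>c \<in> exponents N n \<rightarrow> carrier K. (\<exists>es \<in> exponents N n. c es \<noteq> \<zero>\<^bsub>K\<^esub>) \<and>
    (\<Oplus>\<^bsub>R\<^esub>es\<in>exponents N n. c es \<odot>\<^bsub>R\<^esub> seq_monomial R x es) = \<zero>\<^bsub>R\<^esub>"
proof -
  interpret R: assoc_algebra K R by fact
  obtain V k where V: "\<And>d. finite (V d)" "\<And>d. V d \<subseteq> carrier R" "\<And>d. card (V d) \<le> (d + 1) ^ k"
    "\<And>d e. d \<le> e \<Longrightarrow> V d \<subseteq> V e" "\<one>\<^bsub>R\<^esub> \<in> V 0"
    "\<And>d e x y. x \<in> lin_span K R (V d) \<Longrightarrow> y \<in> lin_span K R (V e) \<Longrightarrow> x \<otimes>\<^bsub>R\<^esub> y \<in> lin_span K R (V (d + e))"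
    "\<And>r. r \<in> carrier R \<Longrightarrow> \<exists>d. r \<in> lin_span K R (V d)"
    using fin_gen_filtration[OF assms(1-4)] by blast
  have incr: "y \<in> lin_span K R (V e)" if "y \<in> lin_span K R (V d)" "d \<le> e" for y d e
    using lin_span_mono[OF V(4)[OF that(2)]] that(1) by auto
  have one: "\<one>\<^bsub>R\<^esub> \<in> lin_span K R (V d)" for d
    using R.lin_span_base[OF V(2) V(5)] incr by blast
  define n where "n = k + 1"
  obtain g where g: "\<And>k. x k \<in> lin_span K R (V (g k))" using V(7)[OF x] by metis
  define d where "d = (\<Sum>k<n. g k)"
  have xd: "x l \<in> lin_span K R (V d)" if "l < n" for l
    using incr[OF g] that unfolding d_def by (simp add: member_le_sum)
  have pow: "y [^]\<^bsub>R\<^esub> e \<in> lin_span K R (V (d * e))" if "y \<in> lin_span K R (V d)" for y and e :: nat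
  proof (induction e)
    case (Suc e)
    then show ?case using V(6)[OF Suc that] by (simp add: add.commute)
  qed (simp add: one)
  have mon: "seq_monomial R y es \<in> lin_span K R (V (d * N * length es))"
    if "\<And>l. l < length es \<Longrightarrow> y l \<in> lin_span K R (V d)" "set es \<subseteq> {..<N}" for y es N
    using that
  proof (induction es arbitrary: y)
    case (Cons e es)
    have "y 0 [^]\<^bsub>R\<^esub> e \<in> lin_span K R (V (d * N))"
      using incr[OF pow[of "y 0" e]] Cons.prems by simp
    moreover have "seq_monomial R (\<lambda>k. y (Suc k)) es \<in> lin_span K R (V (d * N * length es))"
      using Cons.prems by (intro Cons.IH) auto
    ultimately show ?case using V(6) by fastforce
  qed (simp add: one)
  \<comment> \<open>Large enough for \<open>(N * (d * n + 1)) ^ k < N ^ n\<close>, where \<open>n = k + 1\<close>.\<close>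
  define N where "N = (d * n + 1) ^ k + 1"
  have N1: "N \<ge> 1" by (simp add: N_def)
  have "card (V (d * N * n)) \<le> (d * N * n + 1) ^ k" by (rule V(3))
  also have "\<dots> \<le> (N * (d * n + 1)) ^ k"
    by (rule power_mono) (use N1 in \<open>simp_all add: algebra_simps\<close>)
  also have "\<dots> = N ^ k * (d * n + 1) ^ k" by (rule power_mult_distrib)
  also have "\<dots> < N ^ k * N" using N1 by (simp add: N_def)
  also have "\<dots> = card (exponents N n)" by (simp add: card_exponents n_def)
  finally have less: "card (V (d * N * n)) < card (exponents N n)" .
  have mem: "seq_monomial R x es \<in> lin_span K R (V (d * N * n))" if "es \<in> exponents N n" for es
    using mon[of es x N] that xd by (auto simp: exponents_def)
  have "\<exists>c \<in> exponents N n \<rightarrow> carrier K. (\<exists>es \<in> exponents N n. c es \<noteq> \<zero>\<^bsub>K\<^esub>) \<and>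
    (\<Oplus>\<^bsub>R\<^esub>es\<in>exponents N n. c es \<odot>\<^bsub>R\<^esub> seq_monomial R x es) = \<zero>\<^bsub>R\<^esub>"
    by (rule dependent_if_card_less[OF assms(1) R.module_axioms V(1) V(2) finite_exponents less mem])
  then show ?thesis by blast
qed

lemma (in abelian_monoid) finsum_exponents_Suc:
  assumes "\<And>es. es \<in> exponents N (Suc n) \<Longrightarrow> f es \<in> carrier G"
  shows "(\<Oplus>es\<in>exponents N (Suc n). f es) = (\<Oplus>e\<in>{..<N}. \<Oplus>es\<in>exponents N n. f (e # es))"
proof -
  have eq: "exponents N (Suc n) = (\<Union>e\<in>{..<N}. (#) e ` exponents N n)"
    by (auto simp: exponents_def length_Suc_conv)
  have cl: "f (e # es) \<in> carrier G" if "e < N" "es \<in> exponents N n" for e es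
    using that assms by (auto simp: exponents_def)
  have "(\<Oplus>es\<in>exponents N (Suc n). f es) = (\<Oplus>e\<in>{..<N}. \<Oplus>es\<in>(#) e ` exponents N n. f es)"
    unfolding eq
    by (rule add.finprod_UN_disjoint)
      (use finite_exponents cl in \<open>auto simp: pairwise_def disjnt_def\<close>)
  also have "\<dots> = (\<Oplus>e\<in>{..<N}. \<Oplus>es\<in>exponents N n. f (e # es))"
    by (intro finsum_cong' finsum_reindex finsum_closed Pi_I) (use cl in \<open>auto simp: inj_on_def\<close>)
  finally show ?thesis .
qed

section \<open>Internal tensor decompositions\<close>

inductive_set pure_sums ::
  "('t, 'm) ring_scheme \<Rightarrow> ('a \<Rightarrow> 't) \<Rightarrow> ('r \<Rightarrow> 't) \<Rightarrow> 'a set \<Rightarrow> 'r set \<Rightarrow> 't set"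
  for T and i and j and U and V where
    zero: "\<zero>\<^bsub>T\<^esub> \<in> pure_sums T i j U V"
  | step: "a \<in> U \<Longrightarrow> r \<in> V \<Longrightarrow> t \<in> pure_sums T i j U V \<Longrightarrow>
      i a \<otimes>\<^bsub>T\<^esub> j r \<oplus>\<^bsub>T\<^esub> t \<in> pure_sums T i j U V"

text \<open>Sums with prescribed second factors. The list is what shrinks in the elimination argument
  below.\<close>

fun pure_sums_along ::
  "('t, 'm) ring_scheme \<Rightarrow> ('a \<Rightarrow> 't) \<Rightarrow> ('r \<Rightarrow> 't) \<Rightarrow> 'a set \<Rightarrow> 'r list \<Rightarrow> 't set" where
  "pure_sums_along T i j U [] = {\<zero>\<^bsub>T\<^esub>}"
| "pure_sums_along T i j U (r # rs) =
    {i a \<otimes>\<^bsub>T\<^esub> j r \<oplus>\<^bsub>T\<^esub> t | a t. a \<in> U \<and> t \<in> pure_sums_along T i j U rs}"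

lemma pure_sums_along_ex:
  assumes "t \<in> pure_sums T i j U V"
  shows "\<exists>rs. set rs \<subseteq> V \<and> t \<in> pure_sums_along T i j U rs"
  using assms
proof induction
  case zero
  then show ?case by (intro exI[of _ "[]"]) auto
next
  case (step a r t)
  then obtain rs where "set rs \<subseteq> V" "t \<in> pure_sums_along T i j U rs" by blast
  then show ?case using step by (intro exI[of _ "r # rs"]) auto
qed

text \<open>An internal description of \<open>T = A \<otimes> R\<close>, where \<open>\<Phi> \<phi>\<close> is \<open>id \<otimes> \<phi>\<close>. Having these maps for all
  functionals \<open>\<phi>\<close> is a form of linear disjointness of the images of \<open>A\<close> and \<open>R\<close> that avoids a
  choice of bases and is easy to verify both for tensor products and for monoid algebras.\<close>

locale tensor_decomposition =
  K: field K + A: assoc_algebra K A + R: assoc_algebra K R + T: assoc_algebra K T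
  for K :: "('k, 'z) ring_scheme" and A :: "('k, 'a, 'd) module_scheme"
    and R :: "('k, 'r, 'e) module_scheme" and T :: "('k, 't, 'f) module_scheme" +
  fixes i :: "'a \<Rightarrow> 't" and j :: "'r \<Rightarrow> 't" and \<Phi> :: "('r \<Rightarrow> 'k) \<Rightarrow> 't \<Rightarrow> 'a"
  assumes i: "i \<in> alg_hom K A T" and j: "j \<in> alg_hom K R T"
    and commute: "a \<in> carrier A \<Longrightarrow> r \<in> carrier R \<Longrightarrow> j r \<otimes>\<^bsub>T\<^esub> i a = i a \<otimes>\<^bsub>T\<^esub> j r"
    and spanned: "carrier T \<subseteq> pure_sums T i j (carrier A) (carrier R)"
    and \<Phi>: "linear_functional K R \<phi> \<Longrightarrow> additive_map T A (\<Phi> \<phi>)"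
    and \<Phi>_pure: "linear_functional K R \<phi> \<Longrightarrow> a \<in> carrier A \<Longrightarrow> r \<in> carrier R \<Longrightarrow>
      \<Phi> \<phi> (i a \<otimes>\<^bsub>T\<^esub> j r) = \<phi> r \<odot>\<^bsub>A\<^esub> a"
begin

lemmas i_simps = alg_homD(2-6)[OF i]
lemmas j_simps = alg_homD(2-6)[OF j]

lemma pure_closed [simp]: "a \<in> carrier A \<Longrightarrow> r \<in> carrier R \<Longrightarrow> i a \<otimes>\<^bsub>T\<^esub> j r \<in> carrier T"
  by (simp add: i_simps j_simps)

lemma i_zero: "i \<zero>\<^bsub>A\<^esub> = \<zero>\<^bsub>T\<^esub>"
  by (rule additive_map_zero[OF A.M.abelian_group_axioms T.M.abelian_group_axioms alg_homD(1)[OF i]])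

lemma j_zero: "j \<zero>\<^bsub>R\<^esub> = \<zero>\<^bsub>T\<^esub>"
  by (rule additive_map_zero[OF R.M.abelian_group_axioms T.M.abelian_group_axioms alg_homD(1)[OF j]])

lemma j_minus: "r \<in> carrier R \<Longrightarrow> s \<in> carrier R \<Longrightarrow> j (r \<ominus>\<^bsub>R\<^esub> s) = j r \<ominus>\<^bsub>T\<^esub> j s"
  by (rule additive_map_minus[OF R.M.abelian_group_axioms T.M.abelian_group_axioms alg_homD(1)[OF j]])

lemma \<Phi>_zero: "linear_functional K R \<phi> \<Longrightarrow> \<Phi> \<phi> \<zero>\<^bsub>T\<^esub> = \<zero>\<^bsub>A\<^esub>"
  by (rule additive_map_zero[OF T.M.abelian_group_axioms A.M.abelian_group_axioms \<Phi>])

lemma \<Phi>_step: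
  assumes "linear_functional K R \<phi>" "a \<in> carrier A" "r \<in> carrier R" "t \<in> carrier T"
  shows "\<Phi> \<phi> (i a \<otimes>\<^bsub>T\<^esub> j r \<oplus>\<^bsub>T\<^esub> t) = \<phi> r \<odot>\<^bsub>A\<^esub> a \<oplus>\<^bsub>A\<^esub> \<Phi> \<phi> t"
  using assms by (simp add: additive_map_add[OF \<Phi>] \<Phi>_pure)

lemma \<Phi>_closed: "linear_functional K R \<phi> \<Longrightarrow> t \<in> carrier T \<Longrightarrow> \<Phi> \<phi> t \<in> carrier A"
  by (rule additive_map_closed[OF \<Phi>])

lemma T_induct [consumes 1, case_names zero step]:
  assumes t: "t \<in> carrier T" and "P \<zero>\<^bsub>T\<^esub>"
    and "\<And>a r t. a \<in> carrier A \<Longrightarrow> r \<in> carrier R \<Longrightarrow> t \<in> carrier T \<Longrightarrow> P t \<Longrightarrow> P (i a \<otimes>\<^bsub>T\<^esub> j r \<oplus>\<^bsub>T\<^esub> t)"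
  shows "P t"
proof -
  have "t \<in> pure_sums T i j (carrier A) (carrier R)" using spanned t by auto
  then have "t \<in> carrier T \<and> P t" by induction (use assms in auto)
  then show ?thesis ..
qed

lemma along_closed:
  assumes "set rs \<subseteq> carrier R" "t \<in> pure_sums_along T i j (carrier A) rs" shows "t \<in> carrier T"
  using assms by (induction rs arbitrary: t) auto

lemma along_add:
  assumes "set rs \<subseteq> carrier R"
    "t \<in> pure_sums_along T i j (carrier A) rs" "t' \<in> pure_sums_along T i j (carrier A) rs"
  shows "t \<oplus>\<^bsub>T\<^esub> t' \<in> pure_sums_along T i j (carrier A) rs"
  using assms
proof (induction rs arbitrary: t t')
  case (Cons r rs)
  obtain a s a' s' where *: "a \<in> carrier A" "a' \<in> carrier A"
    "s \<in> pure_sums_along T i j (carrier A) rs" "s' \<in> pure_sums_along T i j (carrier A) rs"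
    "t = i a \<otimes>\<^bsub>T\<^esub> j r \<oplus>\<^bsub>T\<^esub> s" "t' = i a' \<otimes>\<^bsub>T\<^esub> j r \<oplus>\<^bsub>T\<^esub> s'"
    using Cons.prems by auto
  have cl: "r \<in> carrier R" "s \<in> carrier T" "s' \<in> carrier T"
    using Cons.prems along_closed * by auto
  have "t \<oplus>\<^bsub>T\<^esub> t' = (i a \<otimes>\<^bsub>T\<^esub> j r \<oplus>\<^bsub>T\<^esub> i a' \<otimes>\<^bsub>T\<^esub> j r) \<oplus>\<^bsub>T\<^esub> (s \<oplus>\<^bsub>T\<^esub> s')"
    using * cl by (simp add: T.M.a_ac)
  also have "i a \<otimes>\<^bsub>T\<^esub> j r \<oplus>\<^bsub>T\<^esub> i a' \<otimes>\<^bsub>T\<^esub> j r = i (a \<oplus>\<^bsub>A\<^esub> a') \<otimes>\<^bsub>T\<^esub> j r"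
    using * cl by (simp add: i_simps j_simps T.A.l_distr)
  finally show ?case
    using * Cons.IH[of s s'] Cons.prems(1) A.M.a_closed[of a a'] by auto
qed auto

lemma along_zero:
  assumes "set rs \<subseteq> carrier R" shows "\<zero>\<^bsub>T\<^esub> \<in> pure_sums_along T i j (carrier A) rs"
  using assms
proof (induction rs)
  case (Cons r rs)
  then show ?case by (auto intro!: exI[of _ "\<zero>\<^bsub>A\<^esub>"] exI[of _ "\<zero>\<^bsub>T\<^esub>"] simp: i_zero j_simps)
qed simp

lemma along_pure:
  assumes "set rs \<subseteq> carrier R" "a \<in> carrier A" "r \<in> set rs"
  shows "i a \<otimes>\<^bsub>T\<^esub> j r \<in> pure_sums_along T i j (carrier A) rs"
  using assms
proof (induction rs)
  case (Cons s rs)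
  have rs: "set rs \<subseteq> carrier R" and s: "s \<in> carrier R" using Cons.prems by auto
  show ?case
  proof (cases "r = s")
    case True
    then show ?thesis using Cons.prems along_zero[OF rs]
      by (auto intro!: exI[of _ a] exI[of _ "\<zero>\<^bsub>T\<^esub>"])
  next
    case False
    then have "i a \<otimes>\<^bsub>T\<^esub> j r \<in> pure_sums_along T i j (carrier A) rs" using Cons by auto
    then show ?thesis using along_closed[OF rs] s
      by (auto intro!: exI[of _ "\<zero>\<^bsub>A\<^esub>"] exI[of _ "i a \<otimes>\<^bsub>T\<^esub> j r"] simp: i_zero j_simps)
  qed
qed simp

text \<open>Those \<open>r\<close> for which all \<open>i a \<otimes> j r\<close> are sums along \<open>rs\<close> form a subspace that contains \<open>rs\<close>.\<close>

lemma along_absorb: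
  assumes rs: "set rs \<subseteq> carrier R" and r: "r \<in> lin_span K R (set rs)" and a: "a \<in> carrier A"
  shows "i a \<otimes>\<^bsub>T\<^esub> j r \<in> pure_sums_along T i j (carrier A) rs"
proof -
  let ?W = "{r \<in> carrier R. \<forall>a \<in> carrier A. i a \<otimes>\<^bsub>T\<^esub> j r \<in> pure_sums_along T i j (carrier A) rs}"
  have "subspace K R ?W"
    unfolding subspace_def
  proof (intro conjI ballI)
    show "\<zero>\<^bsub>R\<^esub> \<in> ?W" using along_zero[OF rs] by (simp add: j_zero i_simps)
  next
    fix x y assume "x \<in> ?W" "y \<in> ?W"
    then show "x \<oplus>\<^bsub>R\<^esub> y \<in> ?W" using along_add[OF rs] by (simp add: j_simps i_simps T.A.r_distr)
  next
    fix c x assume c: "c \<in> carrier K" and x: "x \<in> ?W"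
    have "i a \<otimes>\<^bsub>T\<^esub> j (c \<odot>\<^bsub>R\<^esub> x) = i (c \<odot>\<^bsub>A\<^esub> a) \<otimes>\<^bsub>T\<^esub> j x" if "a \<in> carrier A" for a
      using that c x by (simp add: j_simps i_simps T.smult_mult_left T.smult_mult_right)
    then show "c \<odot>\<^bsub>R\<^esub> x \<in> ?W" using c x by simp
  qed auto
  moreover have "set rs \<subseteq> ?W" using along_pure[OF rs] rs by auto
  ultimately show ?thesis using lin_span_minimal[of K R ?W "set rs"] r a by blast
qed

lemma \<Phi>_vanishes_along:
  assumes "linear_functional K R \<phi>" "set rs \<subseteq> carrier R" "\<And>r. r \<in> set rs \<Longrightarrow> \<phi> r = \<zero>\<^bsub>K\<^esub>"
    "t \<in> pure_sums_along T i j (carrier A) rs"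
  shows "\<Phi> \<phi> t = \<zero>\<^bsub>A\<^esub>"
  using assms(2-)
proof (induction rs arbitrary: t)
  case Nil
  then show ?case using \<Phi>_zero[OF assms(1)] by simp
next
  case (Cons r rs)
  then obtain a s where *: "t = i a \<otimes>\<^bsub>T\<^esub> j r \<oplus>\<^bsub>T\<^esub> s" "a \<in> carrier A"
    "s \<in> pure_sums_along T i j (carrier A) rs" by auto
  then show ?case using Cons along_closed[of rs s] by (simp add: \<Phi>_step[OF assms(1)])
qed

text \<open>If the second factor of the first term depends linearly on the remaining ones, the term is
  absorbed by them. If not, a functional that is \<open>1\<close> on this factor and \<open>0\<close> on the remaining ones
  isolates its coefficient, which therefore lies in \<open>U\<close>, and the term can be split off.\<close>

lemma coefficients_in_subspace:
  assumes U: "subspace K A U" and t: "t \<in> carrier T"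
    and coeff: "\<And>\<phi>. linear_functional K R \<phi> \<Longrightarrow> \<Phi> \<phi> t \<in> U"
  shows "t \<in> pure_sums T i j U (carrier R)"
proof -
  have "t \<in> pure_sums T i j U (carrier R)"
    if "set rs \<subseteq> carrier R" "t \<in> pure_sums_along T i j (carrier A) rs"
      "\<And>\<phi>. linear_functional K R \<phi> \<Longrightarrow> \<Phi> \<phi> t \<in> U" for rs t
    using that
  proof (induction rs arbitrary: t)
    case Nil
    then show ?case by (auto intro: pure_sums.zero)
  next
    case (Cons r rs)
    then obtain a s where *: "t = i a \<otimes>\<^bsub>T\<^esub> j r \<oplus>\<^bsub>T\<^esub> s" "a \<in> carrier A"
      "s \<in> pure_sums_along T i j (carrier A) rs" by auto
    have rs: "set rs \<subseteq> carrier R" "r \<in> carrier R" using Cons.prems by auto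
    have s: "s \<in> carrier T" using along_closed[OF rs(1) *(3)] .
    show ?case
    proof (cases "r \<in> lin_span K R (set rs)")
      case True
      have "t \<in> pure_sums_along T i j (carrier A) rs"
        unfolding * by (intro along_add along_absorb rs True * )
      then show ?thesis using Cons.IH[OF rs(1)] Cons.prems(3) by blast
    next
      case False
      obtain \<phi> where \<phi>: "linear_functional K R \<phi>" "\<And>w. w \<in> lin_span K R (set rs) \<Longrightarrow> \<phi> w = \<zero>\<^bsub>K\<^esub>" "\<phi> r = \<one>\<^bsub>K\<^esub>"
        using functional_separating[OF K.field_axioms R.module_axioms
          R.subspace_lin_span[OF rs(1)] rs(2) False] by blast
      have "\<Phi> \<phi> t = a"
        using \<Phi>_vanishes_along[OF \<phi>(1) rs(1) \<phi>(2)[OF R.lin_span_base[OF rs(1)]] *(3)] * s rs \<phi>(3)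
        by (simp add: \<Phi>_step[OF \<phi>(1)])
      then have a: "a \<in> U" using Cons.prems(3)[OF \<phi>(1)] by simp
      have "\<Phi> \<psi> s \<in> U" if \<psi>: "linear_functional K R \<psi>" for \<psi>
      proof -
        have c: "\<psi> r \<odot>\<^bsub>A\<^esub> a \<in> U"
          using subspaceD(4)[OF U _ a] linear_functionalD(2)[OF \<psi> rs(2)] by blast
        have "\<Phi> \<psi> t = \<psi> r \<odot>\<^bsub>A\<^esub> a \<oplus>\<^bsub>A\<^esub> \<Phi> \<psi> s" using * s rs by (simp add: \<Phi>_step[OF \<psi>])
        then have "\<Phi> \<psi> s = \<ominus>\<^bsub>A\<^esub> (\<psi> r \<odot>\<^bsub>A\<^esub> a) \<oplus>\<^bsub>A\<^esub> \<Phi> \<psi> t"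
          using \<Phi>_closed[OF \<psi> s] subspaceD(1)[OF U c] by (simp add: A.M.r_neg1)
        then show ?thesis
          using subspaceD(3)[OF U A.subspace_a_inv[OF U c] Cons.prems(3)[OF \<psi>]] by simp
      qed
      then have "s \<in> pure_sums T i j U (carrier R)" using Cons.IH[OF rs(1) *(3)] by blast
      then show ?thesis unfolding * by (intro pure_sums.step a rs)
    qed
  qed
  then show ?thesis using pure_sums_along_ex[of t T i j "carrier A" "carrier R"] spanned t coeff by blast
qed

lemma i_via_\<Phi>:
  assumes "linear_functional K R \<phi>" "a \<in> carrier A"
  shows "\<Phi> \<phi> (i a) = \<phi> \<one>\<^bsub>R\<^esub> \<odot>\<^bsub>A\<^esub> a"
  using \<Phi>_pure[OF assms(1,2), of "\<one>\<^bsub>R\<^esub>"] assms(2) by (simp add: j_simps i_simps)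

lemma j_via_\<Phi>:
  assumes "linear_functional K R \<phi>" "r \<in> carrier R"
  shows "\<Phi> \<phi> (j r) = \<phi> r \<odot>\<^bsub>A\<^esub> \<one>\<^bsub>A\<^esub>"
  using \<Phi>_pure[OF assms(1), of "\<one>\<^bsub>A\<^esub>" r] assms(2) by (simp add: j_simps i_simps)

lemma functionals_separate:
  assumes "r \<in> carrier R" "\<And>\<phi>. linear_functional K R \<phi> \<Longrightarrow> \<phi> r = \<zero>\<^bsub>K\<^esub>"
  shows "r = \<zero>\<^bsub>R\<^esub>"
proof (rule ccontr)
  assume "r \<noteq> \<zero>\<^bsub>R\<^esub>"
  then have "r \<notin> {\<zero>\<^bsub>R\<^esub>}" by simp
  moreover have "subspace K R {\<zero>\<^bsub>R\<^esub>}" by (auto simp: subspace_def)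
  ultimately obtain \<phi> where "linear_functional K R \<phi>" "\<phi> r = \<one>\<^bsub>K\<^esub>"
    using functional_separating[OF K.field_axioms R.module_axioms] assms(1) by blast
  then show False using assms(2) K.one_not_zero by metis
qed

text \<open>\<open>\<Phi> \<phi> (j r)\<close> is \<open>\<phi> r\<close> times the unit of \<open>A\<close>, and functionals separate the points of \<open>R\<close>.\<close>

lemma j_inj:
  assumes ne: "\<one>\<^bsub>A\<^esub> \<noteq> \<zero>\<^bsub>A\<^esub>" shows "inj_on j (carrier R)"
proof (rule inj_onI)
  fix r s assume rs: "r \<in> carrier R" "s \<in> carrier R" "j r = j s"
  have "r \<ominus>\<^bsub>R\<^esub> s = \<zero>\<^bsub>R\<^esub>"
  proof (rule functionals_separate)
    fix \<phi> assume \<phi>: "linear_functional K R \<phi>"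
    have "j (r \<ominus>\<^bsub>R\<^esub> s) = \<zero>\<^bsub>T\<^esub>" using rs by (simp add: j_minus j_simps)
    then have z: "\<phi> (r \<ominus>\<^bsub>R\<^esub> s) \<odot>\<^bsub>A\<^esub> \<one>\<^bsub>A\<^esub> = \<zero>\<^bsub>A\<^esub>"
      using j_via_\<Phi>[OF \<phi>, of "r \<ominus>\<^bsub>R\<^esub> s"] rs \<Phi>_zero[OF \<phi>] by simp
    let ?c = "\<phi> (r \<ominus>\<^bsub>R\<^esub> s)"
    have c: "?c \<in> carrier K" using linear_functionalD(2)[OF \<phi>] rs by simp
    show "?c = \<zero>\<^bsub>K\<^esub>"
    proof (rule ccontr)
      assume "?c \<noteq> \<zero>\<^bsub>K\<^esub>"
      then have U: "?c \<in> Units K" using c K.field_Units by auto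
      have "\<one>\<^bsub>A\<^esub> = inv\<^bsub>K\<^esub> ?c \<odot>\<^bsub>A\<^esub> (?c \<odot>\<^bsub>A\<^esub> \<one>\<^bsub>A\<^esub>)"
        using U c by (simp add: A.smult_assoc1[symmetric])
      also have "\<dots> = \<zero>\<^bsub>A\<^esub>" using z U by simp
      finally show False using ne by simp
    qed
  qed (use rs in simp)
  then show "r = s" using rs by simp
qed

lemma \<Phi>_mult_left:
  assumes \<phi>: "linear_functional K R \<phi>" and "t \<in> carrier T" "a \<in> carrier A"
  shows "\<Phi> \<phi> (i a \<otimes>\<^bsub>T\<^esub> t) = a \<otimes>\<^bsub>A\<^esub> \<Phi> \<phi> t"
  using assms(2,3)
proof (induction rule: T_induct)
  case zero
  then show ?case by (simp add: i_simps \<Phi>_zero[OF \<phi>])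
next
  case (step b r t)
  have "i a \<otimes>\<^bsub>T\<^esub> (i b \<otimes>\<^bsub>T\<^esub> j r \<oplus>\<^bsub>T\<^esub> t) = i (a \<otimes>\<^bsub>A\<^esub> b) \<otimes>\<^bsub>T\<^esub> j r \<oplus>\<^bsub>T\<^esub> i a \<otimes>\<^bsub>T\<^esub> t"
    using step by (simp add: i_simps j_simps T.A.r_distr T.A.m_assoc)
  moreover have "\<Phi> \<phi> (i (a \<otimes>\<^bsub>A\<^esub> b) \<otimes>\<^bsub>T\<^esub> j r \<oplus>\<^bsub>T\<^esub> i a \<otimes>\<^bsub>T\<^esub> t) =
      \<phi> r \<odot>\<^bsub>A\<^esub> (a \<otimes>\<^bsub>A\<^esub> b) \<oplus>\<^bsub>A\<^esub> a \<otimes>\<^bsub>A\<^esub> \<Phi> \<phi> t"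
    using step by (subst \<Phi>_step[OF \<phi>]) (simp_all add: i_simps)
  ultimately show ?case using step linear_functionalD(2)[OF \<phi>, of r]
    by (simp add: \<Phi>_step[OF \<phi>] \<Phi>_closed[OF \<phi>] A.A.r_distr A.smult_mult_right)
qed

lemma \<Phi>_mult_right:
  assumes \<phi>: "linear_functional K R \<phi>" and "t \<in> carrier T" "a \<in> carrier A"
  shows "\<Phi> \<phi> (t \<otimes>\<^bsub>T\<^esub> i a) = \<Phi> \<phi> t \<otimes>\<^bsub>A\<^esub> a"
  using assms(2,3)
proof (induction rule: T_induct)
  case zero
  then show ?case by (simp add: i_simps \<Phi>_zero[OF \<phi>])
next
  case (step b r t)
  have "(i b \<otimes>\<^bsub>T\<^esub> j r \<oplus>\<^bsub>T\<^esub> t) \<otimes>\<^bsub>T\<^esub> i a = i (b \<otimes>\<^bsub>A\<^esub> a) \<otimes>\<^bsub>T\<^esub> j r \<oplus>\<^bsub>T\<^esub> t \<otimes>\<^bsub>T\<^esub> i a"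
    using step by (simp add: i_simps j_simps T.A.l_distr T.A.m_assoc commute)
  moreover have "\<Phi> \<phi> (i (b \<otimes>\<^bsub>A\<^esub> a) \<otimes>\<^bsub>T\<^esub> j r \<oplus>\<^bsub>T\<^esub> t \<otimes>\<^bsub>T\<^esub> i a) =
      \<phi> r \<odot>\<^bsub>A\<^esub> (b \<otimes>\<^bsub>A\<^esub> a) \<oplus>\<^bsub>A\<^esub> \<Phi> \<phi> t \<otimes>\<^bsub>A\<^esub> a"
    using step by (subst \<Phi>_step[OF \<phi>]) (simp_all add: i_simps)
  ultimately show ?case using step linear_functionalD(2)[OF \<phi>, of r]
    by (simp add: \<Phi>_step[OF \<phi>] \<Phi>_closed[OF \<phi>] A.A.l_distr A.smult_mult_left)
qed

text \<open>\<open>id \<otimes> \<phi>\<close> is a map of \<open>A\<close>-bimodules and so takes central elements to central ones. Hence the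
  coefficients of a central element of \<open>T\<close> are scalars.\<close>

lemma center_subset_image:
  assumes ZA: "ring_center A \<subseteq> (\<lambda>c. c \<odot>\<^bsub>A\<^esub> \<one>\<^bsub>A\<^esub>) ` carrier K"
  shows "ring_center T \<subseteq> j ` carrier R"
proof
  fix t assume tZ: "t \<in> ring_center T"
  then have t: "t \<in> carrier T" by (simp add: ring_center_def)
  let ?U = "(\<lambda>c. c \<odot>\<^bsub>A\<^esub> \<one>\<^bsub>A\<^esub>) ` carrier K"
  have U: "subspace K A ?U"
    unfolding subspace_def
  proof (intro conjI ballI)
    show "\<zero>\<^bsub>A\<^esub> \<in> ?U" by (intro image_eqI[of _ _ "\<zero>\<^bsub>K\<^esub>"]) auto
    show "x \<oplus>\<^bsub>A\<^esub> y \<in> ?U" if "x \<in> ?U" "y \<in> ?U" for x y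
      using that by (auto simp: A.smult_l_distr[symmetric])
    show "c \<odot>\<^bsub>A\<^esub> x \<in> ?U" if "c \<in> carrier K" "x \<in> ?U" for c x
      using that by (auto simp: A.smult_assoc1[symmetric])
  qed auto
  have "\<Phi> \<phi> t \<in> ?U" if \<phi>: "linear_functional K R \<phi>" for \<phi>
  proof -
    have "\<Phi> \<phi> t \<otimes>\<^bsub>A\<^esub> a = a \<otimes>\<^bsub>A\<^esub> \<Phi> \<phi> t" if "a \<in> carrier A" for a
      using \<Phi>_mult_left[OF \<phi> t that] \<Phi>_mult_right[OF \<phi> t that] tZ that
      by (simp add: ring_center_def i_simps)
    then show ?thesis using ZA \<Phi>_closed[OF \<phi> t] by (auto simp: ring_center_def)
  qed
  then have "t \<in> pure_sums T i j ?U (carrier R)" by (rule coefficients_in_subspace[OF U t])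
  then show "t \<in> j ` carrier R"
  proof induction
    case zero
    then show ?case using j_zero by (metis R.M.zero_closed image_eqI)
  next
    case (step a r t)
    then obtain c s where *: "c \<in> carrier K" "a = c \<odot>\<^bsub>A\<^esub> \<one>\<^bsub>A\<^esub>" "s \<in> carrier R" "t = j s" by auto
    then have "i a \<otimes>\<^bsub>T\<^esub> j r \<oplus>\<^bsub>T\<^esub> t = j (c \<odot>\<^bsub>R\<^esub> r \<oplus>\<^bsub>R\<^esub> s)"
      using step by (simp add: i_simps j_simps T.smult_mult_left)
    then show ?case using * step by auto
  qed
qed

lemma image_central:
  assumes "cring R" shows "j ` carrier R \<subseteq> ring_center T"
proof -
  interpret C: cring R by fact
  have "j r \<otimes>\<^bsub>T\<^esub> t = t \<otimes>\<^bsub>T\<^esub> j r" if "t \<in> carrier T" "r \<in> carrier R" for r t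
    using that
  proof (induction rule: T_induct)
    case (step a s t)
    have "j r \<otimes>\<^bsub>T\<^esub> (i a \<otimes>\<^bsub>T\<^esub> j s) = i a \<otimes>\<^bsub>T\<^esub> j (r \<otimes>\<^bsub>R\<^esub> s)"
      using step by (simp add: i_simps j_simps T.A.m_assoc[symmetric] commute)
    also have "r \<otimes>\<^bsub>R\<^esub> s = s \<otimes>\<^bsub>R\<^esub> r" using step by (simp add: C.m_comm)
    also have "i a \<otimes>\<^bsub>T\<^esub> j (s \<otimes>\<^bsub>R\<^esub> r) = i a \<otimes>\<^bsub>T\<^esub> j s \<otimes>\<^bsub>T\<^esub> j r"
      using step by (simp add: i_simps j_simps T.A.m_assoc)
    finally show ?case using step by (simp add: j_simps T.A.r_distr T.A.l_distr)
  qed (simp add: j_simps)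
  then show ?thesis by (auto simp: ring_center_def j_simps)
qed

lemma center_image_central:
  assumes z: "z \<in> ring_center A" shows "i z \<in> ring_center T"
proof -
  have zc: "z \<in> carrier A" using z by (simp add: ring_center_def)
  have "i z \<otimes>\<^bsub>T\<^esub> t = t \<otimes>\<^bsub>T\<^esub> i z" if "t \<in> carrier T" for t
    using that
  proof (induction rule: T_induct)
    case (step a s t)
    have "i z \<otimes>\<^bsub>T\<^esub> (i a \<otimes>\<^bsub>T\<^esub> j s) = i (z \<otimes>\<^bsub>A\<^esub> a) \<otimes>\<^bsub>T\<^esub> j s"
      using step zc by (simp add: i_simps j_simps T.A.m_assoc)
    also have "z \<otimes>\<^bsub>A\<^esub> a = a \<otimes>\<^bsub>A\<^esub> z" using z step by (simp add: ring_center_def)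
    also have "i (a \<otimes>\<^bsub>A\<^esub> z) \<otimes>\<^bsub>T\<^esub> j s = i a \<otimes>\<^bsub>T\<^esub> j s \<otimes>\<^bsub>T\<^esub> i z"
      using step zc by (simp add: i_simps j_simps T.A.m_assoc commute)
    finally show ?case using step zc by (simp add: i_simps T.A.r_distr T.A.l_distr)
  qed (simp add: i_simps zc)
  then show ?thesis using zc by (auto simp: ring_center_def i_simps)
qed

text \<open>For a functional that is multiplicative, \<open>id \<otimes> e\<close> is multiplicative as well.\<close>

lemma \<Phi>_character:
  assumes e: "e \<in> alg_hom K R (ground_alg K)"
  shows "\<Phi> e \<in> alg_hom K T A"
proof (rule alg_homI)
  note ef = alg_hom_linear_functional[OF e]
  note ec = linear_functionalD(2)[OF ef]
  note e1 = alg_homD(5)[OF e, simplified]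
  show add: "additive_map T A (\<Phi> e)" by (rule \<Phi>[OF ef])
  have \<Phi>j: "\<Phi> e (t \<otimes>\<^bsub>T\<^esub> j r) = e r \<odot>\<^bsub>A\<^esub> \<Phi> e t" if "t \<in> carrier T" "r \<in> carrier R" for t r
    using that
  proof (induction rule: T_induct)
    case zero
    then show ?case using ec by (simp add: \<Phi>_zero[OF ef] j_simps)
  next
    case (step a s t)
    have "(i a \<otimes>\<^bsub>T\<^esub> j s \<oplus>\<^bsub>T\<^esub> t) \<otimes>\<^bsub>T\<^esub> j r = i a \<otimes>\<^bsub>T\<^esub> j (s \<otimes>\<^bsub>R\<^esub> r) \<oplus>\<^bsub>T\<^esub> t \<otimes>\<^bsub>T\<^esub> j r"
      using step by (simp add: i_simps j_simps T.A.l_distr T.A.m_assoc)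
    moreover have "\<Phi> e (i a \<otimes>\<^bsub>T\<^esub> j (s \<otimes>\<^bsub>R\<^esub> r) \<oplus>\<^bsub>T\<^esub> t \<otimes>\<^bsub>T\<^esub> j r) =
        e (s \<otimes>\<^bsub>R\<^esub> r) \<odot>\<^bsub>A\<^esub> a \<oplus>\<^bsub>A\<^esub> e r \<odot>\<^bsub>A\<^esub> \<Phi> e t"
      using step by (subst \<Phi>_step[OF ef]) (simp_all add: j_simps)
    ultimately show ?case using step ec[of s] ec[of r] alg_homD(4)[OF e, of s r]
      by (simp add: \<Phi>_step[OF ef] A.smult_r_distr A.smult_assoc1[symmetric]
          \<Phi>_closed[OF ef] K.m_comm)
  qed
  show "\<Phi> e (t \<otimes>\<^bsub>T\<^esub> u) = \<Phi> e t \<otimes>\<^bsub>A\<^esub> \<Phi> e u" if "t \<in> carrier T" "u \<in> carrier T" for t u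
    using that(2,1)
  proof (induction rule: T_induct)
    case zero
    then show ?case by (simp add: \<Phi>_zero[OF ef] \<Phi>_closed[OF ef])
  next
    case (step a r u)
    have "t \<otimes>\<^bsub>T\<^esub> (i a \<otimes>\<^bsub>T\<^esub> j r \<oplus>\<^bsub>T\<^esub> u) = (t \<otimes>\<^bsub>T\<^esub> i a) \<otimes>\<^bsub>T\<^esub> j r \<oplus>\<^bsub>T\<^esub> t \<otimes>\<^bsub>T\<^esub> u"
      using step by (simp add: i_simps j_simps T.A.r_distr T.A.m_assoc)
    then have "\<Phi> e (t \<otimes>\<^bsub>T\<^esub> (i a \<otimes>\<^bsub>T\<^esub> j r \<oplus>\<^bsub>T\<^esub> u)) = \<Phi> e ((t \<otimes>\<^bsub>T\<^esub> i a) \<otimes>\<^bsub>T\<^esub> j r) \<oplus>\<^bsub>A\<^esub> \<Phi> e (t \<otimes>\<^bsub>T\<^esub> u)"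
      using step by (simp add: additive_map_add[OF add] i_simps j_simps)
    also have "\<Phi> e ((t \<otimes>\<^bsub>T\<^esub> i a) \<otimes>\<^bsub>T\<^esub> j r) = \<Phi> e t \<otimes>\<^bsub>A\<^esub> (e r \<odot>\<^bsub>A\<^esub> a)"
      using step ec[of r] by (simp add: \<Phi>j i_simps \<Phi>_mult_right[OF ef] \<Phi>_closed[OF ef] A.smult_mult_right)
    finally show ?case using step ec[of r]
      by (simp add: \<Phi>_step[OF ef] \<Phi>_closed[OF ef] A.A.r_distr)
  qed
  show "\<Phi> e \<one>\<^bsub>T\<^esub> = \<one>\<^bsub>A\<^esub>"
    using i_via_\<Phi>[OF ef, of "\<one>\<^bsub>A\<^esub>"] e1 by (simp add: i_simps)
  show "\<Phi> e (c \<odot>\<^bsub>T\<^esub> t) = c \<odot>\<^bsub>A\<^esub> \<Phi> e t" if c: "c \<in> carrier K" and t: "t \<in> carrier T" for c t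
  proof -
    have "c \<odot>\<^bsub>T\<^esub> t = i (c \<odot>\<^bsub>A\<^esub> \<one>\<^bsub>A\<^esub>) \<otimes>\<^bsub>T\<^esub> t"
      using c t by (simp add: i_simps T.smult_mult_left)
    then show ?thesis using c t
      by (simp add: \<Phi>_mult_left[OF ef] A.smult_mult_left \<Phi>_closed[OF ef])
  qed
qed

end

text \<open>This turns an isomorphism between \<open>A \<otimes> R\<close> and \<open>B \<otimes> R\<close> into two decompositions of one
  algebra.\<close>

lemma tensor_decomposition_transport:
  assumes D: "tensor_decomposition K A R T i j \<Phi>" and S: "assoc_algebra K S" and h: "h \<in> alg_iso K T S"
  shows "tensor_decomposition K A R S (h \<circ> i) (h \<circ> j) (\<lambda>\<phi>. \<Phi> \<phi> \<circ> inv_into (carrier T) h)"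
proof -
  interpret D: tensor_decomposition K A R T i j \<Phi> by fact
  interpret S: assoc_algebra K S by fact
  let ?g = "inv_into (carrier T) h"
  have hom: "h \<in> alg_hom K T S" and bij: "bij_betw h (carrier T) (carrier S)"
    using h by (auto simp: alg_iso_altdef)
  have g: "?g \<in> alg_hom K S T" using alg_iso_inverse[OF D.T.assoc_algebra_axioms h] by (simp add: alg_iso_altdef)
  have gh: "?g (h t) = t" if "t \<in> carrier T" for t
    using bij that by (metis bij_betw_inv_into_left)
  have hg: "h (?g s) = s" if "s \<in> carrier S" for s
    using bij that by (metis bij_betw_inv_into_right)
  note hs = alg_homD[OF hom] and gs = alg_homD[OF g]
  show ?thesis
  proof (intro tensor_decomposition.intro tensor_decomposition_axioms.intro)
    show "h \<circ> i \<in> alg_hom K A S" "h \<circ> j \<in> alg_hom K R S"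
      using alg_hom_comp[OF D.i hom] alg_hom_comp[OF D.j hom] by auto
    show "(h \<circ> j) r \<otimes>\<^bsub>S\<^esub> (h \<circ> i) a = (h \<circ> i) a \<otimes>\<^bsub>S\<^esub> (h \<circ> j) r"
      if "a \<in> carrier A" "r \<in> carrier R" for a r
      using that by (simp add: hs(4)[symmetric] D.i_simps D.j_simps D.commute)
    show "carrier S \<subseteq> pure_sums S (h \<circ> i) (h \<circ> j) (carrier A) (carrier R)"
    proof
      fix s assume s: "s \<in> carrier S"
      have "h t \<in> pure_sums S (h \<circ> i) (h \<circ> j) (carrier A) (carrier R)" if "t \<in> carrier T" for t
        using that
      proof (induction rule: D.T_induct)
        case zero
        have "h \<zero>\<^bsub>T\<^esub> = \<zero>\<^bsub>S\<^esub>"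
          by (rule additive_map_zero[OF D.T.M.abelian_group_axioms S.M.abelian_group_axioms hs(1)])
        then show ?case by (simp add: pure_sums.zero)
      next
        case (step a r t)
        have "h (i a \<otimes>\<^bsub>T\<^esub> j r \<oplus>\<^bsub>T\<^esub> t) = (h \<circ> i) a \<otimes>\<^bsub>S\<^esub> (h \<circ> j) r \<oplus>\<^bsub>S\<^esub> h t"
          using step by (simp add: hs(3,4) D.i_simps D.j_simps)
        then show ?case using step by (simp only: pure_sums.step)
      qed
      from this[of "?g s"] show "s \<in> pure_sums S (h \<circ> i) (h \<circ> j) (carrier A) (carrier R)"
        using s by (simp add: gs(2) hg)
    qed
    fix \<phi> assume \<phi>: "linear_functional K R \<phi>"
    show "additive_map S A (\<Phi> \<phi> \<circ> ?g)"
      using \<phi> by (intro additive_mapI) (auto simp: gs(2,3) D.\<Phi>_closed additive_map_add[OF D.\<Phi>])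
    show "(\<Phi> \<phi> \<circ> ?g) ((h \<circ> i) a \<otimes>\<^bsub>S\<^esub> (h \<circ> j) r) = \<phi> r \<odot>\<^bsub>A\<^esub> a"
      if "a \<in> carrier A" "r \<in> carrier R" for a r
      using that by (simp add: hs(4)[symmetric] D.i_simps D.j_simps gh D.\<Phi>_pure[OF \<phi>])
  qed (intro_locales)
qed

section \<open>Two decompositions with a common factor\<close>

lemma alg_hom_nat_pow:
  assumes "ring A" "ring B" "h \<in> alg_hom K A B" "x \<in> carrier A"
  shows "h (x [^]\<^bsub>A\<^esub> (n::nat)) = h x [^]\<^bsub>B\<^esub> n"
proof -
  interpret A: ring A by fact
  interpret B: ring B by fact
  show ?thesis by (induction n) (use assms(4) in \<open>simp_all add: alg_homD[OF assms(3)]\<close>)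
qed

lemma alg_hom_finsum:
  assumes "ring A" "ring B" "h \<in> alg_hom K A B" "g \<in> S \<rightarrow> carrier A"
  shows "h (\<Oplus>\<^bsub>A\<^esub>k\<in>S. g k) = (\<Oplus>\<^bsub>B\<^esub>k\<in>S. h (g k))"
  using additive_map_finsum[OF ring.is_abelian_group ring.is_abelian_group alg_homD(1)] assms by metis

lemma alg_hom_polynomial:
  assumes A: "assoc_algebra K A" and B: "assoc_algebra K B" and h: "h \<in> alg_hom K A B"
    and x: "x \<in> carrier A" and c: "c \<in> S \<rightarrow> carrier K"
  shows "h (\<Oplus>\<^bsub>A\<^esub>k\<in>S. c k \<odot>\<^bsub>A\<^esub> x [^]\<^bsub>A\<^esub> (k::nat)) = (\<Oplus>\<^bsub>B\<^esub>k\<in>S. c k \<odot>\<^bsub>B\<^esub> h x [^]\<^bsub>B\<^esub> k)"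
proof -
  interpret A: assoc_algebra K A by fact
  interpret B: assoc_algebra K B by fact
  have "h (\<Oplus>\<^bsub>A\<^esub>k\<in>S. c k \<odot>\<^bsub>A\<^esub> x [^]\<^bsub>A\<^esub> k) = (\<Oplus>\<^bsub>B\<^esub>k\<in>S. h (c k \<odot>\<^bsub>A\<^esub> x [^]\<^bsub>A\<^esub> k))"
    using x c by (intro alg_hom_finsum[OF A.A.ring_axioms B.A.ring_axioms h]) auto
  also have "\<dots> = (\<Oplus>\<^bsub>B\<^esub>k\<in>S. c k \<odot>\<^bsub>B\<^esub> h x [^]\<^bsub>B\<^esub> k)"
    using x c alg_homD[OF h] alg_hom_nat_pow[OF A.A.ring_axioms B.A.ring_axioms h x]
    by (intro B.M.finsum_cong') (auto simp: Pi_iff)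
  finally show ?thesis .
qed

lemma alg_hom_factor:
  assumes R: "assoc_algebra K R" and j: "j \<in> alg_hom K R T" "inj_on j (carrier R)"
    and f: "f \<in> alg_hom K S T" "f ` carrier S \<subseteq> j ` carrier R" and S: "assoc_algebra K S"
  shows "inv_into (carrier R) j \<circ> f \<in> alg_hom K S R"
proof -
  interpret R: assoc_algebra K R by fact
  interpret S: assoc_algebra K S by fact
  let ?g = "inv_into (carrier R) j \<circ> f"
  have cl: "?g x \<in> carrier R" "j (?g x) = f x" if "x \<in> carrier S" for x
    using that f(2) by (auto simp: image_subset_iff inv_into_into f_inv_into_f)
  have eq: "?g x = r" if "x \<in> carrier S" "r \<in> carrier R" "j r = f x" for x r
    using that j(2) cl by (metis inj_onD)
  show ?thesis
    by (intro alg_homI additive_mapI eq)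
      (simp_all only: cl alg_homD[OF j(1)] alg_homD[OF f(1)] S.M.a_closed S.A.m_closed S.A.one_closed
        R.M.a_closed R.A.m_closed R.A.one_closed S.smult_closed R.smult_closed)
qed

lemma (in abelian_monoid) finsum_lessThan_Suc:
  assumes "\<And>k. k < Suc n \<Longrightarrow> f k \<in> carrier G"
  shows "(\<Oplus>k\<in>{..<Suc n}. f k) = f 0 \<oplus> (\<Oplus>k\<in>{..<n}. f (Suc k))"
proof -
  have "{..<Suc n} = insert 0 (Suc ` {..<n})" by (auto simp: less_Suc_eq_0_disj)
  then have "(\<Oplus>k\<in>{..<Suc n}. f k) = f 0 \<oplus> (\<Oplus>k\<in>Suc ` {..<n}. f k)"
    using assms by (simp add: finsum_insert Pi_iff)
  also have "(\<Oplus>k\<in>Suc ` {..<n}. f k) = (\<Oplus>k\<in>{..<n}. f (Suc k))"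
    using assms by (intro finsum_reindex) auto
  finally show ?thesis .
qed

text \<open>The character maps the relation to its constant coefficient, which is therefore \<open>0\<close>. In a
  domain a factor \<open>x\<close> can then be cancelled, unless \<open>x = 0\<close>.\<close>

lemma algebraic_in_character_kernel_zero:
  assumes "field K" "assoc_algebra K R" "domain R" and e: "e \<in> alg_hom K R (ground_alg K)"
    and x: "x \<in> carrier R" "e x = \<zero>\<^bsub>K\<^esub>"
    and c: "c \<in> {..<n} \<rightarrow> carrier K" "\<exists>k<n. c k \<noteq> \<zero>\<^bsub>K\<^esub>"
    and rel: "(\<Oplus>\<^bsub>R\<^esub>k\<in>{..<n}. c k \<odot>\<^bsub>R\<^esub> x [^]\<^bsub>R\<^esub> (k::nat)) = \<zero>\<^bsub>R\<^esub>"
  shows "x = \<zero>\<^bsub>R\<^esub>"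
proof -
  interpret K: field K by fact
  interpret R: assoc_algebra K R by fact
  interpret D: domain R by fact
  note ed = alg_homD[OF e, simplified]
  show ?thesis using c rel
  proof (induction n arbitrary: c)
    case (Suc n)
    have cc: "c k \<in> carrier K" if "k < Suc n" for k using Suc.prems that by auto
    let ?S = "\<Oplus>\<^bsub>R\<^esub>k\<in>{..<n}. c (Suc k) \<odot>\<^bsub>R\<^esub> x [^]\<^bsub>R\<^esub> k"
    have S: "?S \<in> carrier R" using cc x by (intro R.M.finsum_closed) auto
    have "(\<Oplus>\<^bsub>R\<^esub>k\<in>{..<Suc n}. c k \<odot>\<^bsub>R\<^esub> x [^]\<^bsub>R\<^esub> k) =
        c 0 \<odot>\<^bsub>R\<^esub> \<one>\<^bsub>R\<^esub> \<oplus>\<^bsub>R\<^esub> (\<Oplus>\<^bsub>R\<^esub>k\<in>{..<n}. c (Suc k) \<odot>\<^bsub>R\<^esub> x [^]\<^bsub>R\<^esub> Suc k)"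
      using cc x by (subst R.M.finsum_lessThan_Suc) auto
    also have "(\<Oplus>\<^bsub>R\<^esub>k\<in>{..<n}. c (Suc k) \<odot>\<^bsub>R\<^esub> x [^]\<^bsub>R\<^esub> Suc k) = ?S \<otimes>\<^bsub>R\<^esub> x"
      using cc x by (subst R.A.finsum_ldistr) (auto intro!: R.M.finsum_cong' simp: R.smult_mult_left)
    finally have rel: "c 0 \<odot>\<^bsub>R\<^esub> \<one>\<^bsub>R\<^esub> \<oplus>\<^bsub>R\<^esub> ?S \<otimes>\<^bsub>R\<^esub> x = \<zero>\<^bsub>R\<^esub>" using Suc.prems by simp
    have "e (c 0 \<odot>\<^bsub>R\<^esub> \<one>\<^bsub>R\<^esub> \<oplus>\<^bsub>R\<^esub> ?S \<otimes>\<^bsub>R\<^esub> x) = c 0"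
      using S x cc ed(2)[OF S] by (simp add: ed)
    moreover have "e \<zero>\<^bsub>R\<^esub> = \<zero>\<^bsub>K\<^esub>"
      by (rule additive_map_zero[OF R.M.abelian_group_axioms K.abelian_group_axioms
            linear_functionalD(1)[OF alg_hom_linear_functional[OF e]]])
    ultimately have c0: "c 0 = \<zero>\<^bsub>K\<^esub>" using rel by simp
    then have "?S \<otimes>\<^bsub>R\<^esub> x = \<zero>\<^bsub>R\<^esub>" using rel S x by simp
    then consider "x = \<zero>\<^bsub>R\<^esub>" | "?S = \<zero>\<^bsub>R\<^esub>" using D.integral[OF _ S x(1)] by blast
    then show ?case
    proof cases
      case 2
      obtain k where "k < Suc n" "c k \<noteq> \<zero>\<^bsub>K\<^esub>" using Suc.prems by auto
      then have "\<exists>k<n. c (Suc k) \<noteq> \<zero>\<^bsub>K\<^esub>" using c0 by (cases k) auto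
      then show ?thesis using Suc.IH[of "\<lambda>k. c (Suc k)"] cc 2 by auto
    qed
  qed simp
qed

lemma smult_eq_zero_imp:
  assumes "field K" "module K V" "c \<in> carrier K" "v \<in> carrier V" "c \<odot>\<^bsub>V\<^esub> v = \<zero>\<^bsub>V\<^esub>" "v \<noteq> \<zero>\<^bsub>V\<^esub>"
  shows "c = \<zero>\<^bsub>K\<^esub>"
proof (rule ccontr)
  interpret K: field K by fact
  interpret V: module K V by fact
  assume "c \<noteq> \<zero>\<^bsub>K\<^esub>"
  then have U: "c \<in> Units K" using assms K.field_Units by auto
  have "v = inv\<^bsub>K\<^esub> c \<odot>\<^bsub>V\<^esub> (c \<odot>\<^bsub>V\<^esub> v)" using U assms(3,4) by (simp add: V.smult_assoc1[symmetric])
  also have "\<dots> = \<zero>\<^bsub>V\<^esub>" unfolding assms(5) using U by simp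
  finally show False using assms(6) by simp
qed

text \<open>One algebra with two decompositions that share the second factor \<open>R\<close> but embed it
  differently. The character \<open>e\<close> amounts to an ideal \<open>I\<close> of \<open>R\<close> with \<open>R / I = K\<close>, namely its
  kernel.\<close>

locale tensor_cancellation =
  D: tensor_decomposition K A R T i j \<Phi> + E: tensor_decomposition K B R T i' j' \<Psi> + Rdom: domain R
  for K :: "('k, 'z) ring_scheme" and A :: "('k, 'a, 'd) module_scheme"
    and R :: "('k, 'r, 'e) module_scheme" and T :: "('k, 't, 'f) module_scheme" and i j \<Phi>
    and B :: "('k, 'b, 'g) module_scheme" and i' j' \<Psi> +
  fixes e :: "'r \<Rightarrow> 'k"
  assumes e: "e \<in> alg_hom K R (ground_alg K)"
    and finitely_generated: "fin_gen_alg K R"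
    and nontrivial: "\<one>\<^bsub>A\<^esub> \<noteq> \<zero>\<^bsub>A\<^esub>"
    and center_A: "ring_center A \<subseteq> (\<lambda>c. c \<odot>\<^bsub>A\<^esub> \<one>\<^bsub>A\<^esub>) ` carrier K"
begin

lemma center_T: "ring_center T \<subseteq> j ` carrier R"
  by (rule D.center_subset_image[OF center_A])

lemmas inj_j = D.j_inj[OF nontrivial]

lemma image_j': "j' ` carrier R \<subseteq> j ` carrier R"
  using E.image_central[OF Rdom.is_cring] center_T by blast

text \<open>The second copy of \<open>R\<close> is central and so lies in the first one. Read in the first copy, its
  inclusion is an endomorphism of \<open>R\<close>.\<close>

definition \<theta> where "\<theta> = inv_into (carrier R) j \<circ> j'"

lemma \<theta>_hom: "\<theta> \<in> alg_hom K R R"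
  unfolding \<theta>_def
  by (rule alg_hom_factor[OF D.R.assoc_algebra_axioms D.j inj_j E.j image_j' D.R.assoc_algebra_axioms])

lemma j_\<theta>: "r \<in> carrier R \<Longrightarrow> j (\<theta> r) = j' r"
  using image_j' by (simp add: \<theta>_def f_inv_into_f image_subset_iff)

lemma \<theta>_closed: "r \<in> carrier R \<Longrightarrow> \<theta> r \<in> carrier R"
  by (rule alg_homD(2)[OF \<theta>_hom])

lemma seq_monomial_shift:
  assumes "\<And>k. x k \<in> carrier R" "\<And>k. x (Suc k) = \<theta> (x k)"
  shows "seq_monomial R x es \<in> carrier R \<and> seq_monomial R (\<lambda>k. x (Suc k)) es = \<theta> (seq_monomial R x es)"
  using assms
proof (induction es arbitrary: x)
  case Nil
  then show ?case by (simp add: alg_homD[OF \<theta>_hom])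
next
  case (Cons d es)
  have IH: "seq_monomial R (\<lambda>k. x (Suc k)) es \<in> carrier R"
    "seq_monomial R (\<lambda>k. x (Suc (Suc k))) es = \<theta> (seq_monomial R (\<lambda>k. x (Suc k)) es)"
    using Cons.IH[of "\<lambda>k. x (Suc k)"] Cons.prems(1) Cons.prems(2)[of "Suc _"] by auto
  then show ?case using Cons.prems(1)[of 0] Cons.prems(2)[of 0]
    by (simp add: alg_homD[OF \<theta>_hom] alg_hom_nat_pow[OF D.R.A.ring_axioms D.R.A.ring_axioms \<theta>_hom])
qed

text \<open>A relation between monomials in the orbit of \<open>x 0\<close> under \<open>\<theta>\<close> has the form
  \<open>\<Sum>k. x 0 ^ k \<otimes> \<theta> (s k)\<close>, where the \<open>s k\<close> are combinations of monomials with one exponent fewer.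
  The second decomposition reads this as \<open>\<Sum>k. z ^ k \<otimes> s k\<close>. Applying \<open>id \<otimes> \<phi>\<close> yields a relation
  between the powers of \<open>z\<close> with the coefficients \<open>\<phi> (s k)\<close>, so these vanish for every \<open>\<phi>\<close>, and
  the claim follows by induction.\<close>

lemma monomials_independent:
  assumes z: "z \<in> ring_center B" and x0: "x 0 \<in> carrier R" "j (x 0) = i' z"
    and x: "\<And>k. x k \<in> carrier R" "\<And>k. x (Suc k) = \<theta> (x k)"
    and indep: "\<And>c. c \<in> {..<N} \<rightarrow> carrier K \<Longrightarrow>
      (\<Oplus>\<^bsub>B\<^esub>k\<in>{..<N}. c k \<odot>\<^bsub>B\<^esub> z [^]\<^bsub>B\<^esub> (k::nat)) = \<zero>\<^bsub>B\<^esub> \<Longrightarrow> \<forall>k<N. c k = \<zero>\<^bsub>K\<^esub>"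
    and c: "c \<in> exponents N n \<rightarrow> carrier K"
    and rel: "(\<Oplus>\<^bsub>R\<^esub>es\<in>exponents N n. c es \<odot>\<^bsub>R\<^esub> seq_monomial R x es) = \<zero>\<^bsub>R\<^esub>"
  shows "\<forall>es \<in> exponents N n. c es = \<zero>\<^bsub>K\<^esub>"
  using c rel
proof (induction n arbitrary: c)
  case 0
  have e0: "exponents N 0 = {[]}" by (auto simp: exponents_def)
  have c0: "c [] \<in> carrier K" using 0 by (simp add: e0)
  then have "c [] \<odot>\<^bsub>R\<^esub> \<one>\<^bsub>R\<^esub> = \<zero>\<^bsub>R\<^esub>" using 0 by (simp add: e0)
  then have "c [] = \<zero>\<^bsub>K\<^esub>"
    by (rule smult_eq_zero_imp[OF D.K.field_axioms D.R.module_axioms c0 D.R.A.one_closed _ Rdom.one_not_zero])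
  then show ?case by (simp add: e0)
next
  case (Suc n)
  have zB: "z \<in> carrier B" using z by (simp add: ring_center_def)
  have mon: "seq_monomial R x es \<in> carrier R"
    "seq_monomial R (\<lambda>k. x (Suc k)) es = \<theta> (seq_monomial R x es)" for es
    using seq_monomial_shift[of x es] x by auto
  have cc: "c (k # es) \<in> carrier K" if "k < N" "es \<in> exponents N n" for k es
    using Suc.prems(1) that by (auto simp: exponents_def Pi_iff)
  define s where "s k = (\<Oplus>\<^bsub>R\<^esub>es\<in>exponents N n. c (k # es) \<odot>\<^bsub>R\<^esub> seq_monomial R x es)" for k
  have s: "s k \<in> carrier R" if "k < N" for k
    unfolding s_def using cc[OF that] mon by (intro D.R.M.finsum_closed) auto
  \<comment> \<open>Splitting off the first exponent \<open>k\<close> leaves \<open>\<theta>\<close> of a combination of shorter monomials.\<close>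
  have inner: "(\<Oplus>\<^bsub>R\<^esub>es\<in>exponents N n. c (k # es) \<odot>\<^bsub>R\<^esub> seq_monomial R x (k # es)) = x 0 [^]\<^bsub>R\<^esub> k \<otimes>\<^bsub>R\<^esub> \<theta> (s k)"
    if k: "k < N" for k
  proof -
    have "x 0 [^]\<^bsub>R\<^esub> k \<otimes>\<^bsub>R\<^esub> \<theta> (s k) =
        (\<Oplus>\<^bsub>R\<^esub>es\<in>exponents N n. x 0 [^]\<^bsub>R\<^esub> k \<otimes>\<^bsub>R\<^esub> \<theta> (c (k # es) \<odot>\<^bsub>R\<^esub> seq_monomial R x es))"
      unfolding s_def
      by (rule additive_map_finsum[of R R "\<lambda>r. x 0 [^]\<^bsub>R\<^esub> k \<otimes>\<^bsub>R\<^esub> \<theta> r"])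
        (use D.R.M.abelian_group_axioms cc[OF k] mon x0 in
          \<open>auto intro!: additive_mapI simp: alg_homD[OF \<theta>_hom] D.R.A.r_distr\<close>)
    also have "\<dots> = (\<Oplus>\<^bsub>R\<^esub>es\<in>exponents N n. c (k # es) \<odot>\<^bsub>R\<^esub> seq_monomial R x (k # es))"
      using cc[OF k] mon x0 \<theta>_closed
      by (intro D.R.M.finsum_cong') (auto simp: alg_homD(6)[OF \<theta>_hom] D.R.smult_mult_right)
    finally show ?thesis by simp
  qed
  have sum0: "(\<Oplus>\<^bsub>R\<^esub>k\<in>{..<N}. x 0 [^]\<^bsub>R\<^esub> k \<otimes>\<^bsub>R\<^esub> \<theta> (s k)) = \<zero>\<^bsub>R\<^esub>"
  proof -
    have "\<zero>\<^bsub>R\<^esub> = (\<Oplus>\<^bsub>R\<^esub>k\<in>{..<N}. \<Oplus>\<^bsub>R\<^esub>es\<in>exponents N n. c (k # es) \<odot>\<^bsub>R\<^esub> seq_monomial R x (k # es))"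
      unfolding Suc.prems(2)[symmetric] using Suc.prems(1) mon
      by (intro D.R.M.finsum_exponents_Suc) auto
    also have "\<dots> = (\<Oplus>\<^bsub>R\<^esub>k\<in>{..<N}. x 0 [^]\<^bsub>R\<^esub> k \<otimes>\<^bsub>R\<^esub> \<theta> (s k))"
      using inner s x0 \<theta>_closed by (intro D.R.M.finsum_cong') auto
    finally show ?thesis by simp
  qed
  have s0: "s k = \<zero>\<^bsub>R\<^esub>" if k: "k < N" for k
  proof (rule E.functionals_separate[OF s[OF k]])
    fix \<phi> assume \<phi>: "linear_functional K R \<phi>"
    \<comment> \<open>In the second decomposition \<open>x 0\<close> is \<open>z\<close>, and \<open>\<theta>\<close> is the inclusion of \<open>R\<close>.\<close>
    have pure: "\<Psi> \<phi> (j (x 0 [^]\<^bsub>R\<^esub> l \<otimes>\<^bsub>R\<^esub> \<theta> (s l))) = \<phi> (s l) \<odot>\<^bsub>B\<^esub> z [^]\<^bsub>B\<^esub> l" if "l < N" for l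
    proof -
      have "j (x 0 [^]\<^bsub>R\<^esub> l \<otimes>\<^bsub>R\<^esub> \<theta> (s l)) = i' (z [^]\<^bsub>B\<^esub> l) \<otimes>\<^bsub>T\<^esub> j' (s l)"
        using x0 s[OF that] zB \<theta>_closed
        by (simp add: D.j_simps j_\<theta> alg_hom_nat_pow[OF D.R.A.ring_axioms D.T.A.ring_axioms D.j]
            alg_hom_nat_pow[OF E.A.A.ring_axioms D.T.A.ring_axioms E.i])
      then show ?thesis using s[OF that] zB by (simp add: E.\<Phi>_pure[OF \<phi>])
    qed
    have add: "additive_map R B (\<lambda>r. \<Psi> \<phi> (j r))"
      using \<phi> by (intro additive_mapI) (auto simp: D.j_simps E.\<Phi>_closed additive_map_add[OF E.\<Phi>])
    have "\<zero>\<^bsub>B\<^esub> = \<Psi> \<phi> (j (\<Oplus>\<^bsub>R\<^esub>k\<in>{..<N}. x 0 [^]\<^bsub>R\<^esub> k \<otimes>\<^bsub>R\<^esub> \<theta> (s k)))"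
      unfolding sum0 using E.\<Phi>_zero[OF \<phi>] D.j_zero by simp
    also have "\<dots> = (\<Oplus>\<^bsub>B\<^esub>k\<in>{..<N}. \<Psi> \<phi> (j (x 0 [^]\<^bsub>R\<^esub> k \<otimes>\<^bsub>R\<^esub> \<theta> (s k))))"
      using s x0 \<theta>_closed
      by (intro additive_map_finsum[OF D.R.M.abelian_group_axioms E.A.M.abelian_group_axioms add]) auto
    also have "\<dots> = (\<Oplus>\<^bsub>B\<^esub>k\<in>{..<N}. \<phi> (s k) \<odot>\<^bsub>B\<^esub> z [^]\<^bsub>B\<^esub> k)"
      using pure linear_functionalD(2)[OF \<phi>] s zB by (intro E.A.M.finsum_cong') auto
    finally have "(\<Oplus>\<^bsub>B\<^esub>k\<in>{..<N}. \<phi> (s k) \<odot>\<^bsub>B\<^esub> z [^]\<^bsub>B\<^esub> k) = \<zero>\<^bsub>B\<^esub>" by simp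
    moreover have "(\<lambda>k. \<phi> (s k)) \<in> {..<N} \<rightarrow> carrier K" using linear_functionalD(2)[OF \<phi>] s by auto
    ultimately show "\<phi> (s k) = \<zero>\<^bsub>K\<^esub>" using indep k by blast
  qed
  have *: "\<forall>es \<in> exponents N n. c (k # es) = \<zero>\<^bsub>K\<^esub>" if "k < N" for k
  proof (rule Suc.IH)
    show "(\<lambda>es. c (k # es)) \<in> exponents N n \<rightarrow> carrier K" using cc[OF that] by auto
    show "(\<Oplus>\<^bsub>R\<^esub>es\<in>exponents N n. c (k # es) \<odot>\<^bsub>R\<^esub> seq_monomial R x es) = \<zero>\<^bsub>R\<^esub>"
      using s0[OF that] by (simp only: s_def)
  qed
  show ?case
  proof
    fix fs assume "fs \<in> exponents N (Suc n)"
    then obtain k es where "fs = k # es" "k < N" "es \<in> exponents N n"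
      by (auto simp: exponents_def length_Suc_conv)
    then show "c fs = \<zero>\<^bsub>K\<^esub>" using * by simp
  qed
qed

lemma central_algebraic:
  assumes z: "z \<in> ring_center B"
  shows "\<exists>N. \<exists>c \<in> {..<N} \<rightarrow> carrier K. (\<exists>k<N. c k \<noteq> \<zero>\<^bsub>K\<^esub>) \<and>
    (\<Oplus>\<^bsub>B\<^esub>k\<in>{..<N}. c k \<odot>\<^bsub>B\<^esub> z [^]\<^bsub>B\<^esub> (k::nat)) = \<zero>\<^bsub>B\<^esub>"
proof (rule ccontr)
  assume neg: "\<not> ?thesis"
  obtain y where y: "y \<in> carrier R" "j y = i' z"
    using E.center_image_central[OF z] center_T by (metis imageE subsetD)
  define x where "x k = (\<theta> ^^ k) y" for k
  have x: "x k \<in> carrier R" "x (Suc k) = \<theta> (x k)" for k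
    by (induction k) (auto simp: x_def y \<theta>_closed)
  have x0: "x 0 \<in> carrier R" "j (x 0) = i' z" by (simp_all add: x_def y)
  obtain N n where "\<exists>c \<in> exponents N n \<rightarrow> carrier K. (\<exists>es \<in> exponents N n. c es \<noteq> \<zero>\<^bsub>K\<^esub>) \<and>
      (\<Oplus>\<^bsub>R\<^esub>es\<in>exponents N n. c es \<odot>\<^bsub>R\<^esub> seq_monomial R x es) = \<zero>\<^bsub>R\<^esub>"
    using fin_gen_dependent_monomials[where x = x, OF D.K.field_axioms D.R.assoc_algebra_axioms
        Rdom.is_cring finitely_generated x(1)] by (elim exE)
  then obtain c where c: "c \<in> exponents N n \<rightarrow> carrier K" "\<exists>es \<in> exponents N n. c es \<noteq> \<zero>\<^bsub>K\<^esub>"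
    and rel: "(\<Oplus>\<^bsub>R\<^esub>es\<in>exponents N n. c es \<odot>\<^bsub>R\<^esub> seq_monomial R x es) = \<zero>\<^bsub>R\<^esub>"
    by (rule bexE) (erule conjE)
  have indep: "\<forall>k<N. d k = \<zero>\<^bsub>K\<^esub>" if "d \<in> {..<N} \<rightarrow> carrier K"
    "(\<Oplus>\<^bsub>B\<^esub>k\<in>{..<N}. d k \<odot>\<^bsub>B\<^esub> z [^]\<^bsub>B\<^esub> (k::nat)) = \<zero>\<^bsub>B\<^esub>" for d
    using neg that by blast
  have "\<forall>es \<in> exponents N n. c es = \<zero>\<^bsub>K\<^esub>"
    by (rule monomials_independent[OF z x0 x indep c(1) rel])
  with c(2) show False by blast
qed

text \<open>Subtracting the value of \<open>z\<close> under \<open>e\<close> moves \<open>z\<close> into the kernel of the character, where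
  algebraic elements are zero.\<close>

lemma center_B: "ring_center B \<subseteq> (\<lambda>c. c \<odot>\<^bsub>B\<^esub> \<one>\<^bsub>B\<^esub>) ` carrier K"
proof
  fix z assume z: "z \<in> ring_center B"
  have zB: "z \<in> carrier B" using z by (simp add: ring_center_def)
  obtain y where y: "y \<in> carrier R" "j y = i' z"
    using E.center_image_central[OF z] center_T by (metis imageE subsetD)
  note ef = alg_hom_linear_functional[OF e]
  define a where "a = e y"
  have a: "a \<in> carrier K" using linear_functionalD(2)[OF ef] y by (simp add: a_def)
  \<comment> \<open>\<open>?w\<close> in \<open>B\<close> and \<open>?v\<close> in \<open>R\<close> are the same element of \<open>T\<close>.\<close>
  let ?w = "z \<oplus>\<^bsub>B\<^esub> (\<ominus>\<^bsub>K\<^esub> a) \<odot>\<^bsub>B\<^esub> \<one>\<^bsub>B\<^esub>" and ?v = "y \<oplus>\<^bsub>R\<^esub> (\<ominus>\<^bsub>K\<^esub> a) \<odot>\<^bsub>R\<^esub> \<one>\<^bsub>R\<^esub>"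
  have w: "?w \<in> ring_center B"
    using z a by (auto simp: ring_center_def E.A.A.l_distr E.A.A.r_distr E.A.smult_mult_left E.A.smult_mult_right)
  have v: "?v \<in> carrier R" using y a by simp
  have jv: "j ?v = i' ?w" using y a zB by (simp add: D.j_simps E.i_simps)
  have ev: "e ?v = \<zero>\<^bsub>K\<^esub>"
    using y a alg_homD[OF e] by (simp add: a_def D.K.r_neg)
  obtain N c where c: "c \<in> {..<N} \<rightarrow> carrier K" "\<exists>k<N. c k \<noteq> \<zero>\<^bsub>K\<^esub>"
    and rel: "(\<Oplus>\<^bsub>B\<^esub>k\<in>{..<N}. c k \<odot>\<^bsub>B\<^esub> ?w [^]\<^bsub>B\<^esub> (k::nat)) = \<zero>\<^bsub>B\<^esub>"
    using central_algebraic[OF w] by blast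
  have wB: "?w \<in> carrier B" using w by (simp add: ring_center_def)
  let ?q = "\<Oplus>\<^bsub>R\<^esub>k\<in>{..<N}. c k \<odot>\<^bsub>R\<^esub> ?v [^]\<^bsub>R\<^esub> k"
  have "j ?q = i' (\<Oplus>\<^bsub>B\<^esub>k\<in>{..<N}. c k \<odot>\<^bsub>B\<^esub> ?w [^]\<^bsub>B\<^esub> k)"
    unfolding alg_hom_polynomial[OF D.R.assoc_algebra_axioms D.T.assoc_algebra_axioms D.j v c(1)]
      alg_hom_polynomial[OF E.A.assoc_algebra_axioms D.T.assoc_algebra_axioms E.i wB c(1)] jv ..
  then have "j ?q = j \<zero>\<^bsub>R\<^esub>" unfolding rel by (simp add: E.i_zero D.j_zero)
  moreover have "?q \<in> carrier R" using c(1) v by (intro D.R.M.finsum_closed) auto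
  ultimately have "?q = \<zero>\<^bsub>R\<^esub>" using inj_j by (meson inj_onD D.R.M.zero_closed)
  then have "?v = \<zero>\<^bsub>R\<^esub>"
    by (rule algebraic_in_character_kernel_zero[OF D.K.field_axioms D.R.assoc_algebra_axioms Rdom.domain_axioms e v ev c])
  then have "i' ?w = \<zero>\<^bsub>T\<^esub>" using jv D.j_zero by simp
  then have "?w = \<zero>\<^bsub>B\<^esub>"
    using E.i_via_\<Phi>[OF ef wB] E.\<Phi>_zero[OF ef] alg_homD(5)[OF e] wB by simp
  then have w0: "z \<oplus>\<^bsub>B\<^esub> \<ominus>\<^bsub>B\<^esub> (a \<odot>\<^bsub>B\<^esub> \<one>\<^bsub>B\<^esub>) = \<zero>\<^bsub>B\<^esub>"
    using a by (simp add: E.A.smult_l_minus)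
  have a1: "a \<odot>\<^bsub>B\<^esub> \<one>\<^bsub>B\<^esub> \<in> carrier B" using a by simp
  have "z = (z \<oplus>\<^bsub>B\<^esub> \<ominus>\<^bsub>B\<^esub> (a \<odot>\<^bsub>B\<^esub> \<one>\<^bsub>B\<^esub>)) \<oplus>\<^bsub>B\<^esub> a \<odot>\<^bsub>B\<^esub> \<one>\<^bsub>B\<^esub>"
    using zB a1 by (simp only: E.A.M.a_assoc E.A.M.a_inv_closed E.A.M.l_neg E.A.M.r_zero)
  then have "z = a \<odot>\<^bsub>B\<^esub> \<one>\<^bsub>B\<^esub>" using w0 a1 by (simp only: E.A.M.l_zero)
  then show "z \<in> (\<lambda>c. c \<odot>\<^bsub>B\<^esub> \<one>\<^bsub>B\<^esub>) ` carrier K" using a by blast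
qed

lemma image_j: "j ` carrier R \<subseteq> j' ` carrier R"
  using D.image_central[OF Rdom.is_cring] E.center_subset_image[OF center_B] by blast

text \<open>Let \<open>\<rho> : T \<rightarrow> A\<close> evaluate the first copy of \<open>R\<close> at \<open>e\<close>, and \<open>\<sigma> : T \<rightarrow> B\<close> the second copy at
  \<open>e \<circ> \<theta>\<close>. Since the copies have the same image, both maps send \<open>j r\<close> to the scalar \<open>e r\<close>, so
  \<open>\<sigma> \<circ> i \<circ> \<rho> = \<sigma>\<close> and \<open>\<rho> \<circ> i' \<circ> \<sigma> = \<rho>\<close>. Hence \<open>\<sigma> \<circ> i\<close> and \<open>\<rho> \<circ> i'\<close> are inverse to each other.\<close>

theorem factors_isomorphic: "alg_isomorphic K A B"
proof -
  let ?e' = "e \<circ> \<theta>"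
  have e': "?e' \<in> alg_hom K R (ground_alg K)" by (rule alg_hom_comp[OF \<theta>_hom e])
  note ef = alg_hom_linear_functional[OF e] and ef' = alg_hom_linear_functional[OF e']
  note p = D.\<Phi>_character[OF e] and p' = E.\<Phi>_character[OF e']
  note ps = alg_homD[OF p] and ps' = alg_homD[OF p']
  have ec: "e r \<in> carrier K" if "r \<in> carrier R" for r using linear_functionalD(2)[OF ef that] .
  have pj: "\<Phi> e (j r) = e r \<odot>\<^bsub>A\<^esub> \<one>\<^bsub>A\<^esub>" if "r \<in> carrier R" for r using D.j_via_\<Phi>[OF ef that] .
  have pj': "\<Phi> e (j' r) = e (\<theta> r) \<odot>\<^bsub>A\<^esub> \<one>\<^bsub>A\<^esub>" if "r \<in> carrier R" for r
    using pj[OF \<theta>_closed[OF that]] j_\<theta>[OF that] by simp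
  have p'j': "\<Psi> ?e' (j' r) = e (\<theta> r) \<odot>\<^bsub>B\<^esub> \<one>\<^bsub>B\<^esub>" if "r \<in> carrier R" for r
    using E.j_via_\<Phi>[OF ef' that] by simp
  have p'j: "\<Psi> ?e' (j r) = e r \<odot>\<^bsub>B\<^esub> \<one>\<^bsub>B\<^esub>" if r: "r \<in> carrier R" for r
  proof -
    obtain s where s: "s \<in> carrier R" "j r = j' s" using image_j r by blast
    then have "\<theta> s = r" using j_\<theta>[of s] inj_j r \<theta>_closed by (metis inj_onD)
    then show ?thesis using s p'j' by simp
  qed
  have 1: "\<Psi> ?e' (i (\<Phi> e t)) = \<Psi> ?e' t" if "t \<in> carrier T" for t
    using that
  proof (induction rule: D.T_induct)
    case zero
    then show ?case by (simp only: D.\<Phi>_zero[OF ef] D.i_zero)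
  next
    case (step a r t)
    have "\<Psi> ?e' (i a \<otimes>\<^bsub>T\<^esub> j r) = \<Psi> ?e' (i (e r \<odot>\<^bsub>A\<^esub> a))"
      using step ec[of r] ps'(2)[of "i a"] by (simp add: ps'(4,6) D.i_simps D.j_simps p'j E.A.smult_mult_right del: comp_apply)
    then show ?case using step ec[of r] D.\<Phi>_closed[OF ef, of t]
      by (simp add: D.\<Phi>_step[OF ef] D.i_simps ps'(3) D.pure_closed del: comp_apply)
  qed
  have 2: "\<Phi> e (i' (\<Psi> ?e' t)) = \<Phi> e t" if "t \<in> carrier T" for t
    using that
  proof (induction rule: E.T_induct)
    case zero
    then show ?case by (simp only: E.\<Phi>_zero[OF ef'] E.i_zero)
  next
    case (step a r t)
    have "\<Phi> e (i' a \<otimes>\<^bsub>T\<^esub> j' r) = \<Phi> e (i' (e (\<theta> r) \<odot>\<^bsub>B\<^esub> a))"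
      using step ec[OF \<theta>_closed, of r] ps(2)[of "i' a"] by (simp add: ps(4,6) E.i_simps E.j_simps pj' D.A.smult_mult_right)
    moreover have "\<Psi> ?e' (i' a \<otimes>\<^bsub>T\<^esub> j' r \<oplus>\<^bsub>T\<^esub> t) = e (\<theta> r) \<odot>\<^bsub>B\<^esub> a \<oplus>\<^bsub>B\<^esub> \<Psi> ?e' t"
      using E.\<Phi>_step[OF ef'] step by simp
    ultimately show ?case using step ec[OF \<theta>_closed, of r] E.\<Phi>_closed[OF ef', of t]
      by (simp add: E.i_simps ps(3) E.pure_closed del: comp_apply)
  qed
  have one: "\<Phi> e (i a) = a" if "a \<in> carrier A" for a
    using D.i_via_\<Phi>[OF ef that] alg_homD(5)[OF e] that by simp
  have one': "\<Psi> ?e' (i' b) = b" if "b \<in> carrier B" for b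
    using E.i_via_\<Phi>[OF ef' that] alg_homD(5)[OF e'] that by (simp del: comp_apply)
  have "\<Psi> ?e' \<circ> i \<in> alg_hom K A B" by (rule alg_hom_comp[OF D.i p'])
  moreover have "bij_betw (\<Psi> ?e' \<circ> i) (carrier A) (carrier B)"
  proof (rule bij_betw_byWitness[where f' = "\<Phi> e \<circ> i'"])
    show "\<forall>a \<in> carrier A. (\<Phi> e \<circ> i') ((\<Psi> ?e' \<circ> i) a) = a"
      using 2[OF D.i_simps(1)] one by (simp add: comp_def)
    show "\<forall>b \<in> carrier B. (\<Psi> ?e' \<circ> i) ((\<Phi> e \<circ> i') b) = b"
      using 1[OF E.i_simps(1)] one' by (simp add: comp_def)
    show "(\<Psi> ?e' \<circ> i) ` carrier A \<subseteq> carrier B"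
      using ps'(2)[OF D.i_simps(1)] by (auto simp: comp_def)
    show "(\<Phi> e \<circ> i') ` carrier B \<subseteq> carrier A"
      using ps(2)[OF E.i_simps(1)] by (auto simp: comp_def)
  qed
  ultimately show ?thesis unfolding alg_isomorphic_def alg_iso_altdef by blast
qed

end

lemma cancel_common_tensor_factor:
  assumes D: "tensor_decomposition K A R T i j \<Phi>" and E: "tensor_decomposition K B R S i' j' \<Psi>"
    and h: "alg_isomorphic K T S" and R: "domain R" "fin_gen_alg K R" "e \<in> alg_hom K R (ground_alg K)"
    and A: "\<one>\<^bsub>A\<^esub> \<noteq> \<zero>\<^bsub>A\<^esub>" "ring_center A \<subseteq> (\<lambda>c. c \<odot>\<^bsub>A\<^esub> \<one>\<^bsub>A\<^esub>) ` carrier K"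
  shows "alg_isomorphic K A B"
proof -
  obtain g where g: "g \<in> alg_iso K T S" using h by (auto simp: alg_isomorphic_def)
  have S: "assoc_algebra K S" using E by (rule tensor_decomposition.axioms)
  have "tensor_cancellation K A R S (g \<circ> i) (g \<circ> j) (\<lambda>\<phi>. \<Phi> \<phi> \<circ> inv_into (carrier T) g) B i' j' \<Psi> e"
    by (intro tensor_cancellation.intro tensor_cancellation_axioms.intro
        tensor_decomposition_transport[OF D S g] E R A)
  then show ?thesis by (rule tensor_cancellation.factors_isomorphic)
qed

section \<open>Quotients of algebras\<close>

locale algebra_ideal = F: assoc_algebra K F + I: ideal I F
  for K :: "('k, 'z) ring_scheme" and F :: "('k, 'a, 'd) module_scheme" and I :: "'a set"
begin

abbreviation Q where "Q \<equiv> quot_alg F I"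

lemma Q_simps:
  "carrier Q = carrier (F Quot I)" "monoid.mult Q = monoid.mult (F Quot I)" "one Q = one (F Quot I)"
  "zero Q = zero (F Quot I)" "add Q = add (F Quot I)"
  by (simp_all add: quot_alg_def)

definition proj where "proj x = I +>\<^bsub>F\<^esub> x"

lemma proj_ring_hom: "proj \<in> ring_hom F (F Quot I)"
  using I.rcos_ring_hom unfolding proj_def by (simp add: eta_contract_eq)

lemma ideal_smult: "c \<in> carrier K \<Longrightarrow> x \<in> I \<Longrightarrow> c \<odot>\<^bsub>F\<^esub> x \<in> I"
proof -
  assume c: "c \<in> carrier K" and x: "x \<in> I"
  have xF: "x \<in> carrier F" using x by (rule I.Icarr)
  have "c \<odot>\<^bsub>F\<^esub> x = (c \<odot>\<^bsub>F\<^esub> \<one>\<^bsub>F\<^esub>) \<otimes>\<^bsub>F\<^esub> x" using c xF by (simp add: F.smult_mult_left)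
  then show ?thesis using I.I_l_closed[OF x] c by simp
qed

lemma proj_eq_iff:
  assumes "x \<in> carrier F" "y \<in> carrier F" shows "proj x = proj y \<longleftrightarrow> x \<ominus>\<^bsub>F\<^esub> y \<in> I"
  unfolding proj_def using F.A.quotient_eq_iff_same_a_r_cos[OF I.is_ideal assms] by simp

lemma proj_memD:
  assumes "y \<in> carrier F" "x \<in> proj y" shows "x \<in> carrier F" "proj x = proj y"
proof -
  show "x \<in> carrier F" using assms unfolding proj_def
    by (meson F.M.a_r_coset_subset_G I.a_subset subsetD)
  then show "proj x = proj y" unfolding proj_def
    using I.a_repr_independence' assms by (metis proj_def)
qed

lemma proj_self: "x \<in> carrier F \<Longrightarrow> x \<in> proj x"
  unfolding proj_def by (rule I.a_rcos_self)

lemma smult_proj: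
  assumes c: "c \<in> carrier K" and y: "y \<in> carrier F"
  shows "c \<odot>\<^bsub>Q\<^esub> proj y = proj (c \<odot>\<^bsub>F\<^esub> y)"
proof -
  have "proj (c \<odot>\<^bsub>F\<^esub> x) = proj (c \<odot>\<^bsub>F\<^esub> y)" if x: "x \<in> proj y" for x
  proof -
    have xF: "x \<in> carrier F" and "x \<ominus>\<^bsub>F\<^esub> y \<in> I"
      using proj_memD[OF y x] y proj_eq_iff by auto
    then have "c \<odot>\<^bsub>F\<^esub> (x \<ominus>\<^bsub>F\<^esub> y) \<in> I" using c by (intro ideal_smult)
    also have "c \<odot>\<^bsub>F\<^esub> (x \<ominus>\<^bsub>F\<^esub> y) = c \<odot>\<^bsub>F\<^esub> x \<ominus>\<^bsub>F\<^esub> c \<odot>\<^bsub>F\<^esub> y"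
      using c xF y by (simp add: a_minus_def F.smult_r_distr F.smult_r_minus)
    finally show ?thesis using c xF y by (subst proj_eq_iff) auto
  qed
  then have "(\<Union>x\<in>proj y. proj (c \<odot>\<^bsub>F\<^esub> x)) = proj (c \<odot>\<^bsub>F\<^esub> y)" using proj_self[OF y] by blast
  then show ?thesis by (simp add: quot_alg_def proj_def)
qed

lemma carrier_Q: "carrier Q = proj ` carrier F"
  unfolding Q_simps FactRing_def A_RCOSETS_def'[of F I] proj_def by auto

lemma proj_simps:
  "x \<in> carrier F \<Longrightarrow> proj x \<in> carrier Q"
  "x \<in> carrier F \<Longrightarrow> y \<in> carrier F \<Longrightarrow> proj (x \<oplus>\<^bsub>F\<^esub> y) = proj x \<oplus>\<^bsub>Q\<^esub> proj y"
  "x \<in> carrier F \<Longrightarrow> y \<in> carrier F \<Longrightarrow> proj (x \<otimes>\<^bsub>F\<^esub> y) = proj x \<otimes>\<^bsub>Q\<^esub> proj y"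
  "proj \<one>\<^bsub>F\<^esub> = \<one>\<^bsub>Q\<^esub>"
  "c \<in> carrier K \<Longrightarrow> x \<in> carrier F \<Longrightarrow> proj (c \<odot>\<^bsub>F\<^esub> x) = c \<odot>\<^bsub>Q\<^esub> proj x"
  using proj_ring_hom by (auto simp: ring_hom_def Q_simps smult_proj)

lemma assoc_algebra_Q: "assoc_algebra K Q"
proof (rule assoc_algebraI)
  show "ring Q" unfolding quot_alg_def by (rule with_scalars_ring[OF I.quotient_is_ring])
qed (auto simp: carrier_Q proj_simps(2-5)[symmetric] F.smult_l_distr F.smult_r_distr F.smult_assoc1
    F.smult_mult_left F.smult_mult_right F.R.cring_axioms)

lemma proj_hom: "proj \<in> alg_hom K F Q"
  by (intro alg_homI additive_mapI) (auto simp: proj_simps)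

sublocale Q: assoc_algebra K Q by (rule assoc_algebra_Q)

lemma proj_zero: "proj \<zero>\<^bsub>F\<^esub> = \<zero>\<^bsub>Q\<^esub>"
  by (rule additive_map_zero[OF F.M.abelian_group_axioms Q.M.abelian_group_axioms alg_homD(1)[OF proj_hom]])

text \<open>The value at an arbitrary representative of the coset; for maps that vanish on \<open>I\<close> it does
  not depend on the choice.\<close>

definition descend :: "('a \<Rightarrow> 'v) \<Rightarrow> 'a set \<Rightarrow> 'v"
  where "descend h C = h (SOME x. x \<in> C)"

lemma descend_proj:
  assumes V: "abelian_group V" and h: "additive_map F V h" "\<And>x. x \<in> I \<Longrightarrow> h x = \<zero>\<^bsub>V\<^esub>"
    and x: "x \<in> carrier F"
  shows "descend h (proj x) = h x"
proof -
  interpret V: abelian_group V by fact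
  define y where "y = (SOME y. y \<in> proj x)"
  have y: "y \<in> proj x" unfolding y_def by (rule someI[of _ x]) (rule proj_self[OF x])
  note yF = proj_memD[OF x y]
  have "h (y \<ominus>\<^bsub>F\<^esub> x) = \<zero>\<^bsub>V\<^esub>" using yF x proj_eq_iff h(2) by blast
  moreover have "y = (y \<ominus>\<^bsub>F\<^esub> x) \<oplus>\<^bsub>F\<^esub> x" using yF x by (simp add: a_minus_def F.M.a_assoc F.M.l_neg)
  ultimately have "h y = h x"
    using additive_map_add[OF h(1), of "y \<ominus>\<^bsub>F\<^esub> x" x] additive_map_closed[OF h(1) x] yF x by simp
  then show ?thesis by (simp add: descend_def y_def[symmetric])
qed

lemma descend_additive:
  assumes V: "abelian_group V" and h: "additive_map F V h" "\<And>x. x \<in> I \<Longrightarrow> h x = \<zero>\<^bsub>V\<^esub>"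
  shows "additive_map Q V (descend h)"
  by (rule additive_mapI)
    (auto simp: carrier_Q descend_proj[OF V h] additive_map_closed[OF h(1)] proj_simps(2)[symmetric]
      additive_map_add[OF h(1)])

end

section \<open>The tensor product by generators and relations\<close>

locale tensor_product = K: field K + A: assoc_algebra K A + R: assoc_algebra K R
  for K :: "('k, 'z) ring_scheme" and A :: "('k, 'a, 'd) module_scheme"
    and R :: "('k, 'r, 'e) module_scheme"
begin

sublocale G: monoid_algebra K "ground_alg K" "A \<times>\<times> R"
  by (intro monoid_algebra.intro ground_alg_assoc_algebra K.is_cring DirProd_monoid
      A.A.monoid_axioms R.A.monoid_axioms)

abbreviation \<F> where "\<F> \<equiv> tensor_free K A R"

abbreviation \<J> where "\<J> \<equiv> Idl\<^bsub>\<F>\<^esub> (tensor_rels K A R)"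

definition pair :: "'k \<Rightarrow> 'a \<Rightarrow> 'r \<Rightarrow> 'a \<times> 'r \<Rightarrow> 'k"
  where "pair c a r = single (ground_alg K) c (a, r)"

lemma free_eq: "\<F> = monoid_alg (ground_alg K) (A \<times>\<times> R)"
  by (simp add: tensor_free_def)

sublocale F: assoc_algebra K \<F>
  unfolding free_eq by (rule G.assoc_algebra_F)

lemma pair_closed [simp]:
  "c \<in> carrier K \<Longrightarrow> a \<in> carrier A \<Longrightarrow> r \<in> carrier R \<Longrightarrow> pair c a r \<in> carrier \<F>"
  using G.single_closed[of c "(a, r)"] by (simp add: pair_def free_eq DirProd_def)

lemma pair_mult:
  "c \<in> carrier K \<Longrightarrow> a \<in> carrier A \<Longrightarrow> r \<in> carrier R \<Longrightarrow>
   d \<in> carrier K \<Longrightarrow> b \<in> carrier A \<Longrightarrow> s \<in> carrier R \<Longrightarrow>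
   pair c a r \<otimes>\<^bsub>\<F>\<^esub> pair d b s = pair (c \<otimes>\<^bsub>K\<^esub> d) (a \<otimes>\<^bsub>A\<^esub> b) (r \<otimes>\<^bsub>R\<^esub> s)"
  using G.mult_single[of c d "(a, r)" "(b, s)"] by (simp add: pair_def free_eq DirProd_def)

lemma pair_smult: "c \<in> carrier K \<Longrightarrow> c \<odot>\<^bsub>\<F>\<^esub> pair d a r = pair (c \<otimes>\<^bsub>K\<^esub> d) a r"
  using G.smult_single[of c d "(a, r)"] by (simp add: pair_def free_eq)

lemma pair_one: "\<one>\<^bsub>\<F>\<^esub> = pair \<one>\<^bsub>K\<^esub> \<one>\<^bsub>A\<^esub> \<one>\<^bsub>R\<^esub>"
  using G.F_simps(4) by (simp add: pair_def free_eq DirProd_def)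

lemma basis_pair: "basis_elt K (a, r) = pair \<one>\<^bsub>K\<^esub> a r"
  by (auto simp: pair_def basis_elt_def single_def)

lemma \<F>_induct [consumes 1, case_names zero add]:
  assumes "f \<in> carrier \<F>" "P \<zero>\<^bsub>\<F>\<^esub>"
    "\<And>c a r g. c \<in> carrier K \<Longrightarrow> a \<in> carrier A \<Longrightarrow> r \<in> carrier R \<Longrightarrow> g \<in> carrier \<F> \<Longrightarrow> P g \<Longrightarrow>
      P (pair c a r \<oplus>\<^bsub>\<F>\<^esub> g)"
  shows "P f"
proof (rule G.F_induct[of f])
  fix c :: 'k and u g assume *: "c \<in> carrier (ground_alg K)" "u \<in> carrier (A \<times>\<times> R)"
    "g \<in> carrier (monoid_alg (ground_alg K) (A \<times>\<times> R))" "P g"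
  obtain a r where u: "u = (a, r)" by (cases u)
  show "P (single (ground_alg K) c u \<oplus>\<^bsub>monoid_alg (ground_alg K) (A \<times>\<times> R)\<^esub> g)"
    using assms(3)[of c a r g] * unfolding u pair_def free_eq by (simp add: DirProd_def)
qed (use assms(1,2) in \<open>simp_all add: free_eq\<close>)

lemma rels_closed: "tensor_rels K A R \<subseteq> carrier \<F>"
  unfolding tensor_rels_def Let_def basis_pair
  by (auto intro!: F.M.minus_closed F.smult_closed pair_closed)

sublocale I: algebra_ideal K \<F> \<J>
  by (intro algebra_ideal.intro F.assoc_algebra_axioms F.A.genideal_ideal rels_closed)

abbreviation \<T> where "\<T> \<equiv> tensor_alg K A R"

lemma \<T>_eq: "\<T> = quot_alg \<F> \<J>"
  by (simp add: tensor_alg_def)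

abbreviation \<pi> where "\<pi> \<equiv> I.proj"

lemma proj_eq_sum_if_diff_in_ideal:
  assumes "x \<in> carrier \<F>" "y \<in> carrier \<F>" "z \<in> carrier \<F>" "x \<ominus>\<^bsub>\<F>\<^esub> y \<ominus>\<^bsub>\<F>\<^esub> z \<in> \<J>"
  shows "\<pi> x = \<pi> y \<oplus>\<^bsub>\<T>\<^esub> \<pi> z"
proof -
  have "x \<ominus>\<^bsub>\<F>\<^esub> y \<ominus>\<^bsub>\<F>\<^esub> z = x \<ominus>\<^bsub>\<F>\<^esub> (y \<oplus>\<^bsub>\<F>\<^esub> z)"
    using assms by (simp add: a_minus_def F.M.minus_add F.M.a_assoc)
  then have "\<pi> x = \<pi> (y \<oplus>\<^bsub>\<F>\<^esub> z)" using assms by (subst I.proj_eq_iff) auto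
  then show ?thesis using assms by (simp add: I.proj_simps \<T>_eq)
qed

lemma pair_add_left:
  assumes "a \<in> carrier A" "a' \<in> carrier A" "r \<in> carrier R"
  shows "\<pi> (pair \<one>\<^bsub>K\<^esub> (a \<oplus>\<^bsub>A\<^esub> a') r) = \<pi> (pair \<one>\<^bsub>K\<^esub> a r) \<oplus>\<^bsub>\<T>\<^esub> \<pi> (pair \<one>\<^bsub>K\<^esub> a' r)"
proof (rule proj_eq_sum_if_diff_in_ideal)
  show "pair \<one>\<^bsub>K\<^esub> (a \<oplus>\<^bsub>A\<^esub> a') r \<ominus>\<^bsub>\<F>\<^esub> pair \<one>\<^bsub>K\<^esub> a r \<ominus>\<^bsub>\<F>\<^esub> pair \<one>\<^bsub>K\<^esub> a' r \<in> \<J>"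
    by (rule subsetD[OF F.A.genideal_self[OF rels_closed]])
      (use assms in \<open>auto simp: tensor_rels_def Let_def basis_pair\<close>)
qed (use assms in auto)

lemma pair_add_right:
  assumes "a \<in> carrier A" "r \<in> carrier R" "r' \<in> carrier R"
  shows "\<pi> (pair \<one>\<^bsub>K\<^esub> a (r \<oplus>\<^bsub>R\<^esub> r')) = \<pi> (pair \<one>\<^bsub>K\<^esub> a r) \<oplus>\<^bsub>\<T>\<^esub> \<pi> (pair \<one>\<^bsub>K\<^esub> a r')"
proof (rule proj_eq_sum_if_diff_in_ideal)
  show "pair \<one>\<^bsub>K\<^esub> a (r \<oplus>\<^bsub>R\<^esub> r') \<ominus>\<^bsub>\<F>\<^esub> pair \<one>\<^bsub>K\<^esub> a r \<ominus>\<^bsub>\<F>\<^esub> pair \<one>\<^bsub>K\<^esub> a r' \<in> \<J>"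
    by (rule subsetD[OF F.A.genideal_self[OF rels_closed]])
      (use assms in \<open>auto simp: tensor_rels_def Let_def basis_pair\<close>)
qed (use assms in auto)

lemma pair_smult_left:
  assumes "c \<in> carrier K" "a \<in> carrier A" "r \<in> carrier R"
  shows "\<pi> (pair \<one>\<^bsub>K\<^esub> (c \<odot>\<^bsub>A\<^esub> a) r) = c \<odot>\<^bsub>\<T>\<^esub> \<pi> (pair \<one>\<^bsub>K\<^esub> a r)"
proof -
  have "pair \<one>\<^bsub>K\<^esub> (c \<odot>\<^bsub>A\<^esub> a) r \<ominus>\<^bsub>\<F>\<^esub> c \<odot>\<^bsub>\<F>\<^esub> pair \<one>\<^bsub>K\<^esub> a r \<in> \<J>"
    by (rule subsetD[OF F.A.genideal_self[OF rels_closed]])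
      (use assms in \<open>auto simp: tensor_rels_def Let_def basis_pair\<close>)
  then have "\<pi> (pair \<one>\<^bsub>K\<^esub> (c \<odot>\<^bsub>A\<^esub> a) r) = \<pi> (c \<odot>\<^bsub>\<F>\<^esub> pair \<one>\<^bsub>K\<^esub> a r)"
    using assms by (subst I.proj_eq_iff) auto
  then show ?thesis using assms by (simp add: I.proj_simps \<T>_eq)
qed

lemma pair_smult_right:
  assumes "c \<in> carrier K" "a \<in> carrier A" "r \<in> carrier R"
  shows "\<pi> (pair \<one>\<^bsub>K\<^esub> a (c \<odot>\<^bsub>R\<^esub> r)) = c \<odot>\<^bsub>\<T>\<^esub> \<pi> (pair \<one>\<^bsub>K\<^esub> a r)"
proof -
  have "pair \<one>\<^bsub>K\<^esub> a (c \<odot>\<^bsub>R\<^esub> r) \<ominus>\<^bsub>\<F>\<^esub> c \<odot>\<^bsub>\<F>\<^esub> pair \<one>\<^bsub>K\<^esub> a r \<in> \<J>"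
    by (rule subsetD[OF F.A.genideal_self[OF rels_closed]])
      (use assms in \<open>auto simp: tensor_rels_def Let_def basis_pair\<close>)
  then have "\<pi> (pair \<one>\<^bsub>K\<^esub> a (c \<odot>\<^bsub>R\<^esub> r)) = \<pi> (c \<odot>\<^bsub>\<F>\<^esub> pair \<one>\<^bsub>K\<^esub> a r)"
    using assms by (subst I.proj_eq_iff) auto
  then show ?thesis using assms by (simp add: I.proj_simps \<T>_eq)
qed

text \<open>The map \<open>id \<otimes> \<phi>\<close> before the bilinearity relations are divided out.\<close>

definition contract :: "('r \<Rightarrow> 'k) \<Rightarrow> ('a \<times> 'r \<Rightarrow> 'k) \<Rightarrow> 'a"
  where "contract \<phi> = G.term_sum A (\<lambda>u c. (c \<otimes>\<^bsub>K\<^esub> \<phi> (snd u)) \<odot>\<^bsub>A\<^esub> fst u)"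

lemma contract_term_additive:
  assumes "linear_functional K R \<phi>" "u \<in> carrier (A \<times>\<times> R)"
  shows "additive_map (ground_alg K) A (\<lambda>c. (c \<otimes>\<^bsub>K\<^esub> \<phi> (snd u)) \<odot>\<^bsub>A\<^esub> fst u)"
proof -
  have "\<phi> (snd u) \<in> carrier K" "fst u \<in> carrier A"
    using assms by (auto simp: DirProd_def linear_functionalD(2))
  then show ?thesis by (intro additive_mapI) (auto simp: K.l_distr A.smult_l_distr)
qed

lemma contract_additive: "linear_functional K R \<phi> \<Longrightarrow> additive_map \<F> A (contract \<phi>)"
  unfolding contract_def free_eq
  by (rule G.term_sum_additive[OF A.M.abelian_group_axioms contract_term_additive])

lemma contract_pair:
  assumes "linear_functional K R \<phi>" "c \<in> carrier K" "a \<in> carrier A" "r \<in> carrier R"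
  shows "contract \<phi> (pair c a r) = (c \<otimes>\<^bsub>K\<^esub> \<phi> r) \<odot>\<^bsub>A\<^esub> a"
  unfolding contract_def pair_def using assms
  by (subst G.term_sum_single[OF A.M.abelian_group_axioms contract_term_additive])
    (auto simp: DirProd_def)

lemma contract_zero: "linear_functional K R \<phi> \<Longrightarrow> contract \<phi> \<zero>\<^bsub>\<F>\<^esub> = \<zero>\<^bsub>A\<^esub>"
  by (rule additive_map_zero[OF F.M.abelian_group_axioms A.M.abelian_group_axioms contract_additive])

lemma functional_mult_left:
  assumes "linear_functional K R \<phi>" "r \<in> carrier R"
  shows "linear_functional K R (\<lambda>s. \<phi> (r \<otimes>\<^bsub>R\<^esub> s))"
  unfolding linear_functional_def using assms
  by (auto intro!: additive_mapI simp: linear_functionalD[OF assms(1)] R.A.r_distr R.smult_mult_right)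

lemma functional_mult_right:
  assumes "linear_functional K R \<phi>" "r \<in> carrier R"
  shows "linear_functional K R (\<lambda>s. \<phi> (s \<otimes>\<^bsub>R\<^esub> r))"
  unfolding linear_functional_def using assms
  by (auto intro!: additive_mapI simp: linear_functionalD[OF assms(1)] R.A.l_distr R.smult_mult_left)

lemma contract_mult_left:
  assumes \<phi>: "linear_functional K R \<phi>" and "c \<in> carrier K" "a \<in> carrier A" "r \<in> carrier R" "f \<in> carrier \<F>"
  shows "contract \<phi> (pair c a r \<otimes>\<^bsub>\<F>\<^esub> f) = c \<odot>\<^bsub>A\<^esub> (a \<otimes>\<^bsub>A\<^esub> contract (\<lambda>s. \<phi> (r \<otimes>\<^bsub>R\<^esub> s)) f)"
  using assms(5)
proof (induction rule: \<F>_induct)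
  case zero
  then show ?case using assms functional_mult_left by (simp add: contract_zero)
next
  case (add d b s g)
  note \<psi> = functional_mult_left[OF \<phi> assms(4)]
  have cl: "contract (\<lambda>s. \<phi> (r \<otimes>\<^bsub>R\<^esub> s)) g \<in> carrier A"
    by (rule additive_map_closed[OF contract_additive[OF \<psi>] add(4)])
  have fc: "\<phi> (r \<otimes>\<^bsub>R\<^esub> s) \<in> carrier K" using linear_functionalD(2)[OF \<phi>] assms add by simp
  have "contract \<phi> (pair c a r \<otimes>\<^bsub>\<F>\<^esub> (pair d b s \<oplus>\<^bsub>\<F>\<^esub> g)) =
      (c \<otimes>\<^bsub>K\<^esub> d \<otimes>\<^bsub>K\<^esub> \<phi> (r \<otimes>\<^bsub>R\<^esub> s)) \<odot>\<^bsub>A\<^esub> (a \<otimes>\<^bsub>A\<^esub> b) \<oplus>\<^bsub>A\<^esub> contract \<phi> (pair c a r \<otimes>\<^bsub>\<F>\<^esub> g)"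
    using assms add by (simp add: F.A.r_distr pair_mult additive_map_add[OF contract_additive[OF \<phi>]] contract_pair)
  also have "\<dots> = c \<odot>\<^bsub>A\<^esub> (a \<otimes>\<^bsub>A\<^esub> ((d \<otimes>\<^bsub>K\<^esub> \<phi> (r \<otimes>\<^bsub>R\<^esub> s)) \<odot>\<^bsub>A\<^esub> b \<oplus>\<^bsub>A\<^esub> contract (\<lambda>s. \<phi> (r \<otimes>\<^bsub>R\<^esub> s)) g))"
    using assms add cl fc
    by (simp add: A.A.r_distr A.smult_r_distr A.smult_mult_right A.smult_assoc1 K.m_assoc)
  also have "(d \<otimes>\<^bsub>K\<^esub> \<phi> (r \<otimes>\<^bsub>R\<^esub> s)) \<odot>\<^bsub>A\<^esub> b \<oplus>\<^bsub>A\<^esub> contract (\<lambda>s. \<phi> (r \<otimes>\<^bsub>R\<^esub> s)) g =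
      contract (\<lambda>s. \<phi> (r \<otimes>\<^bsub>R\<^esub> s)) (pair d b s \<oplus>\<^bsub>\<F>\<^esub> g)"
    using add by (simp add: additive_map_add[OF contract_additive[OF \<psi>]] contract_pair[OF \<psi>])
  finally show ?case .
qed

lemma contract_mult_right:
  assumes \<phi>: "linear_functional K R \<phi>" and "c \<in> carrier K" "a \<in> carrier A" "r \<in> carrier R" "f \<in> carrier \<F>"
  shows "contract \<phi> (f \<otimes>\<^bsub>\<F>\<^esub> pair c a r) = c \<odot>\<^bsub>A\<^esub> (contract (\<lambda>s. \<phi> (s \<otimes>\<^bsub>R\<^esub> r)) f \<otimes>\<^bsub>A\<^esub> a)"
  using assms(5)
proof (induction rule: \<F>_induct)
  case zero
  then show ?case using assms functional_mult_right by (simp add: contract_zero)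
next
  case (add d b s g)
  note \<psi> = functional_mult_right[OF \<phi> assms(4)]
  have cl: "contract (\<lambda>s. \<phi> (s \<otimes>\<^bsub>R\<^esub> r)) g \<in> carrier A"
    by (rule additive_map_closed[OF contract_additive[OF \<psi>] add(4)])
  have fc: "\<phi> (s \<otimes>\<^bsub>R\<^esub> r) \<in> carrier K" using linear_functionalD(2)[OF \<phi>] assms add by simp
  have "contract \<phi> ((pair d b s \<oplus>\<^bsub>\<F>\<^esub> g) \<otimes>\<^bsub>\<F>\<^esub> pair c a r) =
      (c \<otimes>\<^bsub>K\<^esub> d \<otimes>\<^bsub>K\<^esub> \<phi> (s \<otimes>\<^bsub>R\<^esub> r)) \<odot>\<^bsub>A\<^esub> (b \<otimes>\<^bsub>A\<^esub> a) \<oplus>\<^bsub>A\<^esub> contract \<phi> (g \<otimes>\<^bsub>\<F>\<^esub> pair c a r)"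
    using assms add by (simp add: F.A.l_distr pair_mult additive_map_add[OF contract_additive[OF \<phi>]] contract_pair K.m_comm)
  also have "\<dots> = c \<odot>\<^bsub>A\<^esub> (((d \<otimes>\<^bsub>K\<^esub> \<phi> (s \<otimes>\<^bsub>R\<^esub> r)) \<odot>\<^bsub>A\<^esub> b \<oplus>\<^bsub>A\<^esub> contract (\<lambda>s. \<phi> (s \<otimes>\<^bsub>R\<^esub> r)) g) \<otimes>\<^bsub>A\<^esub> a)"
    using assms add cl fc
    by (simp add: A.A.l_distr A.smult_r_distr A.smult_mult_left A.smult_assoc1 K.m_assoc)
  also have "(d \<otimes>\<^bsub>K\<^esub> \<phi> (s \<otimes>\<^bsub>R\<^esub> r)) \<odot>\<^bsub>A\<^esub> b \<oplus>\<^bsub>A\<^esub> contract (\<lambda>s. \<phi> (s \<otimes>\<^bsub>R\<^esub> r)) g =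
      contract (\<lambda>s. \<phi> (s \<otimes>\<^bsub>R\<^esub> r)) (pair d b s \<oplus>\<^bsub>\<F>\<^esub> g)"
    using add by (simp add: additive_map_add[OF contract_additive[OF \<psi>]] contract_pair[OF \<psi>])
  finally show ?case .
qed

text \<open>An ideal that contains the bilinearity relations and so bounds the ideal they generate from
  above. A single kernel need not be an ideal, but the family of all contractions is stable under
  multiplication: a factor \<open>r\<close> turns the contraction by \<open>\<phi>\<close> into the one by \<open>\<lambda>s. \<phi> (r \<otimes> s)\<close>.\<close>

definition common_kernel where
  "common_kernel = {f \<in> carrier \<F>. \<forall>\<phi>. linear_functional K R \<phi> \<longrightarrow> contract \<phi> f = \<zero>\<^bsub>A\<^esub>}"

lemma common_kernel_ideal: "ideal common_kernel \<F>"
proof (rule idealI[OF F.A.ring_axioms])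
  note hom = additive_map_add[OF contract_additive]
    additive_map_a_inv[OF F.M.abelian_group_axioms A.M.abelian_group_axioms contract_additive]
  show sub: "subgroup common_kernel (add_monoid \<F>)"
    by (rule group.subgroupI[OF F.M.a_group])
      (auto simp: common_kernel_def hom a_inv_def[symmetric] contract_zero intro!: exI[of _ "\<zero>\<^bsub>\<F>\<^esub>"])
  have sum_mem: "x \<oplus>\<^bsub>\<F>\<^esub> y \<in> common_kernel" if "x \<in> common_kernel" "y \<in> common_kernel" for x y
    using that by (auto simp: common_kernel_def hom)
  have zero_mem: "\<zero>\<^bsub>\<F>\<^esub> \<in> common_kernel" by (auto simp: common_kernel_def contract_zero)
  fix f x assume f: "f \<in> common_kernel" and x: "x \<in> carrier \<F>"
  have fF: "f \<in> carrier \<F>" and f0: "\<And>\<phi>. linear_functional K R \<phi> \<Longrightarrow> contract \<phi> f = \<zero>\<^bsub>A\<^esub>"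
    using f by (auto simp: common_kernel_def)
  show "x \<otimes>\<^bsub>\<F>\<^esub> f \<in> common_kernel" using x
  proof (induction rule: \<F>_induct)
    case zero
    then show ?case using fF zero_mem by simp
  next
    case (add c a r g)
    then have "pair c a r \<otimes>\<^bsub>\<F>\<^esub> f \<in> common_kernel"
      using fF by (auto simp: common_kernel_def contract_mult_left f0 functional_mult_left)
    then show ?case using add sum_mem fF
      by (simp add: F.A.l_distr)
  qed
  show "f \<otimes>\<^bsub>\<F>\<^esub> x \<in> common_kernel" using x
  proof (induction rule: \<F>_induct)
    case zero
    then show ?case using fF zero_mem by simp
  next
    case (add c a r g)
    then have "f \<otimes>\<^bsub>\<F>\<^esub> pair c a r \<in> common_kernel"
      using fF by (auto simp: common_kernel_def contract_mult_right f0 functional_mult_right)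
    then show ?case using add sum_mem fF
      by (simp add: F.A.r_distr)
  qed
qed

lemma contract_vanishes:
  assumes "linear_functional K R \<phi>" "f \<in> \<J>" shows "contract \<phi> f = \<zero>\<^bsub>A\<^esub>"
proof -
  have "tensor_rels K A R \<subseteq> common_kernel"
  proof
    fix f assume f: "f \<in> tensor_rels K A R"
    have diff: "contract \<phi> (x \<ominus>\<^bsub>\<F>\<^esub> y) = contract \<phi> x \<ominus>\<^bsub>A\<^esub> contract \<phi> y"
      if "linear_functional K R \<phi>" "x \<in> carrier \<F>" "y \<in> carrier \<F>" for \<phi> x y
      by (rule additive_map_minus[OF F.M.abelian_group_axioms A.M.abelian_group_axioms contract_additive[OF that(1)] that(2,3)])
    have cancel: "x \<oplus>\<^bsub>A\<^esub> y \<ominus>\<^bsub>A\<^esub> x \<ominus>\<^bsub>A\<^esub> y = \<zero>\<^bsub>A\<^esub>" "x \<ominus>\<^bsub>A\<^esub> x = \<zero>\<^bsub>A\<^esub>"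
      if "x \<in> carrier A" "y \<in> carrier A" for x y
      using that by (simp_all add: a_minus_def A.M.a_comm[of x y] A.M.a_assoc A.M.r_neg)
    have "contract \<phi> f = \<zero>\<^bsub>A\<^esub>" if \<phi>: "linear_functional K R \<phi>" for \<phi>
      using f linear_functionalD(2)[OF \<phi>] unfolding tensor_rels_def Let_def basis_pair
      by (elim UnE CollectE exE conjE)
        (simp_all add: diff[OF \<phi>] contract_pair[OF \<phi>] pair_smult linear_functionalD(3,4)[OF \<phi>]
          F.M.minus_closed A.smult_r_distr A.smult_l_distr A.smult_assoc1[symmetric] K.m_comm cancel)
    then show "f \<in> common_kernel" using f rels_closed by (auto simp: common_kernel_def)
  qed
  then have "\<J> \<subseteq> common_kernel" by (rule F.A.genideal_minimal[OF common_kernel_ideal])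
  then show ?thesis using assms by (auto simp: common_kernel_def)
qed

lemma tensor_alg_decomposition:
  "tensor_decomposition K A R \<T> (\<lambda>a. \<pi> (pair \<one>\<^bsub>K\<^esub> a \<one>\<^bsub>R\<^esub>)) (\<lambda>r. \<pi> (pair \<one>\<^bsub>K\<^esub> \<one>\<^bsub>A\<^esub> r))
    (\<lambda>\<phi>. I.descend (contract \<phi>))"
proof (intro tensor_decomposition.intro tensor_decomposition_axioms.intro)
  let ?i = "\<lambda>a. \<pi> (pair \<one>\<^bsub>K\<^esub> a \<one>\<^bsub>R\<^esub>)" and ?j = "\<lambda>r. \<pi> (pair \<one>\<^bsub>K\<^esub> \<one>\<^bsub>A\<^esub> r)"
  show "assoc_algebra K \<T>" unfolding \<T>_eq by (rule I.assoc_algebra_Q)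
  note ps = I.proj_simps[folded \<T>_eq]
  show "?i \<in> alg_hom K A \<T>"
    by (intro alg_homI additive_mapI) (simp_all add: ps pair_add_left pair_smult_left ps(3,4)[symmetric] pair_mult pair_one)
  show "?j \<in> alg_hom K R \<T>"
    by (intro alg_homI additive_mapI) (simp_all add: ps pair_add_right pair_smult_right ps(3,4)[symmetric] pair_mult pair_one)
  have ij: "?i a \<otimes>\<^bsub>\<T>\<^esub> ?j r = \<pi> (pair \<one>\<^bsub>K\<^esub> a r)" if "a \<in> carrier A" "r \<in> carrier R" for a r
    using that by (simp add: ps(3)[symmetric] pair_mult)
  show "?j r \<otimes>\<^bsub>\<T>\<^esub> ?i a = ?i a \<otimes>\<^bsub>\<T>\<^esub> ?j r" if "a \<in> carrier A" "r \<in> carrier R" for a r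
    using that by (simp add: ps(3)[symmetric] pair_mult)
  show "carrier \<T> \<subseteq> pure_sums \<T> ?i ?j (carrier A) (carrier R)"
  proof
    fix t assume "t \<in> carrier \<T>"
    then obtain f where f: "f \<in> carrier \<F>" "t = \<pi> f" unfolding \<T>_eq I.carrier_Q by blast
    have "\<pi> f \<in> pure_sums \<T> ?i ?j (carrier A) (carrier R)" using f(1)
    proof (induction rule: \<F>_induct)
      case zero
      then show ?case unfolding I.proj_zero \<T>_eq by (rule pure_sums.zero)
    next
      case (add c a r g)
      have "pair c a r = c \<odot>\<^bsub>\<F>\<^esub> pair \<one>\<^bsub>K\<^esub> a r" using add by (simp add: pair_smult)
      then have "\<pi> (pair c a r) = \<pi> (pair \<one>\<^bsub>K\<^esub> (c \<odot>\<^bsub>A\<^esub> a) r)"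
        using add by (simp only: ps(5) pair_closed K.one_closed pair_smult_left)
      also have "\<dots> = ?i (c \<odot>\<^bsub>A\<^esub> a) \<otimes>\<^bsub>\<T>\<^esub> ?j r"
        using add by (simp only: ij A.smult_closed)
      finally have "\<pi> (pair c a r) = ?i (c \<odot>\<^bsub>A\<^esub> a) \<otimes>\<^bsub>\<T>\<^esub> ?j r" .
      then show ?case using add by (simp add: ps(2)) (rule pure_sums.step, auto)
    qed
    then show "t \<in> pure_sums \<T> ?i ?j (carrier A) (carrier R)" using f by simp
  qed
  fix \<phi> assume \<phi>: "linear_functional K R \<phi>"
  note d = A.M.abelian_group_axioms contract_additive[OF \<phi>] contract_vanishes[OF \<phi>]
  show "additive_map \<T> A (I.descend (contract \<phi>))"
    unfolding \<T>_eq by (rule I.descend_additive[OF d])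
  show "I.descend (contract \<phi>) (?i a \<otimes>\<^bsub>\<T>\<^esub> ?j r) = \<phi> r \<odot>\<^bsub>A\<^esub> a" if "a \<in> carrier A" "r \<in> carrier R" for a r
    using that by (simp add: ij I.descend_proj[OF d] contract_pair[OF \<phi>] linear_functionalD(2)[OF \<phi>])
qed (intro_locales)

end

section \<open>Cancellation for algebras with trivial center\<close>

text \<open>\<open>A[M] = A \<otimes> K[M]\<close>, and \<open>id \<otimes> \<phi>\<close> evaluates \<open>\<phi>\<close> at each element of \<open>M\<close> and multiplies with the
  coefficient there.\<close>

lemma monoid_alg_decomposition:
  fixes K :: "('k, 'z) ring_scheme" and A :: "('k, 'a, 'd) module_scheme" and M :: "('m, 'n) monoid_scheme"
  assumes "field K" "assoc_algebra K A" "monoid M"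
  shows "tensor_decomposition K A (monoid_alg (ground_alg K) M) (monoid_alg A M)
    (\<lambda>a. single A a \<one>\<^bsub>M\<^esub>) (\<lambda>r u. r u \<odot>\<^bsub>A\<^esub> \<one>\<^bsub>A\<^esub>)
    (\<lambda>\<phi> f. \<Oplus>\<^bsub>A\<^esub>u\<in>supp A f. \<phi> (single (ground_alg K) \<one>\<^bsub>K\<^esub> u) \<odot>\<^bsub>A\<^esub> f u)"
proof -
  interpret K: field K by fact
  interpret P: monoid_algebra K A M using assms by (intro monoid_algebra.intro)
  interpret Q: monoid_algebra K "ground_alg K" M
    using assms by (intro monoid_algebra.intro ground_alg_assoc_algebra K.is_cring)
  interpret PF: assoc_algebra K "monoid_alg A M" by (rule P.assoc_algebra_F)
  interpret QF: assoc_algebra K "monoid_alg (ground_alg K) M" by (rule Q.assoc_algebra_F)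
  let ?k = "ground_alg K"
  let ?R = "monoid_alg ?k M" and ?T = "monoid_alg A M"
  let ?i = "\<lambda>a. single A a \<one>\<^bsub>M\<^esub>" and ?j = "\<lambda>r u. r u \<odot>\<^bsub>A\<^esub> \<one>\<^bsub>A\<^esub>"
  let ?\<Phi> = "\<lambda>\<phi> f. \<Oplus>\<^bsub>A\<^esub>u\<in>supp A f. \<phi> (single ?k \<one>\<^bsub>K\<^esub> u) \<odot>\<^bsub>A\<^esub> f u"
  have j_single: "?j (single ?k c u) = single A (c \<odot>\<^bsub>A\<^esub> \<one>\<^bsub>A\<^esub>) u" for c :: 'k and u
    by (auto simp: single_def)
  have single_smult: "single ?k c u = c \<odot>\<^bsub>?R\<^esub> single ?k \<one>\<^bsub>K\<^esub> u" if "c \<in> carrier K" for c u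
    using that by (simp add: Q.smult_single)
  have j_add: "additive_map ?R ?T ?j"
  proof (rule additive_mapI)
    fix r assume r: "r \<in> carrier ?R"
    have "supp A (?j r) \<subseteq> supp ?k r" by (auto simp: supp_def)
    then show "?j r \<in> carrier ?T" using Q.carrierD[OF r] by (auto simp: P.carrier_iff intro: finite_subset)
    fix s assume s: "s \<in> carrier ?R"
    show "?j (r \<oplus>\<^bsub>?R\<^esub> s) = ?j r \<oplus>\<^bsub>?T\<^esub> ?j s"
      using Q.carrierD(1)[OF r] Q.carrierD(1)[OF s] by (auto simp: P.F_simps Q.F_simps P.A.smult_l_distr)
  qed
  have j_closed: "?j r \<in> carrier ?T" if "r \<in> carrier ?R" for r
    using additive_map_closed[OF j_add that] .
  have j_hom: "?j \<in> alg_hom K ?R ?T"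
  proof (rule alg_homI[OF j_add])
    show "?j (r \<otimes>\<^bsub>?R\<^esub> s) = ?j r \<otimes>\<^bsub>?T\<^esub> ?j s" if "r \<in> carrier ?R" "s \<in> carrier ?R" for r s
    proof (rule Q.mult_hom_if_on_singles[OF P.ring_F j_add _ that])
      fix a u b v assume *: "a \<in> carrier ?k" "u \<in> carrier M" "b \<in> carrier ?k" "v \<in> carrier M"
      show "?j (single ?k (a \<otimes>\<^bsub>?k\<^esub> b) (u \<otimes>\<^bsub>M\<^esub> v)) = ?j (single ?k a u) \<otimes>\<^bsub>?T\<^esub> ?j (single ?k b v)"
        unfolding j_single using * by (simp add: P.mult_single P.A.smult_mult_left P.A.smult_assoc1)
    qed
    show "?j \<one>\<^bsub>?R\<^esub> = \<one>\<^bsub>?T\<^esub>" unfolding P.F_simps Q.F_simps j_single by simp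
    show "?j (c \<odot>\<^bsub>?R\<^esub> r) = c \<odot>\<^bsub>?T\<^esub> ?j r" if "c \<in> carrier K" "r \<in> carrier ?R" for c r
      using that Q.carrierD(1)[OF that(2)] by (auto simp: P.F_simps Q.F_simps P.A.smult_assoc1)
  qed
  have i_closed: "?i a \<in> carrier ?T" if "a \<in> carrier A" for a using that by (intro P.single_closed) auto
  have ij_single: "?i a \<otimes>\<^bsub>?T\<^esub> ?j (single ?k c u) = single A (c \<odot>\<^bsub>A\<^esub> a) u"
    "?j (single ?k c u) \<otimes>\<^bsub>?T\<^esub> ?i a = single A (c \<odot>\<^bsub>A\<^esub> a) u"
    if "a \<in> carrier A" "c \<in> carrier K" "u \<in> carrier M" for a c u
    unfolding j_single using that by (simp_all add: P.mult_single P.A.smult_mult_right P.A.smult_mult_left)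
  have ij_add: "additive_map ?R ?T (\<lambda>r. ?i a \<otimes>\<^bsub>?T\<^esub> ?j r)" if "a \<in> carrier A" for a
    using i_closed[OF that] j_closed by (intro additive_mapI) (simp_all only: additive_map_add[OF j_add] PF.A.r_distr PF.A.m_closed)
  have ji_add: "additive_map ?R ?T (\<lambda>r. ?j r \<otimes>\<^bsub>?T\<^esub> ?i a)" if "a \<in> carrier A" for a
    using i_closed[OF that] j_closed by (intro additive_mapI) (simp_all only: additive_map_add[OF j_add] PF.A.l_distr PF.A.m_closed)
  show ?thesis
  proof (intro tensor_decomposition.intro tensor_decomposition_axioms.intro)
    show "?i \<in> alg_hom K A ?T"
    proof (rule alg_homI)
      show "additive_map A ?T ?i" by (rule P.single_linear) simp
    qed (auto simp: P.mult_single P.F_simps(4) P.smult_single)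
    show "?j \<in> alg_hom K ?R ?T" by (rule j_hom)
    show "?j r \<otimes>\<^bsub>?T\<^esub> ?i a = ?i a \<otimes>\<^bsub>?T\<^esub> ?j r" if a: "a \<in> carrier A" and r: "r \<in> carrier ?R" for a r
      by (rule Q.additive_map_cong_on_singles[OF P.abelian_group_F ji_add[OF a] ij_add[OF a] _ r])
        (simp only: ij_single a ground_alg_simps)
    show "carrier ?T \<subseteq> pure_sums ?T ?i ?j (carrier A) (carrier ?R)"
    proof
      fix t assume "t \<in> carrier ?T"
      then show "t \<in> pure_sums ?T ?i ?j (carrier A) (carrier ?R)"
      proof (induction rule: P.F_induct)
        case zero
        then show ?case by (rule pure_sums.zero)
      next
        case (add a u g)
        have "single A a u = ?i a \<otimes>\<^bsub>?T\<^esub> ?j (single ?k \<one>\<^bsub>K\<^esub> u)"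
          using add by (simp only: ij_single K.one_closed P.A.smult_one)
        then show ?case using add Q.single_closed[of "\<one>\<^bsub>K\<^esub>" u] by (simp only:) (rule pure_sums.step, simp_all)
      qed
    qed
    fix \<phi> assume \<phi>: "linear_functional K ?R \<phi>"
    have eq: "?\<Phi> \<phi> = P.term_sum A (\<lambda>u a. \<phi> (single ?k \<one>\<^bsub>K\<^esub> u) \<odot>\<^bsub>A\<^esub> a)"
      by (simp add: P.term_sum_def fun_eq_iff)
    have \<phi>c: "\<phi> (single ?k \<one>\<^bsub>K\<^esub> u) \<in> carrier K" if "u \<in> carrier M" for u
      using that by (intro linear_functionalD(2)[OF \<phi>] Q.single_closed) auto
    have G: "additive_map A A (\<lambda>a. \<phi> (single ?k \<one>\<^bsub>K\<^esub> u) \<odot>\<^bsub>A\<^esub> a)" if "u \<in> carrier M" for u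
      using \<phi>c[OF that] by (intro additive_mapI) (auto simp: P.A.smult_r_distr)
    show add: "additive_map ?T A (?\<Phi> \<phi>)"
      unfolding eq by (rule P.term_sum_additive[OF P.A.M.abelian_group_axioms G])
    show "?\<Phi> \<phi> (?i a \<otimes>\<^bsub>?T\<^esub> ?j r) = \<phi> r \<odot>\<^bsub>A\<^esub> a" if a: "a \<in> carrier A" and r: "r \<in> carrier ?R" for a r
    proof (rule Q.additive_map_cong_on_singles[OF P.A.M.abelian_group_axioms _ _ _ r])
      show "additive_map ?R A (\<lambda>r. ?\<Phi> \<phi> (?i a \<otimes>\<^bsub>?T\<^esub> ?j r))"
        by (intro additive_mapI)
          (simp_all only: additive_map_closed[OF add] additive_map_add[OF add]
            additive_map_closed[OF ij_add[OF a]] additive_map_add[OF ij_add[OF a]])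
      show "additive_map ?R A (\<lambda>r. \<phi> r \<odot>\<^bsub>A\<^esub> a)"
        using a by (intro additive_mapI) (simp_all add: linear_functionalD(2,3)[OF \<phi>] P.A.smult_l_distr)
      fix c u assume c: "c \<in> carrier ?k" and u: "u \<in> carrier M"
      have e1: "?i a \<otimes>\<^bsub>?T\<^esub> ?j (single ?k c u) = single A (c \<odot>\<^bsub>A\<^esub> a) u"
        using a c u by (intro ij_single) simp_all
      have e2: "P.term_sum A (\<lambda>u a. \<phi> (single ?k \<one>\<^bsub>K\<^esub> u) \<odot>\<^bsub>A\<^esub> a) (single A (c \<odot>\<^bsub>A\<^esub> a) u) =
          \<phi> (single ?k \<one>\<^bsub>K\<^esub> u) \<odot>\<^bsub>A\<^esub> (c \<odot>\<^bsub>A\<^esub> a)"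
        by (rule P.term_sum_single[OF P.A.M.abelian_group_axioms G]) (use a c u in auto)
      have "?\<Phi> \<phi> (?i a \<otimes>\<^bsub>?T\<^esub> ?j (single ?k c u)) = \<phi> (single ?k \<one>\<^bsub>K\<^esub> u) \<odot>\<^bsub>A\<^esub> (c \<odot>\<^bsub>A\<^esub> a)"
        by (rule trans[OF fun_cong[OF eq]]) (simp only: e1 e2)
      also have "\<dots> = \<phi> (c \<odot>\<^bsub>?R\<^esub> single ?k \<one>\<^bsub>K\<^esub> u) \<odot>\<^bsub>A\<^esub> a"
        using a c u \<phi>c[OF u] Q.single_closed[of "\<one>\<^bsub>K\<^esub>" u]
        by (simp add: linear_functionalD(4)[OF \<phi>] P.A.smult_assoc1[symmetric] K.m_comm)
      finally show "?\<Phi> \<phi> (?i a \<otimes>\<^bsub>?T\<^esub> ?j (single ?k c u)) = \<phi> (single ?k c u) \<odot>\<^bsub>A\<^esub> a"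
        using c by (simp only: single_smult[of c u] ground_alg_simps)
    qed
  qed (intro_locales)
qed

text \<open>Exponents of polynomials: natural numbers, or multisets with the multiset order. The order
  provides leading terms.\<close>

locale ordered_exponents = field K for K :: "('k, 'z) ring_scheme" (structure) +
  fixes M :: "('m::{linorder, ordered_cancel_ab_semigroup_add, zero}) monoid"
  assumes mult_M: "monoid.mult M = (+)" and one_M: "one M = 0" and comm_monoid_M: "comm_monoid M"
begin

sublocale M: comm_monoid M by (rule comm_monoid_M)

sublocale Q: monoid_algebra K "ground_alg K" M
  by (intro monoid_algebra.intro ground_alg_assoc_algebra is_cring M.monoid_axioms)

abbreviation KM where "KM \<equiv> monoid_alg (ground_alg K) M"

sublocale F: assoc_algebra K KM by (rule Q.assoc_algebra_F)

lemma cring_KM: "cring KM"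
proof (rule cringI[OF Q.abelian_group_F])
  have "f \<otimes>\<^bsub>KM\<^esub> g = g \<otimes>\<^bsub>KM\<^esub> f" if "f \<in> carrier KM" "g \<in> carrier KM" for f g
  proof -
    have 1: "f \<otimes>\<^bsub>KM\<^esub> single (ground_alg K) c u = single (ground_alg K) c u \<otimes>\<^bsub>KM\<^esub> f"
      if "f \<in> carrier KM" "c \<in> carrier K" "u \<in> carrier M" for f c u
      using that
      by (induction rule: Q.F_induct)
        (simp_all add: Q.single_closed F.A.l_distr F.A.r_distr Q.mult_single m_comm M.m_comm)
    show ?thesis using that(2,1)
      by (induction rule: Q.F_induct) (simp_all add: Q.single_closed F.A.l_distr F.A.r_distr 1)
  qed
  then show "Group.comm_monoid KM" by (intro monoid.monoid_comm_monoidI F.A.monoid_axioms)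
qed (rule F.A.l_distr)

text \<open>The product of the leading terms cannot cancel, because \<open>u + v\<close> is the sum of no other pair
  of elements of the supports.\<close>

lemma domain_KM: "domain KM"
proof (intro domain.intro cring_KM domain_axioms.intro)
  show "\<one>\<^bsub>KM\<^esub> \<noteq> \<zero>\<^bsub>KM\<^esub>"
    using one_not_zero by (auto simp: Q.F_simps single_def fun_eq_iff)
next
  fix f g assume fg: "f \<otimes>\<^bsub>KM\<^esub> g = \<zero>\<^bsub>KM\<^esub>" and f: "f \<in> carrier KM" and g: "g \<in> carrier KM"
  show "f = \<zero>\<^bsub>KM\<^esub> \<or> g = \<zero>\<^bsub>KM\<^esub>"
  proof (rule ccontr)
    assume "\<not> ?thesis"
    then have ne: "supp (ground_alg K) f \<noteq> {}" "supp (ground_alg K) g \<noteq> {}"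
      by (auto simp: supp_def Q.F_simps)
    let ?U = "supp (ground_alg K) f" and ?V = "supp (ground_alg K) g"
    note fc = Q.carrierD[OF f] and gc = Q.carrierD[OF g]
    define u where "u = Max ?U"
    define v where "v = Max ?V"
    have u: "u \<in> ?U" "\<And>x. x \<in> ?U \<Longrightarrow> x \<le> u" using fc ne by (auto simp: u_def)
    have v: "v \<in> ?V" "\<And>x. x \<in> ?V \<Longrightarrow> x \<le> v" using gc ne by (auto simp: v_def)
    have "z = (u, v)" if z: "z \<in> ?U \<times> ?V" "fst z + snd z = u + v" for z
    proof (rule ccontr)
      assume "z \<noteq> (u, v)"
      moreover have "fst z \<le> u" "snd z \<le> v" using z u v by auto
      ultimately have "fst z < u \<or> snd z < v" by (cases z) auto
      then have "fst z + snd z < u + v"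
        using \<open>fst z \<le> u\<close> \<open>snd z \<le> v\<close> add_less_le_mono add_le_less_mono by blast
      then show False using z by simp
    qed
    then have eq: "{z \<in> ?U \<times> ?V. fst z \<otimes>\<^bsub>M\<^esub> snd z = u + v} = {(u, v)}"
      using u v by (auto simp: mult_M)
    have "(f \<otimes>\<^bsub>KM\<^esub> g) (u + v) = (\<Oplus>\<^bsub>ground_alg K\<^esub>z\<in>{(u, v)}. f (fst z) \<otimes>\<^bsub>ground_alg K\<^esub> g (snd z))"
      unfolding eq[symmetric]
      by (rule Q.mult_box[OF f g fc(3) subset_refl fc(2) gc(3) subset_refl gc(2)])
    also have "\<dots> = f u \<otimes> g v" using fc(1) gc(1) by simp
    finally have "f u \<otimes> g v = \<zero>" using fg by (simp add: Q.F_simps)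
    then show False using integral[of "f u" "g v"] fc(1) gc(1) u v by (auto simp: supp_def)
  qed
qed

text \<open>Evaluation of all variables at \<open>1\<close>.\<close>

definition augmentation where "augmentation = Q.term_sum (ground_alg K) (\<lambda>_ c. c)"

lemma augmentation_hom: "augmentation \<in> alg_hom K KM (ground_alg K)"
proof -
  have ag: "abelian_group (ground_alg K)" by (rule Q.A.M.abelian_group_axioms)
  have rg: "ring (ground_alg K)" by (rule Q.A.A.ring_axioms)
  have G: "additive_map (ground_alg K) (ground_alg K) (\<lambda>c. c)" by (auto intro: additive_mapI)
  have add: "additive_map KM (ground_alg K) augmentation"
    unfolding augmentation_def by (rule Q.term_sum_additive[OF ag G])
  have single: "augmentation (single (ground_alg K) c u) = c" if "c \<in> carrier K" "u \<in> carrier M" for c u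
    unfolding augmentation_def using that by (subst Q.term_sum_single[OF ag G]) auto
  have mult: "augmentation (f \<otimes>\<^bsub>KM\<^esub> g) = augmentation f \<otimes>\<^bsub>ground_alg K\<^esub> augmentation g"
    if "f \<in> carrier KM" "g \<in> carrier KM" for f g
    by (rule Q.mult_hom_if_on_singles[OF rg add _ that]) (simp add: single)
  have one: "augmentation \<one>\<^bsub>KM\<^esub> = \<one>" unfolding Q.F_simps by (simp add: single)
  show ?thesis
  proof (rule alg_homI)
    show "augmentation (f \<otimes>\<^bsub>KM\<^esub> g) = augmentation f \<otimes>\<^bsub>ground_alg K\<^esub> augmentation g"
      if "f \<in> carrier KM" "g \<in> carrier KM" for f g using that by (rule mult)
    show "augmentation (c \<odot>\<^bsub>KM\<^esub> f) = c \<odot>\<^bsub>ground_alg K\<^esub> augmentation f"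
      if c: "c \<in> carrier K" and f: "f \<in> carrier KM" for c f
    proof -
      have c1: "c \<odot>\<^bsub>KM\<^esub> \<one>\<^bsub>KM\<^esub> = single (ground_alg K) c \<one>\<^bsub>M\<^esub>"
        using c by (simp add: Q.F_simps(4) Q.smult_single)
      have "c \<odot>\<^bsub>KM\<^esub> f = (c \<odot>\<^bsub>KM\<^esub> \<one>\<^bsub>KM\<^esub>) \<otimes>\<^bsub>KM\<^esub> f" using c f by (simp add: F.smult_mult_left)
      then have "augmentation (c \<odot>\<^bsub>KM\<^esub> f) = augmentation (c \<odot>\<^bsub>KM\<^esub> \<one>\<^bsub>KM\<^esub>) \<otimes> augmentation f"
        using mult[of "c \<odot>\<^bsub>KM\<^esub> \<one>\<^bsub>KM\<^esub>" f] c f by simp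
      then show ?thesis using c by (simp add: c1 single)
    qed
  qed (simp_all add: one add)
qed

text \<open>The assumption \<open>gen\<close> states that \<open>S\<close> generates \<open>M\<close>, in the form of the induction rule by
  which it is used.\<close>

lemma fin_gen_KM:
  assumes S: "finite S" "S \<subseteq> carrier M"
    and gen: "\<And>P u. u \<in> carrier M \<Longrightarrow> P 0 \<Longrightarrow> (\<And>s v. s \<in> S \<Longrightarrow> v \<in> carrier M \<Longrightarrow> P v \<Longrightarrow> P (s + v)) \<Longrightarrow> P u"
  shows "fin_gen_alg K KM"
proof -
  let ?e = "single (ground_alg K) \<one>"
  let ?H = "(\<lambda>c. c \<odot>\<^bsub>KM\<^esub> \<one>\<^bsub>KM\<^esub>) ` carrier K \<union> ?e ` S"
  let ?G = "generate_ring KM ?H"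
  have H: "?H \<subseteq> carrier KM" using S Q.single_closed by auto
  have G: "?G \<subseteq> carrier KM"
  proof
    fix x assume "x \<in> ?G"
    then show "x \<in> carrier KM" by induction (use H in auto)
  qed
  \<comment> \<open>By generation of \<open>M\<close>, all monomials are products of those from \<open>S\<close>.\<close>
  have e: "?e u \<in> ?G" if "u \<in> carrier M" for u
    using that
  proof (rule gen)
    show "?e 0 \<in> ?G" using generate_ring.one[of KM ?H] by (simp add: Q.F_simps(4) one_M)
    fix s v assume *: "s \<in> S" "v \<in> carrier M" "?e v \<in> ?G"
    have "?e (s + v) = ?e s \<otimes>\<^bsub>KM\<^esub> ?e v" using * S by (subst Q.mult_single) (auto simp: mult_M)
    moreover have "?e s \<in> ?G" using * by (intro generate_ring.incl) auto
    ultimately show "?e (s + v) \<in> ?G" using * by (simp add: generate_ring.eng_mult)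
  qed
  have "f \<in> ?G" if "f \<in> carrier KM" for f
    using that
  proof (induction rule: Q.F_induct)
    case zero
    have "\<zero> \<odot>\<^bsub>KM\<^esub> \<one>\<^bsub>KM\<^esub> \<in> ?G" by (intro generate_ring.incl UnI1 imageI zero_closed)
    then show ?case by simp
  next
    case (add c u g)
    have "single (ground_alg K) c u = (c \<odot>\<^bsub>KM\<^esub> \<one>\<^bsub>KM\<^esub>) \<otimes>\<^bsub>KM\<^esub> ?e u"
      using add by (simp add: F.smult_mult_left Q.single_closed Q.smult_single)
    moreover have "c \<odot>\<^bsub>KM\<^esub> \<one>\<^bsub>KM\<^esub> \<in> ?G" using add by (intro generate_ring.incl UnI1 imageI) simp
    ultimately have "single (ground_alg K) c u \<in> ?G" using e[OF add(2)] by (simp only: generate_ring.eng_mult)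
    then show ?case using add by (intro generate_ring.eng_add)
  qed
  then have "?G = carrier KM" using G by blast
  then show ?thesis unfolding fin_gen_alg_def using S H by (intro exI[of _ "?e ` S"]) blast
qed

end

lemma trivial_center_universally_cancellative:
  assumes K: "field K" and A: "assoc_algebra K A" "\<one>\<^bsub>A\<^esub> \<noteq> \<zero>\<^bsub>A\<^esub>"
    "ring_center A \<subseteq> (\<lambda>c. c \<odot>\<^bsub>A\<^esub> \<one>\<^bsub>A\<^esub>) ` carrier K"
  shows "universally_cancellative K A TYPE('r) TYPE('b)"
  unfolding universally_cancellative_def
proof (intro allI impI)
  fix R :: "('a, 'r) module" and B :: "('a, 'b) module"
  assume R: "assoc_algebra K R" "domain R" "fin_gen_alg K R"
    and "\<exists>I. ideal I R \<and> alg_isomorphic K (quot_alg R I) (ground_alg K)"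
    and B: "assoc_algebra K B" and iso: "alg_isomorphic K (tensor_alg K A R) (tensor_alg K B R)"
  then obtain I h where I: "ideal I R" and h: "h \<in> alg_iso K (quot_alg R I) (ground_alg K)"
    by (auto simp: alg_isomorphic_def)
  interpret I: algebra_ideal K R I by (intro algebra_ideal.intro R I)
  have e: "h \<circ> I.proj \<in> alg_hom K R (ground_alg K)"
    using alg_hom_comp[OF I.proj_hom] h by (auto simp: alg_iso_altdef)
  interpret TA: tensor_product K A R by (intro tensor_product.intro K A R)
  interpret TB: tensor_product K B R by (intro tensor_product.intro K B R)
  show "alg_isomorphic K A B"
    by (rule cancel_common_tensor_factor[OF TA.tensor_alg_decomposition TB.tensor_alg_decomposition iso R(2,3) e A(2,3)])
qed

lemma monomials_simps [simp]:
  "carrier (monomials d) = {u. set_mset u \<subseteq> {..<d}}" "monoid.mult (monomials d) = (+)" "one (monomials d) = {#}"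
  by (simp_all add: monomials_def)

lemma ordered_exponents_monomials: "field K \<Longrightarrow> ordered_exponents K (monomials d)"
  by (intro ordered_exponents.intro ordered_exponents_axioms.intro comm_monoidI) (auto simp: ac_simps)

lemma trivial_center_strongly_cancellative:
  assumes K: "field K" and A: "assoc_algebra K A" "\<one>\<^bsub>A\<^esub> \<noteq> \<zero>\<^bsub>A\<^esub>"
    "ring_center A \<subseteq> (\<lambda>c. c \<odot>\<^bsub>A\<^esub> \<one>\<^bsub>A\<^esub>) ` carrier K"
  shows "strongly_cancellative K A TYPE('b)"
  unfolding strongly_cancellative_def mpoly_alg_def
proof (intro allI impI)
  fix d :: nat and B :: "('a, 'b) module"
  assume B: "assoc_algebra K B"
    and iso: "alg_isomorphic K (monoid_alg A (monomials d)) (monoid_alg B (monomials d))"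
  interpret E: ordered_exponents K "monomials d" by (rule ordered_exponents_monomials[OF K])
  have "fin_gen_alg K E.KM"
  proof (rule E.fin_gen_KM)
    show "finite ((\<lambda>i. {#i#}) ` {..<d})" "(\<lambda>i. {#i#}) ` {..<d} \<subseteq> carrier (monomials d)" by auto
    fix P and u :: "nat multiset"
    assume "u \<in> carrier (monomials d)" "P 0"
      "\<And>s v. s \<in> (\<lambda>i. {#i#}) ` {..<d} \<Longrightarrow> v \<in> carrier (monomials d) \<Longrightarrow> P v \<Longrightarrow> P (s + v)"
    then show "P u"
    proof (induction u)
      case (add x u)
      have "P ({#x#} + u)" using add by (intro add.prems) auto
      then show ?case by simp
    qed simp
  qed
  then show "alg_isomorphic K A B"
    by (rule cancel_common_tensor_factor[OF monoid_alg_decomposition[OF K A(1) E.M.monoid_axioms]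
          monoid_alg_decomposition[OF K B E.M.monoid_axioms] iso E.domain_KM _ E.augmentation_hom A(2,3)])
qed

definition nat_monoid :: "nat monoid"
  where "nat_monoid = \<lparr>carrier = UNIV, monoid.mult = (+), one = 0\<rparr>"

lemma nat_monoid_simps [simp]:
  "carrier nat_monoid = UNIV" "monoid.mult nat_monoid = (+)" "one nat_monoid = 0"
  by (simp_all add: nat_monoid_def)

lemma comm_monoid_nat: "comm_monoid nat_monoid"
  by (intro comm_monoidI) auto

lemma poly_alg_simps:
  "carrier (poly_alg A) = up A" "monoid.mult (poly_alg A) = monoid.mult (UP A)" "one (poly_alg A) = one (UP A)"
  "add (poly_alg A) = add (UP A)" "c \<odot>\<^bsub>poly_alg A\<^esub> f = (\<lambda>n. c \<odot>\<^bsub>A\<^esub> f n)"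
  by (simp_all add: poly_alg_def UP_def)

text \<open>Both algebras consist of the same functions. They are different records because the
  operations of univariate polynomials are restricted to the carrier.\<close>

lemma poly_alg_iso_monoid_alg:
  assumes "assoc_algebra K A"
  shows "(\<lambda>f. f) \<in> alg_iso K (poly_alg A) (monoid_alg A nat_monoid)"
proof -
  interpret P: monoid_algebra K A nat_monoid
    using assms comm_monoid.axioms(1)[OF comm_monoid_nat] by (intro monoid_algebra.intro)
  have car: "carrier (poly_alg A) = carrier (monoid_alg A nat_monoid)"
  proof (rule Set.set_eqI)
    fix f
    have "(\<exists>n. bound \<zero>\<^bsub>A\<^esub> n f) \<longleftrightarrow> finite (supp A f)"
    proof
      assume "\<exists>n. bound \<zero>\<^bsub>A\<^esub> n f"
      then obtain n where "bound \<zero>\<^bsub>A\<^esub> n f" ..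
      then have "supp A f \<subseteq> {..n}" by (auto simp: supp_def intro: bound_below)
      then show "finite (supp A f)" by (rule finite_subset) simp
    next
      assume fin: "finite (supp A f)"
      have "bound \<zero>\<^bsub>A\<^esub> (Max (insert 0 (supp A f))) f"
      proof
        fix m assume m: "Max (insert 0 (supp A f)) < m"
        show "f m = \<zero>\<^bsub>A\<^esub>"
        proof (rule ccontr)
          assume "f m \<noteq> \<zero>\<^bsub>A\<^esub>"
          then have "m \<le> Max (insert 0 (supp A f))" using fin by (intro Max_ge) (auto simp: supp_def)
          then show False using m by simp
        qed
      qed
      then show "\<exists>n. bound \<zero>\<^bsub>A\<^esub> n f" ..
    qed
    then show "f \<in> carrier (poly_alg A) \<longleftrightarrow> f \<in> carrier (monoid_alg A nat_monoid)"
      by (auto simp: poly_alg_simps up_def P.carrier_iff)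
  qed
  have "(\<lambda>f. f) \<in> alg_hom K (poly_alg A) (monoid_alg A nat_monoid)"
  proof (intro alg_homI additive_mapI)
    fix f g assume f: "f \<in> carrier (poly_alg A)" and g: "g \<in> carrier (poly_alg A)"
    then have fF: "f \<in> carrier (monoid_alg A nat_monoid)" and gF: "g \<in> carrier (monoid_alg A nat_monoid)"
      using car by auto
    have up: "f \<in> up A" "g \<in> up A" using f g by (auto simp: poly_alg_simps)
    show "f \<oplus>\<^bsub>poly_alg A\<^esub> g = f \<oplus>\<^bsub>monoid_alg A nat_monoid\<^esub> g"
      using up by (simp add: poly_alg_simps UP_def P.F_simps)
    show "f \<otimes>\<^bsub>poly_alg A\<^esub> g = f \<otimes>\<^bsub>monoid_alg A nat_monoid\<^esub> g"
    proof
      fix n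
      note cs = P.carrierD[OF fF] P.carrierD[OF gF]
      have "(f \<otimes>\<^bsub>monoid_alg A nat_monoid\<^esub> g) n =
          (\<Oplus>\<^bsub>A\<^esub>z\<in>{z \<in> ({..n} \<union> supp A f) \<times> ({..n} \<union> supp A g). fst z \<otimes>\<^bsub>nat_monoid\<^esub> snd z = n}. f (fst z) \<otimes>\<^bsub>A\<^esub> g (snd z))"
        by (rule P.mult_box[OF fF gF]) (use cs in auto)
      also have "{z \<in> ({..n} \<union> supp A f) \<times> ({..n} \<union> supp A g). fst z \<otimes>\<^bsub>nat_monoid\<^esub> snd z = n} = (\<lambda>k. (k, n - k)) ` {..n}"
        by (auto simp: image_iff)
      also have "(\<Oplus>\<^bsub>A\<^esub>z\<in>(\<lambda>k. (k, n - k)) ` {..n}. f (fst z) \<otimes>\<^bsub>A\<^esub> g (snd z)) = (\<Oplus>\<^bsub>A\<^esub>k\<in>{..n}. f k \<otimes>\<^bsub>A\<^esub> g (n - k))"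
        by (subst P.A.M.finsum_reindex) (use cs in \<open>auto simp: inj_on_def\<close>)
      finally show "(f \<otimes>\<^bsub>poly_alg A\<^esub> g) n = (f \<otimes>\<^bsub>monoid_alg A nat_monoid\<^esub> g) n"
        using up by (simp add: poly_alg_simps UP_def)
    qed
  next
    show "\<one>\<^bsub>poly_alg A\<^esub> = \<one>\<^bsub>monoid_alg A nat_monoid\<^esub>"
      by (auto simp: poly_alg_simps UP_def P.F_simps single_def)
  qed (auto simp: car[symmetric] poly_alg_simps P.F_simps)
  then show ?thesis using car by (simp add: alg_iso_altdef bij_betw_def)
qed

lemma trivial_center_cancellative:
  assumes K: "field K" and A: "assoc_algebra K A" "\<one>\<^bsub>A\<^esub> \<noteq> \<zero>\<^bsub>A\<^esub>"
    "ring_center A \<subseteq> (\<lambda>c. c \<odot>\<^bsub>A\<^esub> \<one>\<^bsub>A\<^esub>) ` carrier K"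
  shows "cancellative K A TYPE('b)"
  unfolding cancellative_def
proof (intro allI impI)
  fix B :: "('a, 'b) module"
  assume B: "assoc_algebra K B" and "alg_isomorphic K (poly_alg A) (poly_alg B)"
  then obtain h where h: "h \<in> alg_iso K (poly_alg A) (poly_alg B)" by (auto simp: alg_isomorphic_def)
  interpret E: ordered_exponents K nat_monoid
    by (intro ordered_exponents.intro ordered_exponents_axioms.intro K comm_monoid_nat) auto
  have monoid: "monoid nat_monoid" by (rule comm_monoid.axioms(1)[OF comm_monoid_nat])
  have h': "h \<in> alg_iso K (monoid_alg A nat_monoid) (poly_alg B)"
  proof -
    note id = poly_alg_iso_monoid_alg[OF A(1)]
    have eq: "carrier (poly_alg A) = carrier (monoid_alg A nat_monoid)"
      using id by (auto simp: alg_iso_altdef bij_betw_def)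
    interpret PA: assoc_algebra K "monoid_alg A nat_monoid"
      by (intro monoid_algebra.assoc_algebra_F monoid_algebra.intro A monoid)
    have idh: "(\<lambda>f. f) \<in> alg_hom K (poly_alg A) (monoid_alg A nat_monoid)"
      and hh: "h \<in> alg_hom K (poly_alg A) (poly_alg B)"
      using id h by (auto simp: alg_iso_altdef)
    have "h \<in> alg_hom K (monoid_alg A nat_monoid) (poly_alg B)"
      by (intro alg_homI additive_mapI)
        (simp_all add: eq[symmetric] alg_homD(3-6)[OF idh, symmetric] alg_homD(2-6)[OF hh])
    then show ?thesis using h eq by (simp add: alg_iso_altdef)
  qed
  have iso: "alg_isomorphic K (monoid_alg A nat_monoid) (monoid_alg B nat_monoid)"
    using alg_iso_comp[OF h' poly_alg_iso_monoid_alg[OF B]] by (auto simp: alg_isomorphic_def)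
  have "fin_gen_alg K E.KM"
  proof (rule E.fin_gen_KM[of "{1}"])
    fix P and u :: nat
    assume "P 0" "\<And>s v. s \<in> {1} \<Longrightarrow> v \<in> carrier nat_monoid \<Longrightarrow> P v \<Longrightarrow> P (s + v)"
    then show "P u" by (induction u) auto
  qed auto
  then show "alg_isomorphic K A B"
    by (rule cancel_common_tensor_factor[OF monoid_alg_decomposition[OF K A(1) monoid]
          monoid_alg_decomposition[OF K B monoid] iso E.domain_KM _ E.augmentation_hom A(2,3)])
qed

section \<open>Operators on the free module of normal monomials\<close>

context assoc_algebra
begin

lemma quasi_commute_pow_right:
  assumes "c \<in> carrier K" "u \<in> carrier A" "v \<in> carrier A" "u \<otimes>\<^bsub>A\<^esub> v = c \<odot>\<^bsub>A\<^esub> (v \<otimes>\<^bsub>A\<^esub> u)"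
  shows "u \<otimes>\<^bsub>A\<^esub> v [^]\<^bsub>A\<^esub> (n::nat) = (c [^]\<^bsub>K\<^esub> n) \<odot>\<^bsub>A\<^esub> (v [^]\<^bsub>A\<^esub> n \<otimes>\<^bsub>A\<^esub> u)"
proof (induction n)
  case 0
  then show ?case using assms by simp
next
  case (Suc n)
  have "u \<otimes>\<^bsub>A\<^esub> v [^]\<^bsub>A\<^esub> Suc n = (u \<otimes>\<^bsub>A\<^esub> v [^]\<^bsub>A\<^esub> n) \<otimes>\<^bsub>A\<^esub> v" using assms by (simp add: A.m_assoc)
  also have "\<dots> = (c [^]\<^bsub>K\<^esub> n) \<odot>\<^bsub>A\<^esub> (v [^]\<^bsub>A\<^esub> n \<otimes>\<^bsub>A\<^esub> (u \<otimes>\<^bsub>A\<^esub> v))"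
    unfolding Suc using assms(1-3) by (simp add: smult_mult_left A.m_assoc)
  also have "\<dots> = (c [^]\<^bsub>K\<^esub> Suc n) \<odot>\<^bsub>A\<^esub> (v [^]\<^bsub>A\<^esub> Suc n \<otimes>\<^bsub>A\<^esub> u)"
    unfolding assms(4) using assms(1-3) by (simp add: smult_mult_right A.m_assoc smult_assoc1)
  finally show ?case .
qed

lemma quasi_commute_pow_left:
  assumes "c \<in> carrier K" "u \<in> carrier A" "v \<in> carrier A" "u \<otimes>\<^bsub>A\<^esub> v = c \<odot>\<^bsub>A\<^esub> (v \<otimes>\<^bsub>A\<^esub> u)"
  shows "u [^]\<^bsub>A\<^esub> (n::nat) \<otimes>\<^bsub>A\<^esub> v = (c [^]\<^bsub>K\<^esub> n) \<odot>\<^bsub>A\<^esub> (v \<otimes>\<^bsub>A\<^esub> u [^]\<^bsub>A\<^esub> n)"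
proof (induction n)
  case 0
  then show ?case using assms by simp
next
  case (Suc n)
  have "u [^]\<^bsub>A\<^esub> Suc n \<otimes>\<^bsub>A\<^esub> v = u [^]\<^bsub>A\<^esub> n \<otimes>\<^bsub>A\<^esub> (u \<otimes>\<^bsub>A\<^esub> v)" using assms by (simp add: A.m_assoc)
  also have "\<dots> = c \<odot>\<^bsub>A\<^esub> ((u [^]\<^bsub>A\<^esub> n \<otimes>\<^bsub>A\<^esub> v) \<otimes>\<^bsub>A\<^esub> u)"
    unfolding assms(4) using assms(1-3) by (simp add: smult_mult_right A.m_assoc)
  also have "\<dots> = (c [^]\<^bsub>K\<^esub> Suc n) \<odot>\<^bsub>A\<^esub> (v \<otimes>\<^bsub>A\<^esub> u [^]\<^bsub>A\<^esub> Suc n)"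
    unfolding Suc using assms(1-3)
    by (simp add: smult_mult_left A.m_assoc smult_assoc1[symmetric] R.m_comm)
  finally show ?case .
qed

end

locale quantum_parameters = field K for K :: "('k, 'z) ring_scheme" (structure) +
  fixes p q l m :: 'k
  assumes p: "p \<in> carrier K - {\<zero>}" and q: "q \<in> carrier K - {\<zero>}"
    and l: "l \<in> carrier K - {\<zero>}" and m: "m \<in> carrier K - {\<zero>}"
begin

lemma params_closed [simp]:
  "p \<in> carrier K" "q \<in> carrier K" "l \<in> carrier K" "m \<in> carrier K"
  "inv q \<in> carrier K" "inv l \<in> carrier K" "inv m \<in> carrier K"
  using p q l m field_Units by auto

lemma params_inv:
  "inv q \<otimes> q = \<one>" "inv l \<otimes> l = \<one>" "inv m \<otimes> m = \<one>"
  "q \<otimes> inv q = \<one>" "l \<otimes> inv l = \<one>" "m \<otimes> inv m = \<one>"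
  using p q l m field_Units by auto

text \<open>The Gaussian number \<open>1 + p + ... + p ^ (n - 1)\<close>, which arises when \<open>x\<close> is moved past \<open>y\<^sup>n\<close>.\<close>

fun qint :: "nat \<Rightarrow> 'k" where
  "qint 0 = \<zero>"
| "qint (Suc n) = qint n \<oplus> p [^] n"

lemma qint_closed [simp]: "qint n \<in> carrier K"
  by (induction n) auto

lemma qint_Suc: "qint (Suc n) = \<one> \<oplus> p \<otimes> qint n"
proof (induction n)
  case (Suc n)
  have "qint (Suc (Suc n)) = (\<one> \<oplus> p \<otimes> qint n) \<oplus> p \<otimes> p [^] n"
    by (simp only: qint.simps(2)[of "Suc n"] Suc nat_pow_Suc m_comm params_closed nat_pow_closed)
  then show ?case by (simp add: r_distr a_assoc)
qed simp

lemma qint_geometric: "(p \<ominus> \<one>) \<otimes> qint n = p [^] n \<ominus> \<one>"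
proof (induction n)
  case (Suc n)
  let ?x = "p [^] n"
  have "(p \<ominus> \<one>) \<otimes> qint (Suc n) = (?x \<ominus> \<one>) \<oplus> (p \<otimes> ?x \<ominus> ?x)"
    using Suc by (simp add: r_distr) (simp add: a_minus_def l_distr l_minus)
  also have "\<dots> = (?x \<oplus> \<ominus> ?x) \<oplus> (p \<otimes> ?x \<ominus> \<one>)"
    unfolding a_minus_def by (simp only: a_ac params_closed nat_pow_closed m_closed a_inv_closed one_closed a_closed)
  also have "\<dots> = p [^] Suc n \<ominus> \<one>" by (simp add: r_neg m_comm)
  finally show ?case .
qed (simp add: a_minus_def r_neg)

text \<open>The exponents \<open>(a, b, c, d)\<close> of \<open>y\<^sup>a x\<^sup>b s\<^sup>c t\<^sup>d\<close>. Taking them as a monoid presents the free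
  module on the exponents as a monoid algebra.\<close>

abbreviation N4 :: "(nat \<times> nat \<times> nat \<times> nat) monoid"
  where "N4 \<equiv> nat_monoid \<times>\<times> nat_monoid \<times>\<times> nat_monoid \<times>\<times> nat_monoid"

lemma monoid_nat: "monoid nat_monoid"
  by (rule comm_monoid.axioms(1)[OF comm_monoid_nat])

lemma carrier_N4 [simp]: "n \<in> carrier N4"
  by (cases n) (simp add: DirProd_def)

sublocale V: monoid_algebra K "ground_alg K" N4
  by (intro monoid_algebra.intro ground_alg_assoc_algebra is_cring DirProd_monoid monoid_nat)

abbreviation VV where "VV \<equiv> monoid_alg (ground_alg K) N4"

sublocale VF: assoc_algebra K VV by (rule V.assoc_algebra_F)

abbreviation vec :: "'k \<Rightarrow> nat \<times> nat \<times> nat \<times> nat \<Rightarrow> nat \<times> nat \<times> nat \<times> nat \<Rightarrow> 'k"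
  where "vec c n \<equiv> single (ground_alg K) c n"

lemma vec_closed [simp]: "c \<in> carrier K \<Longrightarrow> vec c n \<in> carrier VV"
  by (intro V.single_closed) auto

lemma vec_add: "c \<in> carrier K \<Longrightarrow> d \<in> carrier K \<Longrightarrow> vec (c \<oplus> d) n = vec c n \<oplus>\<^bsub>VV\<^esub> vec d n"
  using additive_map_add[OF V.single_linear[of n], of c d] by simp

lemma vec_zero: "vec \<zero> n = \<zero>\<^bsub>VV\<^esub>"
  by (auto simp: V.F_simps single_def)

lemma vec_smult: "c \<in> carrier K \<Longrightarrow> c \<odot>\<^bsub>VV\<^esub> vec d n = vec (c \<otimes> d) n"
  by (simp add: V.smult_single)

text \<open>The normal form of \<open>g y\<^sup>a x\<^sup>b s\<^sup>c t\<^sup>d\<close> for a generator \<open>g\<close>. For \<open>a = 0\<close> the truncated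
  exponent \<open>a - 1\<close> is harmless, as \<open>qint 0 = 0\<close>.\<close>

fun left_term :: "gen \<Rightarrow> nat \<times> nat \<times> nat \<times> nat \<Rightarrow> 'k \<Rightarrow> nat \<times> nat \<times> nat \<times> nat \<Rightarrow> 'k" where
  "left_term GX (a, b, c, d) k =
    vec (k \<otimes> p [^] a) (a, Suc b, c, d) \<oplus>\<^bsub>VV\<^esub> vec (k \<otimes> qint a) (a - 1, b, c, d)"
| "left_term GY (a, b, c, d) k = vec k (Suc a, b, c, d)"
| "left_term GS (a, b, c, d) k = vec (k \<otimes> (inv l [^] a \<otimes> l [^] b)) (a, b, Suc c, d)"
| "left_term GT (a, b, c, d) k = vec (k \<otimes> (inv m [^] a \<otimes> (m [^] b \<otimes> inv q [^] c))) (a, b, c, Suc d)"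

text \<open>The normal form of \<open>y\<^sup>a x\<^sup>b s\<^sup>c t\<^sup>d g\<close>.\<close>

fun right_term :: "gen \<Rightarrow> nat \<times> nat \<times> nat \<times> nat \<Rightarrow> 'k \<Rightarrow> nat \<times> nat \<times> nat \<times> nat \<Rightarrow> 'k" where
  "right_term GX (a, b, c, d) k = vec (k \<otimes> (m [^] d \<otimes> l [^] c)) (a, Suc b, c, d)"
| "right_term GY (a, b, c, d) k =
    vec (k \<otimes> (inv m [^] d \<otimes> inv l [^] c \<otimes> p [^] b)) (Suc a, b, c, d) \<oplus>\<^bsub>VV\<^esub>
    vec (k \<otimes> (inv m [^] d \<otimes> inv l [^] c \<otimes> qint b)) (a, b - 1, c, d)"
| "right_term GS (a, b, c, d) k = vec (k \<otimes> inv q [^] d) (a, b, Suc c, d)"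
| "right_term GT (a, b, c, d) k = vec k (a, b, c, Suc d)"

lemma left_term_additive: "additive_map (ground_alg K) VV (left_term g n)"
  by (cases n; cases g) (auto intro!: additive_mapI simp: l_distr vec_add V.F.a_ac)

lemma right_term_additive: "additive_map (ground_alg K) VV (right_term g n)"
  by (cases n; cases g) (auto intro!: additive_mapI simp: l_distr vec_add V.F.a_ac)

definition left_op where "left_op g = V.term_sum VV (left_term g)"
definition right_op where "right_op g = V.term_sum VV (right_term g)"

lemma left_op_additive: "additive_map VV VV (left_op g)"
  unfolding left_op_def by (rule V.term_sum_additive[OF V.abelian_group_F left_term_additive])

lemma right_op_additive: "additive_map VV VV (right_op g)"
  unfolding right_op_def by (rule V.term_sum_additive[OF V.abelian_group_F right_term_additive])

lemma left_op_vec: "k \<in> carrier K \<Longrightarrow> left_op g (vec k n) = left_term g n k"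
  unfolding left_op_def by (rule V.term_sum_single[OF V.abelian_group_F left_term_additive]) auto

lemma right_op_vec: "k \<in> carrier K \<Longrightarrow> right_op g (vec k n) = right_term g n k"
  unfolding right_op_def by (rule V.term_sum_single[OF V.abelian_group_F right_term_additive]) auto

lemmas left_op_simps = additive_map_closed[OF left_op_additive] additive_map_add[OF left_op_additive]
  additive_map_zero[OF V.abelian_group_F V.abelian_group_F left_op_additive]

lemmas right_op_simps = additive_map_closed[OF right_op_additive] additive_map_add[OF right_op_additive]
  additive_map_zero[OF V.abelian_group_F V.abelian_group_F right_op_additive]

lemma VV_induct [consumes 1, case_names zero add]:
  assumes "f \<in> carrier VV" "P \<zero>\<^bsub>VV\<^esub>"
    "\<And>k a b c d g. k \<in> carrier K \<Longrightarrow> g \<in> carrier VV \<Longrightarrow> P g \<Longrightarrow> P (vec k (a, b, c, d) \<oplus>\<^bsub>VV\<^esub> g)"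
  shows "P f"
  using assms(1)
proof (induction rule: V.F_induct)
  case (add k n g)
  then show ?case using assms(3)[of k g] by (cases n) auto
qed (rule assms(2))

lemma left_op_smult:
  assumes "k \<in> carrier K" "f \<in> carrier VV"
  shows "left_op g (k \<odot>\<^bsub>VV\<^esub> f) = k \<odot>\<^bsub>VV\<^esub> left_op g f"
  using assms(2,1)
proof (induction rule: VV_induct)
  case (add x a b c d f)
  have "left_op g (k \<odot>\<^bsub>VV\<^esub> vec x (a, b, c, d)) = k \<odot>\<^bsub>VV\<^esub> left_op g (vec x (a, b, c, d))"
    using add by (cases g) (simp_all add: vec_smult left_op_vec VF.smult_r_distr m_assoc)
  then show ?case using add by (simp add: VF.smult_r_distr left_op_simps)
qed (simp add: left_op_simps)

text \<open>These identities make the free module on the exponents a module over the quantum algebra.\<close>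

lemma left_op_relations:
  assumes "f \<in> carrier VV"
  shows "left_op GX (left_op GY f) = p \<odot>\<^bsub>VV\<^esub> left_op GY (left_op GX f) \<oplus>\<^bsub>VV\<^esub> f"
    and "left_op GS (left_op GT f) = q \<odot>\<^bsub>VV\<^esub> left_op GT (left_op GS f)"
    and "left_op GS (left_op GX f) = l \<odot>\<^bsub>VV\<^esub> left_op GX (left_op GS f)"
    and "left_op GS (left_op GY f) = inv l \<odot>\<^bsub>VV\<^esub> left_op GY (left_op GS f)"
    and "left_op GT (left_op GX f) = m \<odot>\<^bsub>VV\<^esub> left_op GX (left_op GT f)"
    and "left_op GT (left_op GY f) = inv m \<odot>\<^bsub>VV\<^esub> left_op GY (left_op GT f)"
proof -
  have pinv: "c \<otimes> (inv c \<otimes> x) = x" if "c \<in> {q, l, m}" "x \<in> carrier K" for c x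
    using that params_inv by (auto simp: m_assoc[symmetric])
  have pinv': "c \<otimes> (y \<otimes> (inv c \<otimes> x)) = y \<otimes> x" if "c \<in> {q, l, m}" "x \<in> carrier K" "y \<in> carrier K" for c x y
  proof -
    have "c \<otimes> (y \<otimes> (inv c \<otimes> x)) = y \<otimes> (c \<otimes> (inv c \<otimes> x))" using that by (intro m_lcomm) auto
    then show ?thesis using pinv that by simp
  qed
  have XY: "left_op GX (left_op GY (vec k n)) = p \<odot>\<^bsub>VV\<^esub> left_op GY (left_op GX (vec k n)) \<oplus>\<^bsub>VV\<^esub> vec k n"
    if k: "k \<in> carrier K" for k n
  proof -
    obtain a b c d where n: "n = (a, b, c, d)" by (cases n)
    have "vec (p \<otimes> (k \<otimes> qint a)) (Suc (a - 1), b, c, d) = vec (p \<otimes> (k \<otimes> qint a)) (a, b, c, d)"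
      by (cases a) (use k in \<open>simp_all add: vec_zero\<close>)
    moreover have "vec (k \<otimes> qint (Suc a)) (a, b, c, d) = vec k (a, b, c, d) \<oplus>\<^bsub>VV\<^esub> vec (p \<otimes> (k \<otimes> qint a)) (a, b, c, d)"
      unfolding qint_Suc using k by (simp add: r_distr vec_add m_lcomm)
    moreover have "k \<otimes> (p [^] a \<otimes> p) = p \<otimes> (k \<otimes> p [^] a)" using k by (simp add: m_ac)
    ultimately show ?thesis using k unfolding n
      by (simp add: left_op_vec left_op_simps VF.smult_r_distr vec_smult V.F.a_ac del: qint.simps)
  qed
  show "left_op GX (left_op GY f) = p \<odot>\<^bsub>VV\<^esub> left_op GY (left_op GX f) \<oplus>\<^bsub>VV\<^esub> f"
    using assms
    by (induction rule: VV_induct) (simp_all add: left_op_simps VF.smult_r_distr XY V.F.a_ac)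
  have on_vec: "left_op GS (left_op GT (vec k (a, b, c, d))) = q \<odot>\<^bsub>VV\<^esub> left_op GT (left_op GS (vec k (a, b, c, d)))"
    if k: "k \<in> carrier K" for k a b c d
    using k by (simp add: left_op_vec vec_smult m_ac pinv)
  show "left_op GS (left_op GT f) = q \<odot>\<^bsub>VV\<^esub> left_op GT (left_op GS f)"
    using assms by (induction rule: VV_induct) (simp_all add: left_op_simps VF.smult_r_distr on_vec)
  have on_vec: "left_op GS (left_op GY (vec k (a, b, c, d))) = inv l \<odot>\<^bsub>VV\<^esub> left_op GY (left_op GS (vec k (a, b, c, d)))"
    if k: "k \<in> carrier K" for k a b c d
    using k by (simp add: left_op_vec vec_smult m_ac)
  show "left_op GS (left_op GY f) = inv l \<odot>\<^bsub>VV\<^esub> left_op GY (left_op GS f)"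
    using assms by (induction rule: VV_induct) (simp_all add: left_op_simps VF.smult_r_distr on_vec)
  have on_vec: "left_op GT (left_op GY (vec k (a, b, c, d))) = inv m \<odot>\<^bsub>VV\<^esub> left_op GY (left_op GT (vec k (a, b, c, d)))"
    if k: "k \<in> carrier K" for k a b c d
    using k by (simp add: left_op_vec vec_smult m_ac)
  show "left_op GT (left_op GY f) = inv m \<odot>\<^bsub>VV\<^esub> left_op GY (left_op GT f)"
    using assms by (induction rule: VV_induct) (simp_all add: left_op_simps VF.smult_r_distr on_vec)
  have on_vec: "left_op GS (left_op GX (vec k (a, b, c, d))) = l \<odot>\<^bsub>VV\<^esub> left_op GX (left_op GS (vec k (a, b, c, d)))"
    if k: "k \<in> carrier K" for k a b c d
    using k by (cases a) (simp_all add: left_op_vec left_op_simps vec_smult VF.smult_r_distr vec_zero m_ac pinv pinv' del: qint.simps(2))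
  show "left_op GS (left_op GX f) = l \<odot>\<^bsub>VV\<^esub> left_op GX (left_op GS f)"
    using assms by (induction rule: VV_induct) (simp_all add: left_op_simps VF.smult_r_distr on_vec)
  have on_vec: "left_op GT (left_op GX (vec k (a, b, c, d))) = m \<odot>\<^bsub>VV\<^esub> left_op GX (left_op GT (vec k (a, b, c, d)))"
    if k: "k \<in> carrier K" for k a b c d
    using k by (cases a) (simp_all add: left_op_vec left_op_simps vec_smult VF.smult_r_distr vec_zero m_ac pinv pinv' del: qint.simps(2))
  show "left_op GT (left_op GX f) = m \<odot>\<^bsub>VV\<^esub> left_op GX (left_op GT f)"
    using assms by (induction rule: VV_induct) (simp_all add: left_op_simps VF.smult_r_distr on_vec)
qed

end

section \<open>The quantum algebra and its representation\<close>

lemma monoid_word_monoid: "monoid word_monoid"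
  by (intro monoidI) (auto simp: word_monoid_def)

lemma word_monoid_simps [simp]:
  "carrier word_monoid = UNIV" "u \<otimes>\<^bsub>word_monoid\<^esub> v = u @ v" "\<one>\<^bsub>word_monoid\<^esub> = []"
  by (simp_all add: word_monoid_def)

context quantum_parameters
begin

abbreviation words :: "gen list monoid" where "words \<equiv> word_monoid"

sublocale G: monoid_algebra K "ground_alg K" words
  by (intro monoid_algebra.intro ground_alg_assoc_algebra is_cring monoid_word_monoid)

abbreviation FF :: "('k, gen list \<Rightarrow> 'k) module" where "FF \<equiv> free_alg K"

lemma FF_eq: "FF = monoid_alg (ground_alg K) words"
  by (simp add: free_alg_def)

sublocale FA: assoc_algebra K FF
  unfolding FF_eq by (rule G.assoc_algebra_F)

abbreviation word :: "'k \<Rightarrow> gen list \<Rightarrow> gen list \<Rightarrow> 'k"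
  where "word c w \<equiv> single (ground_alg K) c w"

lemma word_closed [simp]: "c \<in> carrier K \<Longrightarrow> word c w \<in> carrier FF"
  unfolding FF_eq by (rule G.single_closed) auto

lemma word_mult: "c \<in> carrier K \<Longrightarrow> d \<in> carrier K \<Longrightarrow> word c u \<otimes>\<^bsub>FF\<^esub> word d v = word (c \<otimes> d) (u @ v)"
  unfolding FF_eq using G.mult_single[of c d u v] by simp

lemma word_smult: "c \<in> carrier K \<Longrightarrow> c \<odot>\<^bsub>FF\<^esub> word d u = word (c \<otimes> d) u"
  unfolding FF_eq using G.smult_single[of c d u] by simp

lemma word_one: "\<one>\<^bsub>FF\<^esub> = word \<one> []"
  unfolding FF_eq using G.F_simps(4) by simp

lemma basis_word: "basis_elt K w = word \<one> w"
  by (auto simp: basis_elt_def single_def)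

lemma FF_induct [consumes 1, case_names zero add]:
  assumes "f \<in> carrier FF" "P \<zero>\<^bsub>FF\<^esub>"
    "\<And>c w g. c \<in> carrier K \<Longrightarrow> g \<in> carrier FF \<Longrightarrow> P g \<Longrightarrow> P (word c w \<oplus>\<^bsub>FF\<^esub> g)"
  shows "P f"
  using assms unfolding FF_eq by (induction rule: G.F_induct) auto

abbreviation rels where "rels \<equiv> quantum_rels K p q l m"
abbreviation JJ where "JJ \<equiv> Idl\<^bsub>FF\<^esub> rels"

lemma rels_eq:
  "rels =
    {(word \<one> [GX, GY] \<ominus>\<^bsub>FF\<^esub> word p [GY, GX]) \<ominus>\<^bsub>FF\<^esub> word \<one> [],
     word \<one> [GS, GT] \<ominus>\<^bsub>FF\<^esub> word q [GT, GS],
     word \<one> [GS, GX] \<ominus>\<^bsub>FF\<^esub> word l [GX, GS],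
     word \<one> [GS, GY] \<ominus>\<^bsub>FF\<^esub> word (inv l) [GY, GS],
     word \<one> [GT, GX] \<ominus>\<^bsub>FF\<^esub> word m [GX, GT],
     word \<one> [GT, GY] \<ominus>\<^bsub>FF\<^esub> word (inv m) [GY, GT]}"
  unfolding quantum_rels_def Let_def basis_word word_one by (simp add: word_mult word_smult)

lemma rels_closed: "rels \<subseteq> carrier FF"
  unfolding rels_eq by (simp add: FA.M.minus_closed)

sublocale I: algebra_ideal K FF JJ
  by (intro algebra_ideal.intro FA.assoc_algebra_axioms FA.A.genideal_ideal rels_closed)

abbreviation QA where "QA \<equiv> quantum_alg K p q l m"

lemma QA_eq: "QA = quot_alg FF JJ"
  by (simp add: quantum_alg_def)

sublocale Q: assoc_algebra K QA
  unfolding QA_eq by (rule I.assoc_algebra_Q)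

lemmas proj_simps = I.proj_simps[folded QA_eq]

definition gn :: "gen \<Rightarrow> (gen list \<Rightarrow> 'k) set" where "gn g = I.proj (word \<one> [g])"

lemma gn_closed [simp]: "gn g \<in> carrier QA"
  by (simp add: gn_def proj_simps)

lemma proj_word2: "c \<in> carrier K \<Longrightarrow> I.proj (word c [g, h]) = c \<odot>\<^bsub>QA\<^esub> (gn g \<otimes>\<^bsub>QA\<^esub> gn h)"
  unfolding gn_def by (simp add: proj_simps(3,5)[symmetric] word_mult word_smult)

lemma proj_word_Cons: "I.proj (word \<one> (g # w)) = gn g \<otimes>\<^bsub>QA\<^esub> I.proj (word \<one> w)"
  unfolding gn_def by (simp add: proj_simps(3)[symmetric] word_mult)

lemma proj_eq_if_rel: "x \<in> carrier FF \<Longrightarrow> y \<in> carrier FF \<Longrightarrow> x \<ominus>\<^bsub>FF\<^esub> y \<in> rels \<Longrightarrow> I.proj x = I.proj y"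
  using I.proj_eq_iff FA.A.genideal_self[OF rels_closed] by blast

lemma QA_relations:
  "gn GX \<otimes>\<^bsub>QA\<^esub> gn GY = p \<odot>\<^bsub>QA\<^esub> (gn GY \<otimes>\<^bsub>QA\<^esub> gn GX) \<oplus>\<^bsub>QA\<^esub> \<one>\<^bsub>QA\<^esub>"
  "gn GS \<otimes>\<^bsub>QA\<^esub> gn GT = q \<odot>\<^bsub>QA\<^esub> (gn GT \<otimes>\<^bsub>QA\<^esub> gn GS)"
  "gn GS \<otimes>\<^bsub>QA\<^esub> gn GX = l \<odot>\<^bsub>QA\<^esub> (gn GX \<otimes>\<^bsub>QA\<^esub> gn GS)"
  "gn GS \<otimes>\<^bsub>QA\<^esub> gn GY = inv l \<odot>\<^bsub>QA\<^esub> (gn GY \<otimes>\<^bsub>QA\<^esub> gn GS)"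
  "gn GT \<otimes>\<^bsub>QA\<^esub> gn GX = m \<odot>\<^bsub>QA\<^esub> (gn GX \<otimes>\<^bsub>QA\<^esub> gn GT)"
  "gn GT \<otimes>\<^bsub>QA\<^esub> gn GY = inv m \<odot>\<^bsub>QA\<^esub> (gn GY \<otimes>\<^bsub>QA\<^esub> gn GT)"
proof -
  have two: "gn g \<otimes>\<^bsub>QA\<^esub> gn h = c \<odot>\<^bsub>QA\<^esub> (gn h \<otimes>\<^bsub>QA\<^esub> gn g)"
    if "word \<one> [g, h] \<ominus>\<^bsub>FF\<^esub> word c [h, g] \<in> rels" "c \<in> carrier K" for g h c
    using proj_eq_if_rel[OF _ _ that(1)] that(2) by (simp add: proj_word2)
  show
    "gn GS \<otimes>\<^bsub>QA\<^esub> gn GT = q \<odot>\<^bsub>QA\<^esub> (gn GT \<otimes>\<^bsub>QA\<^esub> gn GS)"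
    "gn GS \<otimes>\<^bsub>QA\<^esub> gn GX = l \<odot>\<^bsub>QA\<^esub> (gn GX \<otimes>\<^bsub>QA\<^esub> gn GS)"
    "gn GS \<otimes>\<^bsub>QA\<^esub> gn GY = inv l \<odot>\<^bsub>QA\<^esub> (gn GY \<otimes>\<^bsub>QA\<^esub> gn GS)"
    "gn GT \<otimes>\<^bsub>QA\<^esub> gn GX = m \<odot>\<^bsub>QA\<^esub> (gn GX \<otimes>\<^bsub>QA\<^esub> gn GT)"
    "gn GT \<otimes>\<^bsub>QA\<^esub> gn GY = inv m \<odot>\<^bsub>QA\<^esub> (gn GY \<otimes>\<^bsub>QA\<^esub> gn GT)"
    by (rule two; simp add: rels_eq)+
  have "word \<one> [GX, GY] \<ominus>\<^bsub>FF\<^esub> word p [GY, GX] \<ominus>\<^bsub>FF\<^esub> word \<one> [] =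
      word \<one> [GX, GY] \<ominus>\<^bsub>FF\<^esub> (word p [GY, GX] \<oplus>\<^bsub>FF\<^esub> word \<one> [])"
    by (simp add: a_minus_def FA.M.minus_add FA.M.a_assoc)
  then have "word \<one> [GX, GY] \<ominus>\<^bsub>FF\<^esub> (word p [GY, GX] \<oplus>\<^bsub>FF\<^esub> word \<one> []) \<in> rels" by (simp add: rels_eq)
  from proj_eq_if_rel[OF _ _ this]
  show "gn GX \<otimes>\<^bsub>QA\<^esub> gn GY = p \<odot>\<^bsub>QA\<^esub> (gn GY \<otimes>\<^bsub>QA\<^esub> gn GX) \<oplus>\<^bsub>QA\<^esub> \<one>\<^bsub>QA\<^esub>"
    by (simp add: proj_word2 proj_simps(2) proj_simps(4)[symmetric] word_one)
qed

fun act :: "gen list \<Rightarrow> _ \<Rightarrow> nat \<times> nat \<times> nat \<times> nat \<Rightarrow> 'k" where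
  "act [] f = f"
| "act (g # w) f = left_op g (act w f)"

lemma act_closed: "f \<in> carrier VV \<Longrightarrow> act w f \<in> carrier VV"
  by (induction w) (auto simp: left_op_simps)

lemma act_append: "act (u @ w) f = act u (act w f)"
  by (induction u) auto

lemma act_add: "f \<in> carrier VV \<Longrightarrow> g \<in> carrier VV \<Longrightarrow> act w (f \<oplus>\<^bsub>VV\<^esub> g) = act w f \<oplus>\<^bsub>VV\<^esub> act w g"
  by (induction w) (auto simp: left_op_simps act_closed)

lemma act_smult: "k \<in> carrier K \<Longrightarrow> f \<in> carrier VV \<Longrightarrow> act w (k \<odot>\<^bsub>VV\<^esub> f) = k \<odot>\<^bsub>VV\<^esub> act w f"
  by (induction w) (auto simp: left_op_smult act_closed)

definition rep :: "(nat \<times> nat \<times> nat \<times> nat \<Rightarrow> 'k) \<Rightarrow> (gen list \<Rightarrow> 'k) \<Rightarrow> nat \<times> nat \<times> nat \<times> nat \<Rightarrow> 'k"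
  where "rep f = G.term_sum VV (\<lambda>w c. c \<odot>\<^bsub>VV\<^esub> act w f)"

lemma rep_term: "f \<in> carrier VV \<Longrightarrow> additive_map (ground_alg K) VV (\<lambda>c. c \<odot>\<^bsub>VV\<^esub> act w f)"
  by (intro additive_mapI) (auto simp: act_closed VF.smult_l_distr)

lemma rep_additive: "f \<in> carrier VV \<Longrightarrow> additive_map FF VV (rep f)"
  unfolding rep_def FF_eq by (rule G.term_sum_additive[OF V.abelian_group_F rep_term])

lemma rep_word: "f \<in> carrier VV \<Longrightarrow> c \<in> carrier K \<Longrightarrow> rep f (word c w) = c \<odot>\<^bsub>VV\<^esub> act w f"
  unfolding rep_def by (rule G.term_sum_single[OF V.abelian_group_F rep_term]) auto

lemma rep_closed: "f \<in> carrier VV \<Longrightarrow> x \<in> carrier FF \<Longrightarrow> rep f x \<in> carrier VV"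
  by (rule additive_map_closed[OF rep_additive])

lemma rep_add: "f \<in> carrier VV \<Longrightarrow> x \<in> carrier FF \<Longrightarrow> y \<in> carrier FF \<Longrightarrow> rep f (x \<oplus>\<^bsub>FF\<^esub> y) = rep f x \<oplus>\<^bsub>VV\<^esub> rep f y"
  by (rule additive_map_add[OF rep_additive])

lemma rep_zero: "f \<in> carrier VV \<Longrightarrow> rep f \<zero>\<^bsub>FF\<^esub> = \<zero>\<^bsub>VV\<^esub>"
  by (rule additive_map_zero[OF FA.M.abelian_group_axioms V.abelian_group_F rep_additive])

lemma act_zero: "act w \<zero>\<^bsub>VV\<^esub> = \<zero>\<^bsub>VV\<^esub>"
  by (induction w) (auto simp: left_op_simps)

lemma rep_zero_vector: "x \<in> carrier FF \<Longrightarrow> rep \<zero>\<^bsub>VV\<^esub> x = \<zero>\<^bsub>VV\<^esub>"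
  by (induction rule: FF_induct) (auto simp: rep_zero rep_add rep_word act_zero)

lemma act_rep:
  assumes "x \<in> carrier FF" "f \<in> carrier VV" "c \<in> carrier K"
  shows "rep f (word c w \<otimes>\<^bsub>FF\<^esub> x) = c \<odot>\<^bsub>VV\<^esub> act w (rep f x)"
  using assms
proof (induction rule: FF_induct)
  case zero
  then show ?case by (simp add: rep_zero act_zero)
next
  case (add d u g)
  have "rep f (word c w \<otimes>\<^bsub>FF\<^esub> word d u) = c \<odot>\<^bsub>VV\<^esub> act w (rep f (word d u))"
    using add by (simp add: word_mult rep_word act_append act_smult act_closed VF.smult_assoc1)
  then show ?case using add
    by (simp add: FA.A.r_distr rep_add rep_closed act_add act_closed VF.smult_r_distr)
qed

lemma rep_mult:
  assumes "x \<in> carrier FF" "y \<in> carrier FF" "f \<in> carrier VV"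
  shows "rep f (x \<otimes>\<^bsub>FF\<^esub> y) = rep (rep f y) x"
  using assms
  by (induction rule: FF_induct)
    (simp_all add: rep_zero FA.A.l_distr rep_add act_rep rep_closed rep_word)

definition annihilator where "annihilator = {x \<in> carrier FF. \<forall>f \<in> carrier VV. rep f x = \<zero>\<^bsub>VV\<^esub>}"

text \<open>The action is multiplicative by \<open>rep_mult\<close>, so what acts as zero on the whole module is a
  two-sided ideal.\<close>

lemma annihilator_ideal: "ideal annihilator FF"
proof (rule idealI[OF FA.A.ring_axioms])
  show "subgroup annihilator (add_monoid FF)"
    by (rule group.subgroupI[OF FA.M.a_group])
      (auto simp: annihilator_def rep_add rep_zero a_inv_def[symmetric]
        additive_map_a_inv[OF FA.M.abelian_group_axioms V.abelian_group_F rep_additive] intro!: exI[of _ "\<zero>\<^bsub>FF\<^esub>"])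
qed (auto simp: annihilator_def rep_mult rep_zero_vector rep_closed)

lemma rep_vanishes:
  assumes "f \<in> carrier VV" "x \<in> JJ" shows "rep f x = \<zero>\<^bsub>VV\<^esub>"
proof -
  have diff: "rep f (x \<ominus>\<^bsub>FF\<^esub> y) = rep f x \<ominus>\<^bsub>VV\<^esub> rep f y"
    if "f \<in> carrier VV" "x \<in> carrier FF" "y \<in> carrier FF" for f x y
    by (rule additive_map_minus[OF FA.M.abelian_group_axioms V.abelian_group_F rep_additive[OF that(1)] that(2,3)])
  have cancel: "a \<oplus>\<^bsub>VV\<^esub> b \<ominus>\<^bsub>VV\<^esub> a \<ominus>\<^bsub>VV\<^esub> b = \<zero>\<^bsub>VV\<^esub>" "a \<ominus>\<^bsub>VV\<^esub> a = \<zero>\<^bsub>VV\<^esub>"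
    if "a \<in> carrier VV" "b \<in> carrier VV" for a b
    using that by (simp_all add: a_minus_def V.F.a_comm[of a b] V.F.a_assoc V.F.r_neg)
  have "rep f r = \<zero>\<^bsub>VV\<^esub>" if "r \<in> rels" "f \<in> carrier VV" for r f
    using that unfolding rels_eq
    by (elim insertE emptyE)
      (simp_all add: diff FA.M.minus_closed rep_word left_op_relations left_op_simps cancel)
  then have "rels \<subseteq> annihilator" using rels_closed by (auto simp: annihilator_def)
  then have "JJ \<subseteq> annihilator" by (rule FA.A.genideal_minimal[OF annihilator_ideal])
  then show ?thesis using assms by (auto simp: annihilator_def)
qed

abbreviation origin :: "nat \<times> nat \<times> nat \<times> nat" where "origin \<equiv> (0, 0, 0, 0)"

text \<open>The action on the basis vector of the monomial \<open>1\<close>. It turns out to be the coordinate vector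
  with respect to the normal monomials.\<close>

definition coords where "coords = I.descend (rep (vec \<one> origin))"

lemma coords_proj: "x \<in> carrier FF \<Longrightarrow> coords (I.proj x) = rep (vec \<one> origin) x"
  unfolding coords_def
  by (rule I.descend_proj[OF V.abelian_group_F rep_additive rep_vanishes]) auto

lemma coords_additive: "additive_map QA VV coords"
  unfolding coords_def QA_eq
  by (rule I.descend_additive[OF V.abelian_group_F rep_additive rep_vanishes]) auto

lemma coords_gn:
  assumes "z \<in> carrier QA" shows "coords (gn g \<otimes>\<^bsub>QA\<^esub> z) = left_op g (coords z)"
proof -
  obtain x where x: "x \<in> carrier FF" "z = I.proj x" using assms unfolding QA_eq I.carrier_Q by blast
  have "coords (gn g \<otimes>\<^bsub>QA\<^esub> z) = rep (vec \<one> origin) (word \<one> [g] \<otimes>\<^bsub>FF\<^esub> x)"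
    unfolding gn_def using x by (simp add: proj_simps(3)[symmetric] coords_proj)
  also have "\<dots> = left_op g (coords z)"
    using x by (simp add: act_rep coords_proj rep_closed left_op_simps)
  finally show ?thesis .
qed

lemma coords_smult:
  assumes "z \<in> carrier QA" "c \<in> carrier K" shows "coords (c \<odot>\<^bsub>QA\<^esub> z) = c \<odot>\<^bsub>VV\<^esub> coords z"
proof -
  obtain x where x: "x \<in> carrier FF" "z = I.proj x" using assms unfolding QA_eq I.carrier_Q by blast
  have eq: "c \<odot>\<^bsub>FF\<^esub> x = word c [] \<otimes>\<^bsub>FF\<^esub> x"
    using FA.smult_mult_left[of c "\<one>\<^bsub>FF\<^esub>" x] x assms by (simp add: word_one[symmetric]) (simp add: word_one word_smult)
  show ?thesis using x assms
    by (simp add: proj_simps(5)[symmetric] coords_proj) (simp add: eq act_rep)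
qed

lemma coords_one: "coords \<one>\<^bsub>QA\<^esub> = vec \<one> origin"
  by (simp add: proj_simps(4)[symmetric] word_one coords_proj rep_word)

end

section \<open>Normal monomials and the center\<close>

context quantum_parameters
begin

abbreviation gX where "gX \<equiv> gn GX"
abbreviation gY where "gY \<equiv> gn GY"
abbreviation gS where "gS \<equiv> gn GS"
abbreviation gT where "gT \<equiv> gn GT"

fun nf :: "nat \<times> nat \<times> nat \<times> nat \<Rightarrow> (gen list \<Rightarrow> 'k) set" where
  "nf (a, b, c, d) = gY [^]\<^bsub>QA\<^esub> a \<otimes>\<^bsub>QA\<^esub> (gX [^]\<^bsub>QA\<^esub> b \<otimes>\<^bsub>QA\<^esub> (gS [^]\<^bsub>QA\<^esub> c \<otimes>\<^bsub>QA\<^esub> gT [^]\<^bsub>QA\<^esub> d))"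

lemma nf_closed [simp]: "nf n \<in> carrier QA"
  by (cases n) simp

lemma T_S_relation: "gT \<otimes>\<^bsub>QA\<^esub> gS = inv q \<odot>\<^bsub>QA\<^esub> (gS \<otimes>\<^bsub>QA\<^esub> gT)"
  unfolding QA_relations(2) by (simp add: Q.smult_assoc1[symmetric] params_inv)

lemma qint_absorb:
  "qint n \<odot>\<^bsub>QA\<^esub> (gn g [^]\<^bsub>QA\<^esub> (n - 1) \<otimes>\<^bsub>QA\<^esub> gn g) = qint n \<odot>\<^bsub>QA\<^esub> gn g [^]\<^bsub>QA\<^esub> n"
  "qint n \<odot>\<^bsub>QA\<^esub> (gn g \<otimes>\<^bsub>QA\<^esub> gn g [^]\<^bsub>QA\<^esub> (n - 1)) = qint n \<odot>\<^bsub>QA\<^esub> gn g [^]\<^bsub>QA\<^esub> n"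
proof -
  consider "n = 0" | k where "n = Suc k" by (cases n) auto
  note cases = this
  show "qint n \<odot>\<^bsub>QA\<^esub> (gn g [^]\<^bsub>QA\<^esub> (n - 1) \<otimes>\<^bsub>QA\<^esub> gn g) = qint n \<odot>\<^bsub>QA\<^esub> gn g [^]\<^bsub>QA\<^esub> n"
    by (rule cases) (hypsubst, simp)+
  show "qint n \<odot>\<^bsub>QA\<^esub> (gn g \<otimes>\<^bsub>QA\<^esub> gn g [^]\<^bsub>QA\<^esub> (n - 1)) = qint n \<odot>\<^bsub>QA\<^esub> gn g [^]\<^bsub>QA\<^esub> n"
    by (rule cases) (hypsubst, simp add: Q.A.nat_pow_Suc2[symmetric] del: Group.nat_pow_Suc Q.A.nat_pow_Suc nat_pow_Suc)+
qed

lemma X_power_Y: "gX \<otimes>\<^bsub>QA\<^esub> gY [^]\<^bsub>QA\<^esub> n = (p [^] n) \<odot>\<^bsub>QA\<^esub> (gY [^]\<^bsub>QA\<^esub> n \<otimes>\<^bsub>QA\<^esub> gX) \<oplus>\<^bsub>QA\<^esub> qint n \<odot>\<^bsub>QA\<^esub> gY [^]\<^bsub>QA\<^esub> (n - 1)"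
proof (induction n)
  case (Suc n)
  have absorb: "qint n \<odot>\<^bsub>QA\<^esub> (gY [^]\<^bsub>QA\<^esub> (n - 1) \<otimes>\<^bsub>QA\<^esub> gY) = qint n \<odot>\<^bsub>QA\<^esub> gY [^]\<^bsub>QA\<^esub> n"
    by (rule qint_absorb(1))
  have "gX \<otimes>\<^bsub>QA\<^esub> gY [^]\<^bsub>QA\<^esub> Suc n = (gX \<otimes>\<^bsub>QA\<^esub> gY [^]\<^bsub>QA\<^esub> n) \<otimes>\<^bsub>QA\<^esub> gY" by (simp add: Q.A.m_assoc)
  also have "\<dots> = (p [^] n) \<odot>\<^bsub>QA\<^esub> (gY [^]\<^bsub>QA\<^esub> n \<otimes>\<^bsub>QA\<^esub> (gX \<otimes>\<^bsub>QA\<^esub> gY)) \<oplus>\<^bsub>QA\<^esub> qint n \<odot>\<^bsub>QA\<^esub> gY [^]\<^bsub>QA\<^esub> n"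
    unfolding Suc by (simp add: Q.A.l_distr Q.smult_mult_left Q.A.m_assoc absorb[unfolded One_nat_def])
  also have "\<dots> = (p [^] Suc n) \<odot>\<^bsub>QA\<^esub> (gY [^]\<^bsub>QA\<^esub> Suc n \<otimes>\<^bsub>QA\<^esub> gX) \<oplus>\<^bsub>QA\<^esub> qint (Suc n) \<odot>\<^bsub>QA\<^esub> gY [^]\<^bsub>QA\<^esub> n"
    unfolding QA_relations(1)
    by (simp add: Q.A.r_distr Q.smult_r_distr Q.smult_mult_right Q.smult_assoc1[symmetric] Q.A.m_assoc
        Q.smult_l_distr Q.M.a_assoc Q.M.a_comm Q.M.a_lcomm)
  finally show ?case by simp
qed simp

lemma power_X_Y: "gX [^]\<^bsub>QA\<^esub> n \<otimes>\<^bsub>QA\<^esub> gY = (p [^] n) \<odot>\<^bsub>QA\<^esub> (gY \<otimes>\<^bsub>QA\<^esub> gX [^]\<^bsub>QA\<^esub> n) \<oplus>\<^bsub>QA\<^esub> qint n \<odot>\<^bsub>QA\<^esub> gX [^]\<^bsub>QA\<^esub> (n - 1)"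
proof (induction n)
  case (Suc n)
  have absorb: "qint n \<odot>\<^bsub>QA\<^esub> (gX \<otimes>\<^bsub>QA\<^esub> gX [^]\<^bsub>QA\<^esub> (n - 1)) = qint n \<odot>\<^bsub>QA\<^esub> gX [^]\<^bsub>QA\<^esub> n"
    by (rule qint_absorb(2))
  have "gX [^]\<^bsub>QA\<^esub> Suc n \<otimes>\<^bsub>QA\<^esub> gY = gX \<otimes>\<^bsub>QA\<^esub> (gX [^]\<^bsub>QA\<^esub> n \<otimes>\<^bsub>QA\<^esub> gY)"
    by (simp add: Q.A.nat_pow_Suc2 Q.A.m_assoc del: Group.nat_pow_Suc Q.A.nat_pow_Suc nat_pow_Suc)
  also have "\<dots> = (p [^] n) \<odot>\<^bsub>QA\<^esub> ((gX \<otimes>\<^bsub>QA\<^esub> gY) \<otimes>\<^bsub>QA\<^esub> gX [^]\<^bsub>QA\<^esub> n) \<oplus>\<^bsub>QA\<^esub> qint n \<odot>\<^bsub>QA\<^esub> gX [^]\<^bsub>QA\<^esub> n"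
    unfolding Suc by (simp add: Q.A.r_distr Q.smult_mult_right Q.A.m_assoc absorb[unfolded One_nat_def])
  also have "\<dots> = (p [^] n \<otimes> p) \<odot>\<^bsub>QA\<^esub> (gY \<otimes>\<^bsub>QA\<^esub> gX [^]\<^bsub>QA\<^esub> Suc n) \<oplus>\<^bsub>QA\<^esub> qint (Suc n) \<odot>\<^bsub>QA\<^esub> gX [^]\<^bsub>QA\<^esub> n"
    unfolding QA_relations(1)
    by (simp add: Q.A.l_distr Q.smult_r_distr Q.smult_mult_left Q.smult_assoc1[symmetric] Q.A.m_assoc
        Q.smult_l_distr Q.M.a_assoc Q.M.a_comm Q.M.a_lcomm Q.A.nat_pow_Suc2 del: Group.nat_pow_Suc Q.A.nat_pow_Suc nat_pow_Suc)
  finally show ?case by simp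
qed simp

text \<open>The linear combination of normal monomials with given coefficients. It is inverse to
  \<open>coords\<close>, which amounts to the Poincare-Birkhoff-Witt theorem for the quantum algebra.\<close>

definition expand :: "(nat \<times> nat \<times> nat \<times> nat \<Rightarrow> 'k) \<Rightarrow> (gen list \<Rightarrow> 'k) set"
  where "expand = V.term_sum QA (\<lambda>n k. k \<odot>\<^bsub>QA\<^esub> nf n)"

lemma expand_term: "additive_map (ground_alg K) QA (\<lambda>k. k \<odot>\<^bsub>QA\<^esub> nf n)"
  by (intro additive_mapI) (auto simp: Q.smult_l_distr simp del: nf.simps)

lemma expand_additive: "additive_map VV QA expand"
  unfolding expand_def by (rule V.term_sum_additive[OF Q.M.abelian_group_axioms expand_term])

lemma expand_vec: "k \<in> carrier K \<Longrightarrow> expand (vec k n) = k \<odot>\<^bsub>QA\<^esub> nf n"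
  unfolding expand_def by (rule V.term_sum_single[OF Q.M.abelian_group_axioms expand_term]) auto

lemmas expand_simps = additive_map_closed[OF expand_additive] additive_map_add[OF expand_additive]
  additive_map_zero[OF V.abelian_group_F Q.M.abelian_group_axioms expand_additive]

lemma pow_swap:
  assumes "u \<otimes>\<^bsub>QA\<^esub> v = c \<odot>\<^bsub>QA\<^esub> (v \<otimes>\<^bsub>QA\<^esub> u)" "c \<in> carrier K" "u \<in> carrier QA" "v \<in> carrier QA" "w \<in> carrier QA"
  shows "u \<otimes>\<^bsub>QA\<^esub> (v [^]\<^bsub>QA\<^esub> (n::nat) \<otimes>\<^bsub>QA\<^esub> w) = (c [^] n) \<odot>\<^bsub>QA\<^esub> (v [^]\<^bsub>QA\<^esub> n \<otimes>\<^bsub>QA\<^esub> (u \<otimes>\<^bsub>QA\<^esub> w))"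
    and "u [^]\<^bsub>QA\<^esub> n \<otimes>\<^bsub>QA\<^esub> (v \<otimes>\<^bsub>QA\<^esub> w) = (c [^] n) \<odot>\<^bsub>QA\<^esub> (v \<otimes>\<^bsub>QA\<^esub> (u [^]\<^bsub>QA\<^esub> n \<otimes>\<^bsub>QA\<^esub> w))"
proof -
  have "u \<otimes>\<^bsub>QA\<^esub> (v [^]\<^bsub>QA\<^esub> n \<otimes>\<^bsub>QA\<^esub> w) = (u \<otimes>\<^bsub>QA\<^esub> v [^]\<^bsub>QA\<^esub> n) \<otimes>\<^bsub>QA\<^esub> w" using assms(2-) by (simp add: Q.A.m_assoc)
  also have "\<dots> = (c [^] n) \<odot>\<^bsub>QA\<^esub> (v [^]\<^bsub>QA\<^esub> n \<otimes>\<^bsub>QA\<^esub> (u \<otimes>\<^bsub>QA\<^esub> w))"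
    unfolding Q.quasi_commute_pow_right[OF assms(2,3,4,1)] using assms(2-) by (simp add: Q.smult_mult_left Q.A.m_assoc)
  finally show "u \<otimes>\<^bsub>QA\<^esub> (v [^]\<^bsub>QA\<^esub> (n::nat) \<otimes>\<^bsub>QA\<^esub> w) = (c [^] n) \<odot>\<^bsub>QA\<^esub> (v [^]\<^bsub>QA\<^esub> n \<otimes>\<^bsub>QA\<^esub> (u \<otimes>\<^bsub>QA\<^esub> w))" .
  have "u [^]\<^bsub>QA\<^esub> n \<otimes>\<^bsub>QA\<^esub> (v \<otimes>\<^bsub>QA\<^esub> w) = (u [^]\<^bsub>QA\<^esub> n \<otimes>\<^bsub>QA\<^esub> v) \<otimes>\<^bsub>QA\<^esub> w" using assms(2-) by (simp add: Q.A.m_assoc)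
  also have "\<dots> = (c [^] n) \<odot>\<^bsub>QA\<^esub> (v \<otimes>\<^bsub>QA\<^esub> (u [^]\<^bsub>QA\<^esub> n \<otimes>\<^bsub>QA\<^esub> w))"
    unfolding Q.quasi_commute_pow_left[OF assms(2,3,4,1)] using assms(2-) by (simp add: Q.smult_mult_left Q.A.m_assoc)
  finally show "u [^]\<^bsub>QA\<^esub> n \<otimes>\<^bsub>QA\<^esub> (v \<otimes>\<^bsub>QA\<^esub> w) = (c [^] n) \<odot>\<^bsub>QA\<^esub> (v \<otimes>\<^bsub>QA\<^esub> (u [^]\<^bsub>QA\<^esub> n \<otimes>\<^bsub>QA\<^esub> w))" .
qed

lemma pow_Suc_left: "u \<in> carrier QA \<Longrightarrow> u \<otimes>\<^bsub>QA\<^esub> u [^]\<^bsub>QA\<^esub> (n::nat) = u [^]\<^bsub>QA\<^esub> Suc n"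
  by (simp only: Q.A.nat_pow_Suc2)

lemma pow_Suc_left_assoc:
  "u \<in> carrier QA \<Longrightarrow> w \<in> carrier QA \<Longrightarrow> u \<otimes>\<^bsub>QA\<^esub> (u [^]\<^bsub>QA\<^esub> (n::nat) \<otimes>\<^bsub>QA\<^esub> w) = u [^]\<^bsub>QA\<^esub> Suc n \<otimes>\<^bsub>QA\<^esub> w"
  by (simp add: pow_Suc_left[symmetric] Q.A.m_assoc del: Group.nat_pow_Suc Q.A.nat_pow_Suc nat_pow_Suc)

lemma pow_Suc_right_assoc:
  "u \<in> carrier QA \<Longrightarrow> w \<in> carrier QA \<Longrightarrow> u [^]\<^bsub>QA\<^esub> (n::nat) \<otimes>\<^bsub>QA\<^esub> (u \<otimes>\<^bsub>QA\<^esub> w) = u [^]\<^bsub>QA\<^esub> Suc n \<otimes>\<^bsub>QA\<^esub> w"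
  by (simp add: Q.A.m_assoc)

lemma X_power_Y_assoc:
  assumes "w \<in> carrier QA"
  shows "gX \<otimes>\<^bsub>QA\<^esub> (gY [^]\<^bsub>QA\<^esub> n \<otimes>\<^bsub>QA\<^esub> w) =
    (p [^] n) \<odot>\<^bsub>QA\<^esub> (gY [^]\<^bsub>QA\<^esub> n \<otimes>\<^bsub>QA\<^esub> (gX \<otimes>\<^bsub>QA\<^esub> w)) \<oplus>\<^bsub>QA\<^esub> qint n \<odot>\<^bsub>QA\<^esub> (gY [^]\<^bsub>QA\<^esub> (n - 1) \<otimes>\<^bsub>QA\<^esub> w)"
proof -
  have "gX \<otimes>\<^bsub>QA\<^esub> (gY [^]\<^bsub>QA\<^esub> n \<otimes>\<^bsub>QA\<^esub> w) = (gX \<otimes>\<^bsub>QA\<^esub> gY [^]\<^bsub>QA\<^esub> n) \<otimes>\<^bsub>QA\<^esub> w" using assms by (simp add: Q.A.m_assoc)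
  then show ?thesis unfolding X_power_Y using assms by (simp add: Q.A.l_distr Q.smult_mult_left Q.A.m_assoc)
qed

lemma power_X_Y_assoc:
  assumes "w \<in> carrier QA"
  shows "gX [^]\<^bsub>QA\<^esub> n \<otimes>\<^bsub>QA\<^esub> (gY \<otimes>\<^bsub>QA\<^esub> w) =
    (p [^] n) \<odot>\<^bsub>QA\<^esub> (gY \<otimes>\<^bsub>QA\<^esub> (gX [^]\<^bsub>QA\<^esub> n \<otimes>\<^bsub>QA\<^esub> w)) \<oplus>\<^bsub>QA\<^esub> qint n \<odot>\<^bsub>QA\<^esub> (gX [^]\<^bsub>QA\<^esub> (n - 1) \<otimes>\<^bsub>QA\<^esub> w)"
proof -
  have "gX [^]\<^bsub>QA\<^esub> n \<otimes>\<^bsub>QA\<^esub> (gY \<otimes>\<^bsub>QA\<^esub> w) = (gX [^]\<^bsub>QA\<^esub> n \<otimes>\<^bsub>QA\<^esub> gY) \<otimes>\<^bsub>QA\<^esub> w" using assms by (simp add: Q.A.m_assoc)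
  then show ?thesis unfolding power_X_Y using assms by (simp add: Q.A.l_distr Q.smult_mult_left Q.A.m_assoc)
qed

text \<open>Spanning and the computation of the center both rest on these two rewritings of products
  with a generator into normal form; they hold by repeated use of the commutation rules.\<close>

lemma gn_nf: "gn g \<otimes>\<^bsub>QA\<^esub> nf n = expand (left_op g (vec \<one> n))"
proof -
  obtain a b c d where n: "n = (a, b, c, d)" by (cases n)
  note smult = Q.smult_mult_right Q.smult_mult_left Q.smult_assoc1
  show ?thesis
  proof (cases g)
    case GX
    then show ?thesis unfolding n
      by (simp add: left_op_vec expand_simps expand_vec X_power_Y_assoc pow_Suc_left_assoc del: Group.nat_pow_Suc Q.A.nat_pow_Suc nat_pow_Suc)
  next
    case GY
    then show ?thesis unfolding n
      by (simp add: left_op_vec expand_vec pow_Suc_left_assoc del: Group.nat_pow_Suc Q.A.nat_pow_Suc nat_pow_Suc)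
  next
    case GS
    then show ?thesis unfolding n
      by (simp add: left_op_vec expand_vec pow_swap(1)[OF QA_relations(3)] pow_swap(1)[OF QA_relations(4)]
          pow_Suc_left_assoc smult del: Group.nat_pow_Suc Q.A.nat_pow_Suc nat_pow_Suc)
  next
    case GT
    then show ?thesis unfolding n
      by (simp add: left_op_vec expand_vec pow_swap(1)[OF QA_relations(5)] pow_swap(1)[OF QA_relations(6)]
          pow_swap(1)[OF T_S_relation] pow_Suc_left smult del: Group.nat_pow_Suc Q.A.nat_pow_Suc nat_pow_Suc)
  qed
qed

lemma nf_gn: "nf n \<otimes>\<^bsub>QA\<^esub> gn g = expand (right_op g (vec \<one> n))"
proof -
  obtain a b c d where n: "n = (a, b, c, d)" by (cases n)
  note smult = Q.smult_mult_right Q.smult_mult_left Q.smult_assoc1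
  show ?thesis
  proof (cases g)
    case GX
    then show ?thesis unfolding n
      by (simp add: right_op_vec expand_vec Q.A.m_assoc Q.quasi_commute_pow_left[OF _ _ _ QA_relations(5)]
          pow_swap(2)[OF QA_relations(3)] pow_Suc_right_assoc smult del: Group.nat_pow_Suc Q.A.nat_pow_Suc nat_pow_Suc)
  next
    case GY
    then show ?thesis unfolding n
      by (simp add: right_op_vec expand_simps expand_vec Q.A.m_assoc Q.quasi_commute_pow_left[OF _ _ _ QA_relations(6)]
          pow_swap(2)[OF QA_relations(4)] power_X_Y_assoc Q.A.r_distr Q.smult_r_distr
          pow_Suc_right_assoc smult del: Group.nat_pow_Suc Q.A.nat_pow_Suc nat_pow_Suc)
  next
    case GS
    then show ?thesis unfolding n
      by (simp add: right_op_vec expand_vec Q.A.m_assoc Q.quasi_commute_pow_left[OF _ _ _ T_S_relation]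
          pow_Suc_right_assoc smult del: Group.nat_pow_Suc Q.A.nat_pow_Suc nat_pow_Suc)
  next
    case GT
    then show ?thesis unfolding n
      by (simp add: right_op_vec expand_vec Q.A.m_assoc)
  qed
qed

lemma expand_smult:
  assumes "f \<in> carrier VV" "k \<in> carrier K" shows "expand (k \<odot>\<^bsub>VV\<^esub> f) = k \<odot>\<^bsub>QA\<^esub> expand f"
  using assms
  by (induction rule: VV_induct)
    (simp_all add: expand_simps VF.smult_r_distr vec_smult expand_vec Q.smult_r_distr Q.smult_assoc1 del: nf.simps)

lemma right_op_smult:
  assumes "k \<in> carrier K" "f \<in> carrier VV"
  shows "right_op g (k \<odot>\<^bsub>VV\<^esub> f) = k \<odot>\<^bsub>VV\<^esub> right_op g f"
  using assms(2,1)
proof (induction rule: VV_induct)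
  case (add x a b c d f)
  have "right_op g (k \<odot>\<^bsub>VV\<^esub> vec x (a, b, c, d)) = k \<odot>\<^bsub>VV\<^esub> right_op g (vec x (a, b, c, d))"
    using add by (cases g) (simp_all add: vec_smult right_op_vec VF.smult_r_distr m_assoc)
  then show ?case using add by (simp add: VF.smult_r_distr right_op_simps)
qed (simp add: right_op_simps)

lemma gn_expand:
  assumes "f \<in> carrier VV" shows "gn g \<otimes>\<^bsub>QA\<^esub> expand f = expand (left_op g f)"
  using assms
proof (induction rule: VV_induct)
  case (add k a b c d f)
  let ?n = "(a, b, c, d)"
  have k: "vec k ?n = k \<odot>\<^bsub>VV\<^esub> vec \<one> ?n" using add by (simp add: vec_smult)
  have "gn g \<otimes>\<^bsub>QA\<^esub> expand (vec k ?n) = k \<odot>\<^bsub>QA\<^esub> (gn g \<otimes>\<^bsub>QA\<^esub> nf ?n)"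
    using add by (simp add: expand_vec Q.smult_mult_right del: nf.simps)
  also have "\<dots> = expand (left_op g (vec k ?n))"
    unfolding gn_nf k using add by (simp add: left_op_smult expand_smult left_op_simps del: left_term.simps)
  finally show ?case using add by (simp add: expand_simps left_op_simps Q.A.r_distr del: left_term.simps)
qed (simp add: expand_simps left_op_simps)

lemma expand_gn:
  assumes "f \<in> carrier VV" shows "expand f \<otimes>\<^bsub>QA\<^esub> gn g = expand (right_op g f)"
  using assms
proof (induction rule: VV_induct)
  case (add k a b c d f)
  let ?n = "(a, b, c, d)"
  have k: "vec k ?n = k \<odot>\<^bsub>VV\<^esub> vec \<one> ?n" using add by (simp add: vec_smult)
  have "expand (vec k ?n) \<otimes>\<^bsub>QA\<^esub> gn g = k \<odot>\<^bsub>QA\<^esub> (nf ?n \<otimes>\<^bsub>QA\<^esub> gn g)"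
    using add by (simp add: expand_vec Q.smult_mult_left del: nf.simps)
  also have "\<dots> = expand (right_op g (vec k ?n))"
    unfolding nf_gn k using add by (simp add: right_op_smult expand_smult right_op_simps del: right_term.simps)
  finally show ?case using add by (simp add: expand_simps right_op_simps Q.A.l_distr del: right_term.simps)
qed (simp add: expand_simps right_op_simps)

lemma coords_pow:
  "z \<in> carrier QA \<Longrightarrow> coords (gn g [^]\<^bsub>QA\<^esub> (n::nat) \<otimes>\<^bsub>QA\<^esub> z) = (left_op g ^^ n) (coords z)"
proof (induction n)
  case (Suc n)
  have "gn g [^]\<^bsub>QA\<^esub> Suc n \<otimes>\<^bsub>QA\<^esub> z = gn g \<otimes>\<^bsub>QA\<^esub> (gn g [^]\<^bsub>QA\<^esub> n \<otimes>\<^bsub>QA\<^esub> z)"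
    using Suc by (simp add: pow_Suc_left_assoc del: Group.nat_pow_Suc Q.A.nat_pow_Suc nat_pow_Suc)
  then show ?case using Suc by (simp add: coords_gn del: Group.nat_pow_Suc Q.A.nat_pow_Suc nat_pow_Suc)
qed simp

text \<open>Starting from the basis vector of \<open>1\<close>, applying \<open>t\<close>, \<open>s\<close>, \<open>x\<close>, \<open>y\<close> in this order only raises
  the respective exponent: all correction factors are \<open>1\<close> and the lowering part of \<open>x\<close> is zero as
  long as the exponent of \<open>y\<close> is \<open>0\<close>.\<close>

lemma coords_nf: "coords (nf n) = vec \<one> n"
proof -
  obtain a b c d where n: "n = (a, b, c, d)" by (cases n)
  have T: "(left_op GT ^^ k) (vec \<one> (0, 0, 0, 0)) = vec \<one> (0, 0, 0, k)" for k
    by (induction k) (simp_all add: left_op_vec)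
  have S: "(left_op GS ^^ k) (vec \<one> (0, 0, 0, d)) = vec \<one> (0, 0, k, d)" for k
    by (induction k) (simp_all add: left_op_vec)
  have X: "(left_op GX ^^ k) (vec \<one> (0, 0, c, d)) = vec \<one> (0, k, c, d)" for k
    by (induction k) (simp_all add: left_op_vec vec_zero)
  have Y: "(left_op GY ^^ k) (vec \<one> (0, b, c, d)) = vec \<one> (k, b, c, d)" for k
    by (induction k) (simp_all add: left_op_vec)
  have "coords (gT [^]\<^bsub>QA\<^esub> d) = vec \<one> (0, 0, 0, d)"
    using coords_pow[of "\<one>\<^bsub>QA\<^esub>" GT d] by (simp add: coords_one T)
  then show ?thesis unfolding n by (simp add: coords_pow S X Y)
qed

lemma coords_expand:
  assumes "f \<in> carrier VV" shows "coords (expand f) = f"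
  using assms
proof (induction rule: VV_induct)
  case zero
  then show ?case
    by (simp add: expand_simps additive_map_zero[OF Q.M.abelian_group_axioms V.abelian_group_F coords_additive])
next
  case (add k a b c d f)
  then show ?case
    by (simp add: expand_simps additive_map_add[OF coords_additive] expand_vec coords_smult coords_nf vec_smult del: nf.simps)
qed

lemma nf_origin: "nf origin = \<one>\<^bsub>QA\<^esub>"
  by simp

text \<open>The combinations of normal monomials contain \<open>1\<close> and are stable under left multiplication
  with generators, so they contain all words.\<close>

lemma expand_surj:
  assumes "z \<in> carrier QA" shows "\<exists>f \<in> carrier VV. z = expand f"
proof -
  have word: "\<exists>f \<in> carrier VV. I.proj (word \<one> w) = expand f" for w
  proof (induction w)
    case Nil
    have "I.proj (word \<one> []) = expand (vec \<one> origin)"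
      by (simp add: expand_vec word_one[symmetric] proj_simps(4))
    then show ?case using vec_closed one_closed by blast
  next
    case (Cons g w)
    then show ?case unfolding proj_word_Cons using gn_expand left_op_simps(1) by metis
  qed
  obtain x where x: "x \<in> carrier FF" "z = I.proj x" using assms unfolding QA_eq I.carrier_Q by blast
  have "\<exists>f \<in> carrier VV. I.proj x = expand f" using x(1)
  proof (induction rule: FF_induct)
    case zero
    have "I.proj \<zero>\<^bsub>FF\<^esub> = expand \<zero>\<^bsub>VV\<^esub>" using I.proj_zero by (simp add: QA_eq[symmetric] expand_simps)
    then show ?case using V.F.zero_closed by blast
  next
    case (add c w g)
    obtain f where f: "f \<in> carrier VV" "I.proj (word \<one> w) = expand f" using word by blast
    obtain h where h: "h \<in> carrier VV" "I.proj g = expand h" using add by blast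
    have "word c w = c \<odot>\<^bsub>FF\<^esub> word \<one> w" using add by (simp add: word_smult)
    then have "I.proj (word c w \<oplus>\<^bsub>FF\<^esub> g) = expand (c \<odot>\<^bsub>VV\<^esub> f \<oplus>\<^bsub>VV\<^esub> h)"
      using add f h by (simp add: proj_simps expand_simps expand_smult)
    then show ?case using add(1) f(1) h(1) by (metis V.F.a_closed VF.smult_closed)
  qed
  then show ?thesis using x by simp
qed

lemma expand_coords: "z \<in> carrier QA \<Longrightarrow> expand (coords z) = z"
  using expand_surj coords_expand by metis

lemma coords_closed: "z \<in> carrier QA \<Longrightarrow> coords z \<in> carrier VV"
  by (rule additive_map_closed[OF coords_additive])

lemma coords_right_gn:
  assumes "z \<in> carrier QA" shows "coords (z \<otimes>\<^bsub>QA\<^esub> gn g) = right_op g (coords z)"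
  using expand_gn[of "coords z" g] coords_expand[of "right_op g (coords z)"] assms
  by (simp add: expand_coords coords_closed right_op_simps)

lemma VV_apply: "(f \<oplus>\<^bsub>VV\<^esub> g) n = f n \<oplus> g n" "\<zero>\<^bsub>VV\<^esub> n = \<zero>"
  by (simp_all add: V.F_simps)

lemma VV_value [simp]: "f \<in> carrier VV \<Longrightarrow> f n \<in> carrier K"
  using V.carrierD(1) by fastforce

lemma vec_apply: "vec k n n' = (if n' = n then k else \<zero>)"
  by (simp add: single_def)

lemma operator_coefficients:
  assumes "f \<in> carrier VV"
  shows "left_op GX f (a, 0, c, d) = qint (Suc a) \<otimes> f (Suc a, 0, c, d)"
    and "left_op GX f (a, Suc b, c, d) = p [^] a \<otimes> f (a, b, c, d) \<oplus> qint (Suc a) \<otimes> f (Suc a, Suc b, c, d)"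
    and "right_op GX f (a, 0, c, d) = \<zero>"
    and "right_op GX f (a, Suc b, c, d) = m [^] d \<otimes> l [^] c \<otimes> f (a, b, c, d)"
    and "left_op GY f (0, b, c, d) = \<zero>"
    and "right_op GY f (0, b, c, d) = inv m [^] d \<otimes> inv l [^] c \<otimes> qint (Suc b) \<otimes> f (0, Suc b, c, d)"
    and "left_op GS f (a, b, Suc c, d) = inv l [^] a \<otimes> l [^] b \<otimes> f (a, b, c, d)"
    and "right_op GS f (a, b, Suc c, d) = inv q [^] d \<otimes> f (a, b, c, d)"
    and "left_op GT f (a, b, c, Suc d) = inv m [^] a \<otimes> (m [^] b \<otimes> inv q [^] c) \<otimes> f (a, b, c, d)"
    and "right_op GT f (a, b, c, Suc d) = f (a, b, c, d)"
proof -
  note step = left_op_simps right_op_simps left_op_vec right_op_vec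
  note at_point = VV_apply vec_apply r_distr m_comm
  show "left_op GX f (a, 0, c, d) = qint (Suc a) \<otimes> f (Suc a, 0, c, d)"
    using assms
  proof (induction rule: VV_induct)
    case (add k a' b' c' d' g)
    then show ?case by (cases a') (simp_all add: step del: qint.simps(2), auto simp: at_point a_ac simp del: qint.simps(2))
  qed (simp only: step, simp add: at_point del: qint.simps(2))
  show "left_op GX f (a, Suc b, c, d) = p [^] a \<otimes> f (a, b, c, d) \<oplus> qint (Suc a) \<otimes> f (Suc a, Suc b, c, d)"
    using assms
  proof (induction rule: VV_induct)
    case (add k a' b' c' d' g)
    then show ?case by (cases a') (simp_all add: step del: qint.simps(2), auto simp: at_point a_ac simp del: qint.simps(2))
  qed (simp only: step, simp add: at_point del: qint.simps(2))
  show "right_op GX f (a, 0, c, d) = \<zero>"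
    using assms by (induction rule: VV_induct) (simp_all add: step, auto simp: at_point)
  show "right_op GX f (a, Suc b, c, d) = m [^] d \<otimes> l [^] c \<otimes> f (a, b, c, d)"
    using assms by (induction rule: VV_induct) (simp_all add: step, auto simp: at_point)
  show "left_op GY f (0, b, c, d) = \<zero>"
    using assms by (induction rule: VV_induct) (simp_all add: step, auto simp: at_point)
  show "right_op GY f (0, b, c, d) = inv m [^] d \<otimes> inv l [^] c \<otimes> qint (Suc b) \<otimes> f (0, Suc b, c, d)"
    using assms
  proof (induction rule: VV_induct)
    case (add k a' b' c' d' g)
    then show ?case by (cases b') (simp_all add: step del: qint.simps(2), auto simp: at_point a_ac simp del: qint.simps(2))
  qed (simp only: step, simp add: at_point del: qint.simps(2))
  show "left_op GS f (a, b, Suc c, d) = inv l [^] a \<otimes> l [^] b \<otimes> f (a, b, c, d)"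
    using assms by (induction rule: VV_induct) (simp_all add: step, auto simp: at_point)
  show "right_op GS f (a, b, Suc c, d) = inv q [^] d \<otimes> f (a, b, c, d)"
    using assms by (induction rule: VV_induct) (simp_all add: step, auto simp: at_point)
  show "left_op GT f (a, b, c, Suc d) = inv m [^] a \<otimes> (m [^] b \<otimes> inv q [^] c) \<otimes> f (a, b, c, d)"
    using assms by (induction rule: VV_induct) (simp_all add: step, auto simp: at_point)
  show "right_op GT f (a, b, c, Suc d) = f (a, b, c, d)"
    using assms by (induction rule: VV_induct) (simp_all add: step, auto simp: at_point)
qed

end

locale generic_quantum_parameters = quantum_parameters +
  assumes p_generic: "\<not> root_of_unity K p" and q_generic: "\<not> root_of_unity K q"
begin

lemma qint_nonzero: "qint (Suc n) \<noteq> \<zero>"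
proof
  assume "qint (Suc n) = \<zero>"
  then have "p [^] Suc n \<ominus> \<one> = \<zero>" using qint_geometric[of "Suc n"] by (simp del: qint.simps Group.nat_pow_Suc nat_pow_Suc)
  then have "p [^] Suc n = \<one>" by (simp del: Group.nat_pow_Suc nat_pow_Suc)
  then show False using p_generic unfolding root_of_unity_def by (metis Suc_le_mono One_nat_def le0)
qed

lemma inv_q_power: "inv q [^] Suc n \<noteq> \<one>"
proof
  assume *: "inv q [^] Suc n = \<one>"
  have "q [^] Suc n = q [^] Suc n \<otimes> inv q [^] Suc n" unfolding * by (simp del: Group.nat_pow_Suc nat_pow_Suc)
  also have "\<dots> = (q \<otimes> inv q) [^] Suc n" by (intro nat_pow_distrib[symmetric]) auto
  also have "\<dots> = \<one>" by (simp only: params_inv nat_pow_one)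
  finally show False using q_generic unfolding root_of_unity_def by (metis Suc_le_mono One_nat_def le0)
qed

lemma mult_eq_zero: "x \<in> carrier K \<Longrightarrow> y \<in> carrier K \<Longrightarrow> x \<otimes> y = \<zero> \<Longrightarrow> x \<noteq> \<zero> \<Longrightarrow> y = \<zero>"
  using integral by blast

lemma fixed_by_scalar: "x \<in> carrier K \<Longrightarrow> y \<in> carrier K \<Longrightarrow> x \<otimes> y = y \<Longrightarrow> x \<noteq> \<one> \<Longrightarrow> y = \<zero>"
  by (metis l_one m_rcancel one_closed)

lemma pow_nonzero: "x \<in> carrier K \<Longrightarrow> x \<noteq> \<zero> \<Longrightarrow> x [^] (n::nat) \<noteq> \<zero>"
  by (induction n) (auto dest: integral)

text \<open>Comparing coefficients, \<open>x\<close> forces \<open>f (a + 1, b + 1, c, d) = 0\<close> as soon as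
  \<open>f (a, b, c, d) = 0\<close>, and it kills \<open>f (a, 0, c, d)\<close> for \<open>a > 0\<close>; \<open>y\<close> kills \<open>f (0, b, c, d)\<close> for
  \<open>b > 0\<close>. This disposes of all \<open>a \<noteq> b\<close>. On the diagonal \<open>s\<close> and \<open>t\<close> scale the coefficients by
  powers of \<open>inv q\<close> and leave \<open>c = d = 0\<close>, where \<open>x\<close> starts the propagation of zeros at
  \<open>a = b = 1\<close>.\<close>

lemma central_coords_supported_at_origin:
  assumes f: "f \<in> carrier VV" and comm: "\<And>g. left_op g f = right_op g f" and n: "n \<noteq> origin"
  shows "f n = \<zero>"
proof -
  note [simp] = VV_value[OF f]
  have fc: "f v \<in> carrier K" for v by simp
  have comm': "left_op g f v = right_op g f v" for g v using comm by simp
  have step: "f (Suc a, Suc b, c, d) = \<zero>" if z: "f (a, b, c, d) = \<zero>" for a b c d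
  proof -
    have "qint (Suc a) \<otimes> f (Suc a, Suc b, c, d) = \<zero>"
      using comm'[of GX "(a, Suc b, c, d)"] unfolding operator_coefficients[OF f] z by (simp del: qint.simps)
    then show ?thesis by (rule mult_eq_zero[rotated 2]) (simp_all add: qint_nonzero del: qint.simps)
  qed
  have right_edge: "f (Suc a, 0, c, d) = \<zero>" for a c d
  proof -
    have "qint (Suc a) \<otimes> f (Suc a, 0, c, d) = \<zero>"
      using comm'[of GX "(a, 0, c, d)"] unfolding operator_coefficients[OF f] .
    then show ?thesis by (rule mult_eq_zero[rotated 2]) (simp_all add: qint_nonzero del: qint.simps)
  qed
  have left_edge: "f (0, Suc b, c, d) = \<zero>" for b c d
  proof -
    have nz: "inv m [^] d \<noteq> \<zero>" "inv l [^] c \<noteq> \<zero>"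
      using params_inv(2,3) by (intro pow_nonzero; force)+
    have "inv m [^] d \<otimes> inv l [^] c \<otimes> qint (Suc b) \<otimes> f (0, Suc b, c, d) = \<zero>"
      using comm'[of GY "(0, b, c, d)"] unfolding operator_coefficients[OF f] by simp
    then show ?thesis
      by (rule mult_eq_zero[rotated 2])
        (use nz qint_nonzero[of b] in \<open>auto simp: integral_iff simp del: qint.simps\<close>)
  qed
  have off: "f (a, b, c, d) = \<zero>" if "a \<noteq> b" for a b c d
    using that
  proof (induction a arbitrary: b)
    case 0
    then show ?case using left_edge by (cases b) auto
  next
    case (Suc a)
    then show ?case using right_edge step by (cases b) auto
  qed
  have dzero: "f (a, a, c, Suc d) = \<zero>" for a c d
  proof -
    have "inv l [^] a \<otimes> l [^] a = \<one>"
      by (simp add: nat_pow_distrib[symmetric] params_inv)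
    then have "inv q [^] Suc d \<otimes> f (a, a, c, Suc d) = f (a, a, c, Suc d)"
      using comm'[of GS "(a, a, Suc c, Suc d)"] unfolding operator_coefficients[OF f] by (simp del: Group.nat_pow_Suc nat_pow_Suc)
    then show ?thesis by (rule fixed_by_scalar[rotated 2]) (use inv_q_power in auto)
  qed
  have czero: "f (a, a, Suc c, d) = \<zero>" for a c d
  proof -
    have "inv m [^] a \<otimes> (m [^] a \<otimes> inv q [^] Suc c) = inv q [^] Suc c"
      by (simp add: m_assoc[symmetric] nat_pow_distrib[symmetric] params_inv del: Group.nat_pow_Suc nat_pow_Suc)
    then have "inv q [^] Suc c \<otimes> f (a, a, Suc c, d) = f (a, a, Suc c, d)"
      using comm'[of GT "(a, a, Suc c, Suc d)"] unfolding operator_coefficients[OF f] by (simp del: Group.nat_pow_Suc nat_pow_Suc)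
    then show ?thesis by (rule fixed_by_scalar[rotated 2]) (use inv_q_power in auto)
  qed
  have diag: "f (Suc a, Suc a, 0, 0) = \<zero>" for a
  proof (induction a)
    case 0
    have "f origin \<oplus> f (Suc 0, Suc 0, 0, 0) = f origin"
      using comm'[of GX "(0, Suc 0, 0, 0)"] unfolding operator_coefficients[OF f] by simp
    then show ?case using fc by simp
  next
    case (Suc a)
    then show ?case by (rule step)
  qed
  obtain a b c d where abcd: "n = (a, b, c, d)" by (cases n)
  show ?thesis
  proof (cases "a = b")
    case True
    then show ?thesis using n dzero czero diag unfolding abcd by (cases c; cases d; cases a) auto
  qed (use off abcd in simp)
qed

lemma center_scalar: "ring_center QA \<subseteq> (\<lambda>c. c \<odot>\<^bsub>QA\<^esub> \<one>\<^bsub>QA\<^esub>) ` carrier K"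
proof
  fix z assume z: "z \<in> ring_center QA"
  then have zQ: "z \<in> carrier QA" by (simp add: ring_center_def)
  let ?f = "coords z"
  have f: "?f \<in> carrier VV" using zQ by (rule coords_closed)
  have "left_op g ?f = right_op g ?f" for g
    using coords_gn[OF zQ, of g] coords_right_gn[OF zQ, of g] z by (simp add: ring_center_def)
  then have "?f n = \<zero>" if "n \<noteq> origin" for n using central_coords_supported_at_origin[OF f] that by blast
  then have "?f = vec (?f origin) origin" by (auto simp: vec_apply fun_eq_iff)
  then have "z = expand (vec (?f origin) origin)" using expand_coords[OF zQ] by simp
  also have "\<dots> = ?f origin \<odot>\<^bsub>QA\<^esub> \<one>\<^bsub>QA\<^esub>" using f by (simp add: expand_vec nf_origin del: nf.simps)
  finally show "z \<in> (\<lambda>c. c \<odot>\<^bsub>QA\<^esub> \<one>\<^bsub>QA\<^esub>) ` carrier K" using f by (metis VV_value image_eqI)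
qed

lemma coords_scalar: "c \<in> carrier K \<Longrightarrow> coords (c \<odot>\<^bsub>QA\<^esub> \<one>\<^bsub>QA\<^esub>) = vec c origin"
  by (simp add: coords_smult coords_one vec_smult)

lemma center_bij: "bij_betw (\<lambda>c. c \<odot>\<^bsub>QA\<^esub> \<one>\<^bsub>QA\<^esub>) (carrier K) (ring_center QA)"
  unfolding bij_betw_def
proof
  show "inj_on (\<lambda>c. c \<odot>\<^bsub>QA\<^esub> \<one>\<^bsub>QA\<^esub>) (carrier K)"
  proof (rule inj_onI)
    fix c d assume "c \<in> carrier K" "d \<in> carrier K" "c \<odot>\<^bsub>QA\<^esub> \<one>\<^bsub>QA\<^esub> = d \<odot>\<^bsub>QA\<^esub> \<one>\<^bsub>QA\<^esub>"
    then have "vec c origin origin = vec d origin origin" using coords_scalar by metis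
    then show "c = d" by (simp add: vec_apply)
  qed
  have "(\<lambda>c. c \<odot>\<^bsub>QA\<^esub> \<one>\<^bsub>QA\<^esub>) ` carrier K \<subseteq> ring_center QA"
    by (auto simp: ring_center_def Q.smult_mult_left Q.smult_mult_right)
  then show "(\<lambda>c. c \<odot>\<^bsub>QA\<^esub> \<one>\<^bsub>QA\<^esub>) ` carrier K = ring_center QA" using center_scalar by blast
qed

lemma QA_nontrivial: "\<one>\<^bsub>QA\<^esub> \<noteq> \<zero>\<^bsub>QA\<^esub>"
proof
  assume "\<one>\<^bsub>QA\<^esub> = \<zero>\<^bsub>QA\<^esub>"
  then have "vec \<one> origin = \<zero>\<^bsub>VV\<^esub>"
    using coords_one additive_map_zero[OF Q.M.abelian_group_axioms V.abelian_group_F coords_additive] by simp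
  then have "vec \<one> origin origin = \<zero>" by (simp add: VV_apply)
  then show False by (simp add: vec_apply)
qed

end

theorem theorem1p2:
  fixes K :: "('k, 'z) ring_scheme" and p q l m :: 'k
  assumes "field K"
    and "p \<in> carrier K - {\<zero>\<^bsub>K\<^esub>}" and "q \<in> carrier K - {\<zero>\<^bsub>K\<^esub>}"
    and "l \<in> carrier K - {\<zero>\<^bsub>K\<^esub>}" and "m \<in> carrier K - {\<zero>\<^bsub>K\<^esub>}"
    and "\<not> root_of_unity K p" and "\<not> root_of_unity K q"
  shows "bij_betw (\<lambda>c. c \<odot>\<^bsub>quantum_alg K p q l m\<^esub> \<one>\<^bsub>quantum_alg K p q l m\<^esub>)
           (carrier K) (ring_center (quantum_alg K p q l m))
    \<and> universally_cancellative K (quantum_alg K p q l m) TYPE('r) TYPE('b)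
    \<and> strongly_cancellative K (quantum_alg K p q l m) TYPE('b)
    \<and> cancellative K (quantum_alg K p q l m) TYPE('b)"
proof -
  interpret generic_quantum_parameters K p q l m
    using assms
    by (intro generic_quantum_parameters.intro quantum_parameters.intro quantum_parameters_axioms.intro
        generic_quantum_parameters_axioms.intro)
  note trivial_center = assms(1) Q.assoc_algebra_axioms QA_nontrivial center_scalar
  show ?thesis
    by (intro conjI center_bij trivial_center_universally_cancellative[OF trivial_center]
        trivial_center_strongly_cancellative[OF trivial_center] trivial_center_cancellative[OF trivial_center])
qed

end
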